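(* Let $p(\cdot)\in\mathcal{P}(\mathbb{R}^n)\cap LH(\mathbb{R}^n)$ with $p_+<\infty$ and let $w\in\mathcal{A}_{p(\cdot)}$ be a scalar weight. Then there exists $r>1$ such that for all $s\in[1,r]$, $w\in\mathcal{A}_{s p(\cdot)}$.
   Context: Cubes in $\mathbb{R}^n$ have sides parallel to the coordinate axes. $\mathcal{P}(\mathbb{R}^n)$ is the set of exponent functions, i.e. Lebesgue measurable $p(\cdot):\mathbb{R}^n\to[1,\infty]$; $p_+=\operatorname{ess\,sup}_{\mathbb{R}^n}p$, $p_-=\operatorname{ess\,inf}_{\mathbb{R}^n}p$. The conjugate exponent $p'(\cdot)$ satisfies $\frac1{p(x)}+\frac1{p'(x)}=1$ (with $1/\infty=0$). With $\Omega_\infty=\{x:p(x)=\infty\}$, the modular is $\rho_{p(\cdot)}(f)=\int_{\mathbb{R}^n\setminus\Omega_\infty}|f(x)|^{p(x)}dx+\|f\|_{L^\infty(\Omega_\infty)}$ and the norm is $\|f\|_{L^{p(\cdot)}(\mathbb{R}^n)}=\inf\{\lambda>0:\rho_{p(\cdot)}(f/\lambda)\le1\}$. Log-Hölder continuity: $u(\cdot):\mathbb{R}^n\to\mathbb{R}$ is in $LH(\mathbb{R}^n)$ if there is $C_0$ with $|u(x)-u(y)|\le\frac{C_0}{-\log|x-y|}$ whenever $|x-y|<1/2$, and there are constants $C_\infty,u_\infty$ with $|u(x)-u_\infty|\le\frac{C_\infty}{\log(e+|x|)}$ for all $x$. A (scalar) weight is a non-negative locally integrable function $w$ with $0<w(x)<\infty$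 a.e. For an exponent function $p(\cdot)$, $w\in\mathcal{A}_{p(\cdot)}$ means $[w]_{\mathcal{A}_{p(\cdot)}}=\sup_Q|Q|^{-1}\|w\chi_Q\|_{L^{p(\cdot)}(\mathbb{R}^n)}\|w^{-1}\chi_Q\|_{L^{p'(\cdot)}(\mathbb{R}^n)}<\infty$, the supremum being over all cubes $Q\subset\mathbb{R}^n$. *)

theory Defs
  imports "HOL-Analysis.Analysis" "HOL-Probability.Essential_Supremum"
begin

section \<open>Variable exponents\<close>

definition exponent_function :: "(real ^ 'n \<Rightarrow> ennreal) \<Rightarrow> bool" where
  "exponent_function p \<longleftrightarrow> p \<in> borel_measurable lebesgue \<and> (\<forall>x. 1 \<le> p x)"

text \<open>The conjugate exponent is \<open>1 / (1 - 1 / p)\<close>; in \<^typ>\<open>ennreal\<close>, where \<open>1 / 0 = \<infinity>\<close> and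
  \<open>1 / \<infinity> = 0\<close>, this covers \<open>p = 1\<close> and \<open>p = \<infinity>\<close> as well.\<close>

definition conj_exponent :: "('a \<Rightarrow> ennreal) \<Rightarrow> 'a \<Rightarrow> ennreal" where
  "conj_exponent p x = inverse (1 - inverse (p x))"

lemma conj_exponent_sum:
  assumes "1 \<le> p x"
  shows "inverse (p x) + inverse (conj_exponent p x) = 1"
proof -
  have "inverse e \<le> 1" if "1 \<le> e" for e :: ennreal
    using that
    by (cases e) (auto simp: inverse_ennreal field_simps simp flip: ennreal_1)
  then have "inverse (p x) \<le> 1"
    using assms by blast
  moreover have "inverse (conj_exponent p x) = 1 - inverse (p x)"
    using one_divide_one_divide_ennreal[of "1 - inverse (p x)"]
    by (simp add: conj_exponent_def divide_ennreal_def)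
  ultimately show ?thesis
    by (simp add: add_diff_inverse_ennreal)
qed

text \<open>At \<open>x = y\<close> the left-hand side of the local condition is \<open>0\<close>, and so is the right-hand side,
  since \<^term>\<open>ln (0 :: real) = 0\<close> and division by \<open>0\<close> gives \<open>0\<close>; the condition is vacuous there,
  as it is under the reading \<open>- log 0 = \<infinity>\<close>.\<close>

definition log_Holder :: "(real ^ 'n \<Rightarrow> real) \<Rightarrow> bool" where
  "log_Holder u \<longleftrightarrow>
     (\<exists>C0. \<forall>x y. norm (x - y) < 1 / 2 \<longrightarrow> \<bar>u x - u y\<bar> \<le> C0 / (- ln (norm (x - y)))) \<and>
     (\<exists>Cinf uinf. \<forall>x. \<bar>u x - uinf\<bar> \<le> Cinf / ln (exp 1 + norm x))"


section \<open>The norm of the variable Lebesgue space\<close>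

text \<open>Modular and norm are defined on functions with values in \<open>[0, \<infinity>]\<close>, which play the role of
  \<open>\<bar>f\<bar>\<close>. The value \<open>\<infinity>\<close> is needed for weights and their reciprocals, which are only almost
  everywhere finite.\<close>

definition ennreal_powr :: "ennreal \<Rightarrow> real \<Rightarrow> ennreal" where
  "ennreal_powr t a = (if t = \<infinity> then \<infinity> else ennreal (enn2real t powr a))"

definition Omega_inf :: "(real ^ 'n \<Rightarrow> ennreal) \<Rightarrow> (real ^ 'n) set" where
  "Omega_inf p = {x. p x = \<infinity>}"

definition modular :: "(real ^ 'n \<Rightarrow> ennreal) \<Rightarrow> (real ^ 'n \<Rightarrow> ennreal) \<Rightarrow> ennreal" where
  "modular p f =
     (\<integral>\<^sup>+x\<in>- Omega_inf p. ennreal_powr (f x) (enn2real (p x)) \<partial>lebesgue) +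
     esssup (restrict_space lebesgue (Omega_inf p)) f"

definition var_norm :: "(real ^ 'n \<Rightarrow> ennreal) \<Rightarrow> (real ^ 'n \<Rightarrow> ennreal) \<Rightarrow> ennreal" where
  "var_norm p f = Inf {ennreal l | l. 0 < l \<and> modular p (\<lambda>x. f x / ennreal l) \<le> 1}"


section \<open>Weights and the Muckenhoupt condition\<close>

definition weight :: "(real ^ 'n \<Rightarrow> ennreal) \<Rightarrow> bool" where
  "weight w \<longleftrightarrow>
     w \<in> borel_measurable lebesgue \<and>
     (\<forall>K. compact K \<longrightarrow> (\<integral>\<^sup>+x\<in>K. w x \<partial>lebesgue) < \<infinity>) \<and>
     (AE x in lebesgue. 0 < w x \<and> w x < \<infinity>)"

text \<open>Cubes are taken closed; the boundary is a null set and does not affect the constant below.\<close>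

definition cubes :: "(real ^ 'n) set set" where
  "cubes = {cbox a (\<chi> i. a $ i + l) | a l. 0 < l}"

text \<open>For a weight \<open>w\<close> neither norm vanishes, so the convention \<open>0 * \<infinity> = 0\<close> of \<^typ>\<open>ennreal\<close>
  never hides an infinite factor. Off the cube the products are \<open>0\<close> even where \<open>w\<close> or its
  reciprocal is infinite.\<close>

definition Ap_const :: "(real ^ 'n \<Rightarrow> ennreal) \<Rightarrow> (real ^ 'n \<Rightarrow> ennreal) \<Rightarrow> ennreal" where
  "Ap_const p w =
     (SUP Q\<in>cubes. inverse (emeasure lebesgue Q)
        * var_norm p (\<lambda>x. w x * indicator Q x)
        * var_norm (conj_exponent p) (\<lambda>x. inverse (w x) * indicator Q x))"

definition Ap_class :: "(real ^ 'n \<Rightarrow> ennreal) \<Rightarrow> (real ^ 'n \<Rightarrow> ennreal) set" where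
  "Ap_class p = {w. weight w \<and> Ap_const p w < \<infinity>}"

end

theory Submission
  imports Defs
begin

text \<open>Right-openness of the condition \<open>\<A>\<^sub>p\<close> comes from a reverse Hoelder inequality for the ordinary
weight \<open>W = w\<^sup>p\<close>. Write \<open>P\<close> for an upper bound of the exponent.

For a cube \<open>Q\<close> let \<open>a\<close> and \<open>b\<close> be at least, and at most twice, the norms of \<open>w\<close> and of \<open>1 / w\<close> on \<open>Q\<close>,
so that \<open>a b \<le> K \<bar>Q\<bar>\<close>. Young's inequality turns this product bound into a statement about the
density \<open>V = (w / a)\<^sup>p\<close> alone (\<open>spread_of_dual\<close>): its integral over \<open>Q\<close> is at most \<open>1\<close>, and its
integral over any \<open>E \<subseteq> Q\<close> is at least a constant times \<open>(\<bar>E\<bar> / \<bar>Q\<bar>)\<^sup>P\<close>. The locale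
\<open>normalised_weight\<close> starts from these two facts.

The densities \<open>V\<close> and \<open>W\<close> differ by the factor \<open>a powr - p x\<close>, which varies over \<open>Q\<close>. If the side of
\<open>Q\<close> is at most \<open>shifted_norm x = exp 1 + \<bar>x\<bar>\<close> for all \<open>x\<close> in \<open>Q\<close> (the cube is distant), the two
logarithmic conditions make the factor constant up to a bounded ratio (\<open>distant_comparability\<close>), because \<open>\<bar>ln a\<bar>\<close> is at most a multiple of
\<open>\<bar>ln (side)\<bar> + ln (shifted_norm x)\<close>. Any other cube lies in a cube centred at the origin and of comparable
size. On a large centred cube the exponent may be replaced by its limit at infinity, except on a
smaller centred cube whose side is a small power of the relevant size; there the mass is negligible,
since the mass of centred cubes grows polynomially (\<open>centred_upper\<close>, \<open>centred_lower\<close>). Hence \<open>W\<close>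
is a Muckenhoupt \<open>A\<^sub>\<infinity>\<close> weight (\<open>muckenhoupt\<close>), and the stopping time argument of Calderon and Zygmund
on dyadic cubes gives the reverse Hoelder inequality (\<open>reverse_Holder_on_cubes\<close>).

To return to norms, let \<open>s = 1 + e\<close>. It suffices to find, for each distant or centred cube, a number
\<open>\<nu> > 0\<close>, comparable to the norm of the indicator of \<open>Q\<close> in \<open>L\<^sup>p\<close>, such that
\<open>\<integral>\<^sub>Q \<nu> powr - p\<close> and \<open>\<integral>\<^sub>Q V powr s * \<nu> powr (e * p)\<close> are bounded (\<open>admissible\<close>). Then \<open>w\<close> has norm at
most \<open>C a \<nu> powr - (e / s)\<close> for the exponent \<open>s p\<close>, and \<open>1 / w\<close> has norm at most
\<open>C b \<nu> powr (e / s)\<close> for the conjugate of \<open>s p\<close>; the powers of \<open>\<nu>\<close> cancel in the product. The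
number \<open>\<nu>\<close> is a power of the side. Freezing the exponent as before gives the bound for the first
integral and reduces the one for the second to the reverse Hoelder inequality
(\<open>normalised_higher_integrability\<close>).\<close>

section \<open>Stopping times for nested partitions\<close>

lemma emeasure_disjoint_Union_le:
  assumes F: "countable F" "disjoint F" "F \<subseteq> sets M"
    and N: "sets N = sets M" and B: "B \<in> sets M" and C: "C \<in> sets M"
    and le: "\<And>A. A \<in> F \<Longrightarrow> c * emeasure M (B \<inter> A) \<le> emeasure N (C \<inter> A)"
  shows "c * emeasure M (B \<inter> \<Union>F) \<le> emeasure N (C \<inter> \<Union>F)"
proof -
  have dis: "disjoint_family_on (\<lambda>A. Z \<inter> A) F" for Z :: "'a set"
    using F(2) by (auto simp: disjoint_family_on_def disjoint_def)
  have M: "emeasure M (B \<inter> \<Union>F) = (\<integral>\<^sup>+A. emeasure M (B \<inter> A) \<partial>count_space F)"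
    unfolding Int_Union using F(3) B by (intro emeasure_UN_countable F(1) dis) auto
  have N: "emeasure N (C \<inter> \<Union>F) = (\<integral>\<^sup>+A. emeasure N (C \<inter> A) \<partial>count_space F)"
    unfolding Int_Union using F(3) C N by (intro emeasure_UN_countable F(1) dis) auto
  show ?thesis
    unfolding M N by (subst nn_integral_cmult[symmetric]) (auto intro!: nn_integral_mono le)
qed

text \<open>The cell \<open>D k x\<close> is the set of generation \<open>k\<close> that contains \<open>x\<close>. Describing a filtration by the cell of
a point turns the choice of a maximal cell into the choice of a least generation.\<close>

locale nested_partitions =
  fixes X :: "'a set" and D :: "nat \<Rightarrow> 'a \<Rightarrow> 'a set"
  assumes self: "x \<in> X \<Longrightarrow> x \<in> D k x"
    and sub: "x \<in> X \<Longrightarrow> D k x \<subseteq> X"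
    and part: "x \<in> X \<Longrightarrow> y \<in> D k x \<Longrightarrow> D k y = D k x"
    and nested: "x \<in> X \<Longrightarrow> D (Suc k) x \<subseteq> D k x"
    and countable_cells: "countable (D k ` X)"
begin

definition maximal_cells :: "('a set \<Rightarrow> bool) \<Rightarrow> 'a set set" where
  "maximal_cells S = {D k x | k x. x \<in> X \<and> S (D k x) \<and> (\<forall>j<k. \<not> S (D j x))}"

lemma antimono: "x \<in> X \<Longrightarrow> j \<le> k \<Longrightarrow> D k x \<subseteq> D j x"
  by (rule lift_Suc_antimono_le[of "\<lambda>k. D k x"]) (rule nested)

lemma same_cell: "x \<in> X \<Longrightarrow> y \<in> D k x \<Longrightarrow> j \<le> k \<Longrightarrow> D j y = D j x"
  using part[of x y j] antimono[of x j k] by auto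

lemma countable_maximal_cells: "countable (maximal_cells S)"
proof (rule countable_subset)
  show "maximal_cells S \<subseteq> (\<Union>k. D k ` X)" by (auto simp: maximal_cells_def)
qed (use countable_cells in auto)

text \<open>Two maximal cells with a common point \<open>z\<close> are both the cell of \<open>z\<close> at the first generation at which
\<open>S\<close> holds.\<close>

lemma disjoint_maximal_cells: "disjoint (maximal_cells S)"
proof (rule disjointI)
  fix A B assume "A \<in> maximal_cells S" "B \<in> maximal_cells S" "A \<noteq> B"
  then obtain k x l y where x: "A = D k x" "x \<in> X" "S (D k x)" "\<forall>j<k. \<not> S (D j x)"
    and y: "B = D l y" "y \<in> X" "S (D l y)" "\<forall>j<l. \<not> S (D j y)"
    by (auto simp: maximal_cells_def)
  show "A \<inter> B = {}"
  proof (rule ccontr)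
    assume "A \<inter> B \<noteq> {}"
    then obtain z where z: "z \<in> D k x" "z \<in> D l y" using x y by auto
    have 1: "D j z = D j x" if "j \<le> k" for j using same_cell z x that by blast
    have 2: "D j z = D j y" if "j \<le> l" for j using same_cell z y that by blast
    have "k = l"
      using 1[of k] 2[of l] 1[of l] 2[of k] x y by (metis linorder_neqE_nat order.refl less_imp_le)
    then show False using 1[of k] 2[of l] x y \<open>A \<noteq> B\<close> by auto
  qed
qed

lemma Union_maximal_cells: "\<Union>(maximal_cells S) = {x \<in> X. \<exists>k. S (D k x)}"
proof (intro equalityI subsetI)
  fix z assume "z \<in> \<Union>(maximal_cells S)"
  then obtain k x where "z \<in> D k x" "x \<in> X" "S (D k x)" by (auto simp: maximal_cells_def)
  then have "z \<in> X" "S (D k z)" using sub[of x k] part[of x z k] by auto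
  then show "z \<in> {x \<in> X. \<exists>k. S (D k x)}" by blast
next
  fix x assume "x \<in> {x \<in> X. \<exists>k. S (D k x)}"
  then have x: "x \<in> X" "\<exists>k. S (D k x)" by auto
  define k where "k = (LEAST k. S (D k x))"
  have "S (D k x)" "\<forall>j<k. \<not> S (D j x)"
    using LeastI_ex[OF x(2)] not_less_Least unfolding k_def by blast+
  then have "D k x \<in> maximal_cells S" using x by (auto simp: maximal_cells_def)
  then show "x \<in> \<Union>(maximal_cells S)" using self[OF x(1)] by blast
qed

end

section \<open>The reverse Hoelder inequality on a filtered space\<close>

text \<open>An abstract form of the dyadic setting, with \<open>M\<close> in the role of Lebesgue measure and \<open>N\<close> in the role of
the weighted measure. The hypothesis \<open>A_infinity\<close> is the Muckenhoupt condition for cells: a subset with a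
proportion of at most \<open>\<eta>\<close> of the \<open>M\<close>-mass carries a proportion of at most \<open>\<theta> < 1\<close> of the \<open>N\<close>-mass.\<close>

locale filtered_pair = nested_partitions "space M" D for M :: "'a measure" and D +
  fixes N :: "'a measure" and d \<eta> \<theta> :: real
  assumes sets_N: "sets N = sets M"
    and cells: "x \<in> space M \<Longrightarrow> D k x \<in> sets M"
    and top: "x \<in> space M \<Longrightarrow> D 0 x = space M"
    and parent: "x \<in> space M \<Longrightarrow> emeasure M (D k x) \<le> ennreal d * emeasure M (D (Suc k) x)"
    and A_infinity: "x \<in> space M \<Longrightarrow> E \<in> sets M \<Longrightarrow> E \<subseteq> D k x \<Longrightarrow>
        emeasure M E \<le> ennreal \<eta> * emeasure M (D k x) \<Longrightarrow>
        emeasure N E \<le> ennreal \<theta> * emeasure N (D k x)"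
    and d: "1 \<le> d" and \<eta>: "0 < \<eta>" "\<eta> < 1" and \<theta>: "0 < \<theta>" "\<theta> < 1"
begin

text \<open>The superlevel set of the maximal function of \<open>N\<close> with respect to \<open>M\<close>, given by the Calderon-Zygmund
cells at height \<open>l\<close>.\<close>

definition high :: "real \<Rightarrow> 'a set" where
  "high l = \<Union>(maximal_cells (\<lambda>A. ennreal l * emeasure M A < emeasure N A))"

lemma cells_measurable: "maximal_cells S \<subseteq> sets M"
  using cells by (auto simp: maximal_cells_def)

lemma high_measurable [measurable]: "high l \<in> sets M"
  unfolding high_def using countable_maximal_cells cells_measurable
  by (intro sets.countable_Union) auto

lemma mem_high_iff:
  "x \<in> high l \<longleftrightarrow> x \<in> space M \<and> (\<exists>k. ennreal l * emeasure M (D k x) < emeasure N (D k x))"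
  unfolding high_def Union_maximal_cells by auto

text \<open>The weak-type estimate inside one stopping cell. The stopping cells of a larger height that meet \<open>A\<close>
have a later generation, so they lie in \<open>A\<close>.\<close>

lemma measure_high_in_cell:
  assumes l: "0 < l" "l \<le> l'"
    and A: "A \<in> maximal_cells (\<lambda>A. ennreal l * emeasure M A < emeasure N A)"
  shows "ennreal l' * emeasure M (high l' \<inter> A) \<le> emeasure N A"
proof -
  let ?S = "\<lambda>l A. ennreal l * emeasure M A < emeasure N A"
  have mono: "?S l B" if "?S l' B" for B
  proof -
    have "ennreal l * emeasure M B \<le> ennreal l' * emeasure M B"
      using l by (intro mult_right_mono ennreal_leI) auto
    then show ?thesis using that by (rule le_less_trans)
  qed
  obtain k x where x: "A = D k x" "x \<in> space M" "?S l (D k x)" "\<forall>j<k. \<not> ?S l (D j x)"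
    using A by (auto simp: maximal_cells_def)
  define F where "F = {B \<in> maximal_cells (?S l'). B \<subseteq> A}"
  have "high l' \<inter> A = \<Union>F"
  proof (intro equalityI subsetI)
    fix y assume "y \<in> high l' \<inter> A"
    then obtain j z where z: "y \<in> D j z" "z \<in> space M" "?S l' (D j z)" "\<forall>i<j. \<not> ?S l' (D i z)"
      and y: "y \<in> D k x" by (auto simp: high_def maximal_cells_def x)
    have B: "D j z \<in> maximal_cells (?S l')" using z by (auto simp: maximal_cells_def)
    have "k \<le> j"
    proof (rule ccontr)
      assume "\<not> k \<le> j"
      then have "D j y = D j x" using same_cell[OF x(2) y] by auto
      moreover have "D j y = D j z" using same_cell[OF z(2,1)] by auto
      ultimately show False using mono[OF z(3)] x(4) \<open>\<not> k \<le> j\<close> by auto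
    qed
    then have "D j y \<subseteq> D k y" using antimono z sub by blast
    then have "D j z \<subseteq> A" using same_cell[OF x(2) y] same_cell[OF z(2,1)] x(1) by auto
    then show "y \<in> \<Union>F" using B z(1) by (auto simp: F_def)
  qed (auto simp: F_def high_def)
  moreover have "ennreal l' * emeasure M (space M \<inter> \<Union>F) \<le> emeasure N (space M \<inter> \<Union>F)"
  proof (rule emeasure_disjoint_Union_le)
    show "countable F" using countable_maximal_cells by (rule countable_subset[rotated]) (auto simp: F_def)
    show "disjoint F" using disjoint_maximal_cells
      by (rule pairwise_subset) (auto simp: F_def)
    show "F \<subseteq> sets M" using cells_measurable by (auto simp: F_def)
    fix B assume "B \<in> F"
    then have "?S l' B" "B \<in> sets M" using cells by (auto simp: F_def maximal_cells_def)
    then show "ennreal l' * emeasure M (space M \<inter> B) \<le> emeasure N (space M \<inter> B)"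
      by (simp add: sets.sets_into_space Int_absorb1)
  qed (auto simp: sets_N)
  moreover have F: "\<Union>F \<subseteq> A" and A': "A \<in> sets M" using cells x by (auto simp: F_def)
  moreover have "space M \<inter> \<Union>F = \<Union>F" using F sub[OF x(2), of k] x(1) by blast
  ultimately have "ennreal l' * emeasure M (high l' \<inter> A) \<le> emeasure N (\<Union>F)" by simp
  also have "\<dots> \<le> emeasure N A" using F A' sets_N by (intro emeasure_mono) auto
  finally show ?thesis .
qed

text \<open>The parent of a stopping cell \<open>A\<close> has average at most \<open>l\<close>, so \<open>A\<close> has average at most \<open>d l\<close>. Raising the
height by the factor \<open>d / \<eta>\<close> therefore leaves at most the proportion \<open>\<eta>\<close> of \<open>A\<close>, and
\<open>A_infinity\<close> applies.\<close>

lemma high_decay: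
  assumes l: "0 < l" and start: "emeasure N (space M) \<le> ennreal l * emeasure M (space M)"
  shows "emeasure N (high (d / \<eta> * l)) \<le> ennreal \<theta> * emeasure N (high l)"
proof -
  let ?S = "\<lambda>A. ennreal l * emeasure M A < emeasure N A"
  let ?l' = "d / \<eta> * l"
  have "1 \<le> d / \<eta>" using d \<eta> by (simp add: le_divide_eq)
  then have l': "l \<le> ?l'" "0 < ?l'" using l mult_right_mono[of 1 "d / \<eta>" l] by auto
  have cell: "emeasure N (high ?l' \<inter> A) \<le> ennreal \<theta> * emeasure N A" if A: "A \<in> maximal_cells ?S" for A
  proof -
    obtain k x where x: "A = D k x" "x \<in> space M" "?S (D k x)" "\<forall>j<k. \<not> ?S (D j x)"
      using A by (auto simp: maximal_cells_def)
    obtain j where k: "k = Suc j"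
      using x start top by (cases k) (auto simp: not_less)
    have "emeasure N A \<le> emeasure N (D j x)"
      using nested[OF x(2)] cells[OF x(2)] x(1) k sets_N by (auto intro!: emeasure_mono)
    also have "\<dots> \<le> ennreal l * emeasure M (D j x)" using x(4) k by (auto simp: not_less)
    also have "\<dots> \<le> ennreal l * (ennreal d * emeasure M A)"
      using parent[OF x(2)] x(1) k by (auto intro!: mult_left_mono)
    finally have "ennreal ?l' * emeasure M (high ?l' \<inter> A) \<le> ennreal l * (ennreal d * emeasure M A)"
      using measure_high_in_cell[OF l l'(1) A] by (rule order_trans[rotated])
    then have "ennreal (1 / ?l') * (ennreal ?l' * emeasure M (high ?l' \<inter> A))
        \<le> ennreal (1 / ?l') * (ennreal l * (ennreal d * emeasure M A))"
      by (rule mult_left_mono) auto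
    moreover have "1 / ?l' * (l * d) = \<eta>" "1 / ?l' * ?l' = 1" using d \<eta> l by (auto simp: field_simps)
    ultimately have "emeasure M (high ?l' \<inter> A) \<le> ennreal \<eta> * emeasure M A"
      using d l l' by (simp add: mult.assoc[symmetric] ennreal_mult[symmetric] del: times_divide_eq_left)
    then show ?thesis
      using A_infinity[OF x(2), of "high ?l' \<inter> A" k] x(1) cells[OF x(2)] by auto
  qed
  have "1 * emeasure N (high ?l' \<inter> high l) \<le> emeasure (scale_measure (ennreal \<theta>) N) (high l \<inter> high l)"
    unfolding high_def[of l]
  proof (rule emeasure_disjoint_Union_le[OF countable_maximal_cells disjoint_maximal_cells])
    fix A assume A: "A \<in> maximal_cells ?S"
    have "\<Union> (maximal_cells ?S) \<inter> A = A" using A by auto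
    then show "1 * emeasure N (high ?l' \<inter> A)
        \<le> emeasure (scale_measure (ennreal \<theta>) N) (\<Union> (maximal_cells ?S) \<inter> A)"
      using cell[OF A] by simp
  qed (use cells_measurable sets_N high_measurable high_measurable[of l, unfolded high_def] in auto)
  moreover have "high ?l' \<subseteq> high l"
  proof
    fix x assume "x \<in> high ?l'"
    then obtain k where "x \<in> space M" "ennreal ?l' * emeasure M (D k x) < emeasure N (D k x)"
      by (auto simp: mem_high_iff)
    moreover have "ennreal l * emeasure M (D k x) \<le> ennreal ?l' * emeasure M (D k x)"
      using l' by (intro mult_right_mono ennreal_leI) auto
    ultimately show "x \<in> high l" unfolding mem_high_iff by (meson le_less_trans)
  qed
  ultimately show ?thesis by (simp add: Int_absorb2)
qed

lemma high_decay_power: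
  assumes l: "0 < l" and start: "emeasure N (space M) \<le> ennreal l * emeasure M (space M)"
  shows "emeasure N (high (l * (d / \<eta>) ^ k)) \<le> ennreal (\<theta> ^ k) * emeasure N (space M)"
proof (induction k)
  case 0
  show ?case using sets.sets_into_space[OF high_measurable] sets_N
    by (auto intro!: emeasure_mono)
next
  case (Suc k)
  have q: "1 \<le> d / \<eta>" using d \<eta> by (simp add: le_divide_eq)
  have ge: "l \<le> l * (d / \<eta>) ^ k" using l one_le_power[OF q, of k] by simp
  have "emeasure N (space M) \<le> ennreal (l * (d / \<eta>) ^ k) * emeasure M (space M)"
    using start ge by (meson mult_right_mono ennreal_leI order_trans zero_le)
  then have "emeasure N (high (d / \<eta> * (l * (d / \<eta>) ^ k))) \<le> ennreal \<theta> * emeasure N (high (l * (d / \<eta>) ^ k))"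
    using ge l by (intro high_decay) auto
  also have "\<dots> \<le> ennreal \<theta> * (ennreal (\<theta> ^ k) * emeasure N (space M))"
    by (intro mult_left_mono Suc) auto
  also have "\<dots> = ennreal (\<theta> ^ Suc k) * emeasure N (space M)"
    using \<theta> by (simp add: ennreal_mult mult.assoc)
  finally show ?case by (simp add: mult_ac)
qed

text \<open>Since \<open>W\<close> is at most \<open>l (d / \<eta>)\<^sup>k\<close> outside the corresponding superlevel set, \<open>W powr e\<close> is dominated by a
series of indicators of superlevel sets. Their \<open>N\<close>-mass decays like \<open>\<theta>\<^sup>k\<close> by \<open>high_decay_power\<close>, and for
small \<open>e\<close> this beats the growth \<open>q\<^sup>k\<close> of the coefficients.\<close>

theorem reverse_Holder:
  fixes W :: "'a \<Rightarrow> real"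
  assumes W [measurable]: "W \<in> borel_measurable M" "\<And>x. 0 \<le> W x"
    and N: "N = density M (\<lambda>x. ennreal (W x))"
    and differentiation: "\<And>l. 0 < l \<Longrightarrow>
        AE x in M. (\<forall>k. emeasure N (D k x) \<le> ennreal l * emeasure M (D k x)) \<longrightarrow> W x \<le> l"
    and l: "0 < l" and start: "emeasure N (space M) \<le> ennreal l * emeasure M (space M)"
    and e: "0 \<le> e" and q: "q = (d / \<eta>) powr e" "q * \<theta> < 1"
  shows "(\<integral>\<^sup>+x. ennreal (W x powr (1 + e)) \<partial>M)
      \<le> ennreal (l powr e * (1 + q / (1 - q * \<theta>))) * emeasure N (space M)"
proof -
  define b where "b k = l * (d / \<eta>) ^ k" for k
  have ratio: "1 < d / \<eta>" using d \<eta> by (simp add: less_divide_eq)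
  have b: "0 < b k" for k using l ratio by (simp add: b_def)
  have q0: "0 < q" using d \<eta> q by simp
  have b_powr: "b k powr e = l powr e * q ^ k" for k
  proof -
    have "((d / \<eta>) ^ k) powr e = q ^ k"
      using ratio unfolding q(1) by (induction k) (auto simp: powr_mult simp del: times_divide_eq_left)
    then show ?thesis using l ratio by (simp add: b_def powr_mult)
  qed
  have "AE x in M. \<forall>k. (\<forall>j. emeasure N (D j x) \<le> ennreal (b k) * emeasure M (D j x)) \<longrightarrow> W x \<le> b k"
    unfolding AE_all_countable using differentiation b by blast
  then have pointwise: "AE x in M. ennreal (W x powr e)
      \<le> ennreal (l powr e) + (\<Sum>k. ennreal (b (Suc k) powr e) * indicator (high (b k)) x)"
  proof (rule AE_mp, intro AE_I2 impI)
    fix x assume x: "x \<in> space M"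
      and *: "\<forall>k. (\<forall>j. emeasure N (D j x) \<le> ennreal (b k) * emeasure M (D j x)) \<longrightarrow> W x \<le> b k"
    have low: "W x \<le> b k" if "x \<notin> high (b k)" for k
      using * that x by (auto simp: mem_high_iff not_less)
    show "ennreal (W x powr e)
      \<le> ennreal (l powr e) + (\<Sum>k. ennreal (b (Suc k) powr e) * indicator (high (b k)) x)"
    proof (cases "W x \<le> b 0")
      case True
      then have "W x powr e \<le> l powr e" using W(2) e by (auto simp: b_def intro!: powr_mono2)
      then show ?thesis by (meson add_increasing2 ennreal_leI order_trans zero_le)
    next
      case False
      obtain n where "W x / l < (d / \<eta>) ^ n" using real_arch_pow[OF ratio] by blast
      then have n: "W x \<le> b n" using l by (simp add: b_def field_simps)
      define k where "k = (LEAST n. W x \<le> b n)"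
      have k: "W x \<le> b k" "\<And>j. j < k \<Longrightarrow> \<not> W x \<le> b j"
        using LeastI[of "\<lambda>n. W x \<le> b n", OF n] not_less_Least unfolding k_def by auto
      then obtain j where j: "k = Suc j" using False by (cases k) auto
      have "x \<in> high (b j)" using low k(2)[of j] j by auto
      define f where "f k = ennreal (b (Suc k) powr e) * indicator (high (b k)) x" for k
      have "ennreal (W x powr e) \<le> f j"
        using k(1) j W(2) e \<open>x \<in> high (b j)\<close> by (auto simp: f_def intro!: ennreal_leI powr_mono2)
      also have "f j \<le> (\<Sum>k. f k)" using sum_le_suminf[of f "{j}"] by simp
      finally have "ennreal (W x powr e) \<le> (\<Sum>k. ennreal (b (Suc k) powr e) * indicator (high (b k)) x)"
        by (simp add: f_def)
      then show ?thesis by (meson add_increasing order_trans zero_le)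
    qed
  qed
  define g where "g x = ennreal (l powr e) + (\<Sum>k. ennreal (b (Suc k) powr e) * indicator (high (b k)) x)" for x
  have g [measurable]: "g \<in> borel_measurable M" unfolding g_def by measurable
  have "(\<integral>\<^sup>+x. ennreal (W x powr (1 + e)) \<partial>M) = (\<integral>\<^sup>+x. ennreal (W x) * ennreal (W x powr e) \<partial>M)"
    using W(2) by (intro nn_integral_cong) (auto simp: powr_add ennreal_mult)
  also have "\<dots> \<le> (\<integral>\<^sup>+x. ennreal (W x) * g x \<partial>M)"
  proof (rule nn_integral_mono_AE)
    show "AE x in M. ennreal (W x) * ennreal (W x powr e) \<le> ennreal (W x) * g x"
      using pointwise unfolding g_def by eventually_elim (simp add: mult_left_mono)
  qed
  also have "\<dots> = (\<integral>\<^sup>+x. g x \<partial>N)"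
    using nn_integral_density[of "\<lambda>x. ennreal (W x)" M g] N by simp
  also have "\<dots> = ennreal (l powr e) * emeasure N (space M)
      + (\<Sum>k. ennreal (b (Suc k) powr e) * emeasure N (high (b k)))"
  proof -
    have high: "high (b k) \<in> sets N" for k by (simp add: sets_N)
    have "space N = space M" using sets_N by (rule sets_eq_imp_space_eq)
    moreover have "(\<integral>\<^sup>+x. g x \<partial>N) = (\<integral>\<^sup>+x. ennreal (l powr e) \<partial>N)
        + (\<integral>\<^sup>+x. (\<Sum>k. ennreal (b (Suc k) powr e) * indicator (high (b k)) x) \<partial>N)"
      unfolding g_def using high by (intro nn_integral_add) auto
    moreover have "(\<integral>\<^sup>+x. (\<Sum>k. ennreal (b (Suc k) powr e) * indicator (high (b k)) x) \<partial>N)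
        = (\<Sum>k. \<integral>\<^sup>+x. ennreal (b (Suc k) powr e) * indicator (high (b k)) x \<partial>N)"
      using high by (intro nn_integral_suminf) auto
    ultimately show ?thesis using high by (simp add: nn_integral_cmult_indicator)
  qed
  also have "\<dots> \<le> ennreal (l powr e) * emeasure N (space M)
      + (\<Sum>k. ennreal (l powr e * q * (q * \<theta>) ^ k) * emeasure N (space M))"
  proof (intro add_left_mono suminf_le summableI)
    fix k
    have "ennreal (b (Suc k) powr e) * emeasure N (high (b k))
        \<le> ennreal (b (Suc k) powr e) * (ennreal (\<theta> ^ k) * emeasure N (space M))"
      using high_decay_power[OF l start] unfolding b_def by (intro mult_left_mono) auto
    also have "\<dots> = ennreal (b (Suc k) powr e * \<theta> ^ k) * emeasure N (space M)"
      using \<theta> by (simp add: ennreal_mult mult.assoc)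
    also have "b (Suc k) powr e * \<theta> ^ k = l powr e * q * (q * \<theta>) ^ k"
      unfolding b_powr by (simp add: power_mult_distrib)
    finally show "ennreal (b (Suc k) powr e) * emeasure N (high (b k))
        \<le> ennreal (l powr e * q * (q * \<theta>) ^ k) * emeasure N (space M)" .
  qed
  also have "(\<Sum>k. ennreal (l powr e * q * (q * \<theta>) ^ k) * emeasure N (space M))
      = ennreal (l powr e * q / (1 - q * \<theta>)) * emeasure N (space M)"
  proof -
    have "(\<lambda>k. l powr e * q * (q * \<theta>) ^ k) sums (l powr e * q * (1 / (1 - q * \<theta>)))"
      using q q0 \<theta> by (intro sums_mult geometric_sums) auto
    then have "(\<Sum>k. ennreal (l powr e * q * (q * \<theta>) ^ k)) = ennreal (l powr e * q / (1 - q * \<theta>))"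
      using q0 \<theta> by (subst suminf_ennreal2) (auto simp: sums_iff)
    then show ?thesis by simp
  qed
  also have "ennreal (l powr e) * emeasure N (space M) + ennreal (l powr e * q / (1 - q * \<theta>)) * emeasure N (space M)
     = ennreal (l powr e * (1 + q / (1 - q * \<theta>))) * emeasure N (space M)"
    using q q0 by (simp add: distrib_right[symmetric] ennreal_plus[symmetric] distrib_left del: ennreal_plus)
  finally show ?thesis .
qed

end

section \<open>Dyadic cells of a cube\<close>

abbreviation cube :: "real ^ 'n \<Rightarrow> real \<Rightarrow> (real ^ 'n) set" where
  "cube a l \<equiv> cbox a (\<chi> i. a $ i + l)"

definition mass :: "(real ^ 'n \<Rightarrow> real) \<Rightarrow> (real ^ 'n) set \<Rightarrow> ennreal" where
  "mass f E = (\<integral>\<^sup>+x\<in>E. ennreal (f x) \<partial>lebesgue)"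

text \<open>Half-open cubes of side \<open>l / 2\<^sup>k\<close> as the fibres of a rounding map. Nestedness is then the remark that
\<open>\<lfloor>2 t\<rfloor>\<close> determines \<open>\<lfloor>t\<rfloor>\<close>.\<close>

definition cell :: "real ^ 'n \<Rightarrow> real \<Rightarrow> nat \<Rightarrow> real ^ 'n \<Rightarrow> (real ^ 'n) set" where
  "cell a l k x = {y. \<forall>i. \<lfloor>2 ^ k * (y $ i - a $ i) / l\<rfloor> = \<lfloor>2 ^ k * (x $ i - a $ i) / l\<rfloor>}"

definition corner :: "real ^ 'n \<Rightarrow> real \<Rightarrow> nat \<Rightarrow> real ^ 'n \<Rightarrow> real ^ 'n" where
  "corner a l k x = (\<chi> i. a $ i + l / 2 ^ k * real_of_int \<lfloor>2 ^ k * (x $ i - a $ i) / l\<rfloor>)"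

definition half_open_cube :: "real ^ 'n \<Rightarrow> real \<Rightarrow> (real ^ 'n) set" where
  "half_open_cube a l = {y. \<forall>i. a $ i \<le> y $ i \<and> y $ i < a $ i + l}"

lemma emeasure_cube: "0 < l \<Longrightarrow> emeasure lebesgue (cube (a :: real ^ 'n) l) = ennreal (l ^ CARD('n))"
proof -
  assume l: "0 < l"
  have "cube a l \<noteq> {}" using l by (auto simp: interval_ne_empty_cart(1))
  then have "measure lborel (cube a l) = l ^ CARD('n)" by (subst content_cbox_cart) auto
  then show ?thesis using emeasure_eq_ennreal_measure[of lborel "cube a l"] emeasure_lborel_cbox_finite[of a "\<chi> i. a $ i + l"]
    by simp
qed

lemma cell_eq: 
  assumes l: "0 < l"
  shows "cell a l k x = half_open_cube (corner a l k x) (l / 2 ^ k)"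
proof -
  have "\<lfloor>2 ^ k * u / l\<rfloor> = j \<longleftrightarrow> l / 2 ^ k * real_of_int j \<le> u \<and> u < l / 2 ^ k * real_of_int j + l / 2 ^ k"
    for u j using l by (simp add: floor_eq_iff field_simps)
  then show ?thesis unfolding cell_def half_open_cube_def corner_def
    by (simp only: vec_lambda_beta le_diff_eq diff_less_eq) (simp add: add_ac)
qed

lemma half_open_between: "box a (\<chi> i. a $ i + l) \<subseteq> half_open_cube a l" "half_open_cube a l \<subseteq> cube a l"
  by (auto simp: half_open_cube_def mem_box_cart less_imp_le)

lemma null_half_open: "cube a l - half_open_cube a l \<in> null_sets lebesgue"
proof -
  have "cube a l - box a (\<chi> i. a $ i + l) \<in> null_sets lebesgue"
    using negligible_frontier_interval negligible_iff_null_sets by blast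
  then show ?thesis by (rule null_sets_completion_subset[rotated]) (use half_open_between in auto)
qed

lemma half_open_sets [measurable]: "half_open_cube a l \<in> sets lebesgue"
proof -
  have "half_open_cube a l = cube a l - (cube a l - half_open_cube a l)"
    using half_open_between by blast
  then show ?thesis using null_half_open[of a l] by (metis null_setsD2 sets.Diff lmeasurable_cbox fmeasurableD)
qed

lemma AE_half_open: "AE x in lebesgue. x \<in> half_open_cube a l \<longleftrightarrow> x \<in> cube a l"
proof -
  have "AE x in lebesgue. x \<notin> cube a l - half_open_cube a l" by (rule AE_not_in[OF null_half_open])
  then show ?thesis by eventually_elim (use half_open_between[of a l] in auto)
qed

lemma emeasure_half_open: "emeasure lebesgue (half_open_cube a l) = emeasure lebesgue (cube a l)"
  by (rule emeasure_eq_AE[OF AE_half_open]) auto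

lemma mass_half_open: "mass f (half_open_cube a l) = mass f (cube a l)"
  unfolding mass_def
  by (rule nn_integral_cong_AE) (use AE_half_open[of a l] in \<open>eventually_elim, auto simp: indicator_def\<close>)

lemma floor_double_cong:
  fixes s t :: real
  shows "\<lfloor>2 * s\<rfloor> = \<lfloor>2 * t\<rfloor> \<Longrightarrow> \<lfloor>s\<rfloor> = \<lfloor>t\<rfloor>"
  using floor_divide_real_eq_div[of 2 "2 * s"] floor_divide_real_eq_div[of 2 "2 * t"] by simp

lemma cell_0: "0 < l \<Longrightarrow> x \<in> half_open_cube a l \<Longrightarrow> cell a l 0 x = half_open_cube a l"
proof -
  assume l: "0 < l" and x: "x \<in> half_open_cube a l"
  have "\<lfloor>(x $ i - a $ i) / l\<rfloor> = 0" for i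
    using x l by (auto simp: half_open_cube_def floor_eq_iff field_simps)
  then have "corner a l 0 x = a" by (simp add: corner_def vec_eq_iff)
  then show ?thesis using cell_eq[OF l, of a 0 x] by simp
qed

lemma cell_nested: "cell a l (Suc k) x \<subseteq> cell a l k x"
proof
  fix y assume y: "y \<in> cell a l (Suc k) x"
  have "\<lfloor>2 * (2 ^ k * (y $ i - a $ i) / l)\<rfloor> = \<lfloor>2 * (2 ^ k * (x $ i - a $ i) / l)\<rfloor>" for i
    using y by (simp add: cell_def mult.assoc)
  then show "y \<in> cell a l k x" unfolding cell_def using floor_double_cong by blast
qed

lemma cells_partition:
  assumes l: "0 < l"
  shows "nested_partitions (half_open_cube a l) (cell a l)"
proof
  fix x k assume x: "x \<in> half_open_cube a l"
  have "cell a l k x \<subseteq> cell a l 0 x"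
    by (rule lift_Suc_antimono_le[of "\<lambda>k. cell a l k x"]) (auto intro: cell_nested[THEN subsetD])
  then show "cell a l k x \<subseteq> half_open_cube a l" using cell_0[OF l x] by simp
next
  fix k
  define G where "G v = {y. \<forall>i. \<lfloor>2 ^ k * (y $ i - a $ i) / l\<rfloor> = v i}" for v :: "'a \<Rightarrow> int"
  have "cell a l k x = G (\<lambda>i. \<lfloor>2 ^ k * (x $ i - a $ i) / l\<rfloor>)" for x
    by (simp add: cell_def G_def)
  then have "cell a l k ` half_open_cube a l \<subseteq> range G" by auto
  then show "countable (cell a l k ` half_open_cube a l)"
    by (rule countable_subset) (rule countable_image, rule countableI_type)
next
  show "cell a l (Suc k) x \<subseteq> cell a l k x" for x k by (rule cell_nested)
qed (auto simp: cell_def)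

lemma cell_in_open:
  assumes l: "0 < l" and U: "open U" "x \<in> U"
  shows "\<exists>k. cell (a :: real ^ 'n) l k x \<subseteq> U"
proof -
  obtain e where e: "0 < e" "ball x e \<subseteq> U" using U by (auto simp: open_contains_ball)
  obtain k where k: "real CARD('n) * l / e < 2 ^ k" using real_arch_pow[of 2] by auto
  have small: "CARD('n) * (l / 2 ^ k) < e" using k e by (simp add: field_simps)
  have "cell a l k x \<subseteq> ball x e"
  proof
    fix y assume y: "y \<in> cell a l k x"
    have "x \<in> cell a l k x" by (simp add: cell_def)
    then have "\<bar>(x - y) $ i\<bar> \<le> l / 2 ^ k" for i
      using y unfolding cell_eq[OF l] half_open_cube_def by simp (smt (verit))
    then have "(\<Sum>i\<in>UNIV. \<bar>(x - y) $ i\<bar>) \<le> (\<Sum>i\<in>(UNIV :: 'n set). l / 2 ^ k)" by (intro sum_mono) auto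
    then show "y \<in> ball x e" using norm_le_l1_cart[of "x - y"] small by (simp add: dist_norm)
  qed
  then show ?thesis using e by blast
qed

text \<open>The part of the Lebesgue differentiation theorem that the stopping time argument needs. The set of points
where \<open>W\<close> exceeds \<open>c\<close> by a fixed amount although all cells have average at most \<open>c\<close> is covered by
disjoint such cells inside an open set of nearly the same measure. Integrating \<open>W\<close> over the cells
shows that the set is null.\<close>

lemma dyadic_differentiation:
  fixes W :: "real ^ 'n \<Rightarrow> real"
  assumes l: "0 < l" and W [measurable]: "W \<in> borel_measurable lebesgue" "\<And>x. 0 \<le> W x" and c: "0 < c"
  shows "AE x in lebesgue. x \<in> half_open_cube a l \<longrightarrow>
      (\<forall>k. mass W (cell a l k x) \<le> ennreal c * emeasure lebesgue (cell a l k x)) \<longrightarrow> W x \<le> c"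
proof -
  interpret nested_partitions "half_open_cube a l" "cell a l" by (rule cells_partition[OF l])
  let ?N = "density lebesgue (\<lambda>x. ennreal (W x))"
  have N: "emeasure ?N E = mass W E" if "E \<in> sets lebesgue" for E
    using that by (simp add: mass_def emeasure_density)
  define S where "S A \<longleftrightarrow> mass W A \<le> ennreal c * emeasure lebesgue A" for A
  have cell_sets: "cell a l k x \<in> sets lebesgue" for k x by (simp add: cell_eq[OF l])
  have max_sets: "maximal_cells T \<subseteq> sets lebesgue" for T using cell_sets by (auto simp: maximal_cells_def)
  have "\<Union>(maximal_cells (\<lambda>A. \<not> S A)) \<in> sets lebesgue"
    using max_sets countable_maximal_cells by (intro sets.countable_Union) auto
  then have good: "{x \<in> half_open_cube a l. \<exists>k. \<not> S (cell a l k x)} \<in> sets lebesgue"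
    by (simp add: Union_maximal_cells)
  define Bad where "Bad n = {x \<in> half_open_cube a l - {x \<in> half_open_cube a l. \<exists>k. \<not> S (cell a l k x)}.
     c + 1 / real (Suc n) < W x}" for n
  have Bad [measurable]: "Bad n \<in> sets lebesgue" for n
  proof -
    have "Bad n = (half_open_cube a l - {x \<in> half_open_cube a l. \<exists>k. \<not> S (cell a l k x)}) \<inter> 
      {x \<in> space lebesgue. c + 1 / real (Suc n) < W x}" by (auto simp: Bad_def)
    also have "\<dots> \<in> sets lebesgue" using good by measurable
    finally show ?thesis .
  qed
  have "emeasure lebesgue (Bad n) = 0" for n
  proof -
    have fin: "emeasure lebesgue (Bad n) < \<infinity>"
    proof -
      have "emeasure lebesgue (Bad n) \<le> emeasure lebesgue (half_open_cube a l)"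
        by (rule emeasure_mono) (auto simp: Bad_def)
      then show ?thesis using emeasure_cube[OF l, of a] by (simp add: emeasure_half_open order_le_less_trans)
    qed
    then obtain b where b: "emeasure lebesgue (Bad n) = ennreal b" "0 \<le> b"
      by (cases "emeasure lebesgue (Bad n)") auto
    have bound: "(c + 1 / real (Suc n)) * b \<le> c * (b + e)" if e: "0 < e" for e
    proof -
      obtain U where U: "open U" "Bad n \<subseteq> U" "emeasure lebesgue (U - Bad n) < ennreal e"
        using sets_lebesgue_outer_open[OF Bad e] by blast
      define T where "T A \<longleftrightarrow> A \<subseteq> U \<and> S A" for A
      have sub: "Bad n \<subseteq> \<Union>(maximal_cells T)"
      proof
        fix x assume x: "x \<in> Bad n"
        then obtain k where "cell a l k x \<subseteq> U" using cell_in_open[OF l U(1)] U(2) by blast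
        then show "x \<in> \<Union>(maximal_cells T)" using x unfolding Union_maximal_cells T_def Bad_def by auto
      qed
      have UT: "\<Union>(maximal_cells T) \<in> sets lebesgue"
        using max_sets countable_maximal_cells by (intro sets.countable_Union) auto
      have "ennreal ((c + 1 / real (Suc n)) * b) = ennreal (c + 1 / real (Suc n)) * emeasure lebesgue (Bad n)"
        using b c by (simp add: ennreal_mult)
      also have "\<dots> = (\<integral>\<^sup>+x\<in>Bad n. ennreal (c + 1 / real (Suc n)) \<partial>lebesgue)"
        by (subst nn_integral_cmult_indicator) auto
      also have "\<dots> \<le> mass W (Bad n)" unfolding mass_def
        by (intro nn_integral_mono) (auto simp: Bad_def indicator_def intro!: ennreal_leI)
      also have "\<dots> \<le> mass W (\<Union>(maximal_cells T))" unfolding mass_def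
        using sub by (intro nn_integral_mono) (auto simp: indicator_def)
      also have "\<dots> \<le> ennreal c * emeasure lebesgue (\<Union>(maximal_cells T))"
      proof -
        have "1 * emeasure ?N (UNIV \<inter> \<Union>(maximal_cells T)) \<le> emeasure (scale_measure (ennreal c) lebesgue) (UNIV \<inter> \<Union>(maximal_cells T))"
        proof (rule emeasure_disjoint_Union_le[OF countable_maximal_cells disjoint_maximal_cells])
          fix A assume A: "A \<in> maximal_cells T"
          then have "S A" "A \<in> sets lebesgue" using max_sets[of T] by (auto simp: maximal_cells_def[of T] T_def)
          then show "1 * emeasure ?N (UNIV \<inter> A) \<le> emeasure (scale_measure (ennreal c) lebesgue) (UNIV \<inter> A)"
            by (simp add: N S_def)
        qed (use max_sets in auto)
        then show ?thesis using N[OF UT] by simp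
      qed
      also have "\<dots> \<le> ennreal c * emeasure lebesgue U"
        using U(1) by (intro mult_left_mono emeasure_mono) (auto simp: maximal_cells_def T_def)
      also have "\<dots> \<le> ennreal c * (emeasure lebesgue (Bad n) + emeasure lebesgue (U - Bad n))"
      proof -
        have "U - Bad n \<in> sets lebesgue" using U(1) Bad[of n] by auto
        moreover have "Bad n \<union> (U - Bad n) = U" using U(2) by auto
        ultimately have "emeasure lebesgue U \<le> emeasure lebesgue (Bad n) + emeasure lebesgue (U - Bad n)"
          using emeasure_subadditive[OF Bad[of n], of "U - Bad n"] by metis
        then show ?thesis by (rule mult_left_mono) simp
      qed
      also have "\<dots> \<le> ennreal c * (ennreal b + ennreal e)"
        using U b by (intro mult_left_mono add_mono) auto
      also have "\<dots> = ennreal (c * (b + e))" using b c e by (simp add: ennreal_mult ennreal_plus[symmetric] del: ennreal_plus)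
      finally show ?thesis using b c e by (subst (asm) ennreal_le_iff) auto
    qed
    have "b \<le> 0"
    proof (rule ccontr)
      assume "\<not> b \<le> 0"
      then have pos: "0 < b" by simp
      define m where "m = real (Suc n)"
      have m: "0 < m" by (simp add: m_def)
      define u where "u = b / m"
      \<comment> \<open>This excess is so small that the bound contradicts \<open>b > 0\<close>.\<close>
      have "(c + 1 / m) * b \<le> c * (b + b / (2 * m * c))"
        unfolding m_def using c pos by (intro bound) simp
      moreover have "c * (b + b / (2 * m * c)) = c * b + u / 2" using c m by (simp add: u_def field_simps)
      moreover have "(c + 1 / m) * b = c * b + u" by (simp add: u_def distrib_right)
      moreover have "0 < u" using pos m by (simp add: u_def)
      ultimately show False by linarith
    qed
    then show ?thesis using b by simp
  qed
  then have "AE x in lebesgue. \<forall>n. x \<notin> Bad n"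
    unfolding AE_all_countable by (intro allI AE_not_in null_setsI) auto
  then show ?thesis
  proof eventually_elim
    case (elim x)
    show ?case
    proof (intro impI, rule ccontr)
      assume x: "x \<in> half_open_cube a l"
        and *: "\<forall>k. mass W (cell a l k x) \<le> ennreal c * emeasure lebesgue (cell a l k x)" "\<not> W x \<le> c"
      obtain n where "inverse (real (Suc n)) < W x - c" using reals_Archimedean[of "W x - c"] * by auto
      then have "x \<in> Bad n" using x * by (auto simp: Bad_def S_def field_simps)
      then show False using elim by auto
    qed
  qed
qed

lemma mass_mono_set: "E \<subseteq> F \<Longrightarrow> mass f E \<le> mass f F"
  unfolding mass_def by (intro nn_integral_mono) (auto simp: indicator_def)

lemma mass_density:
  assumes "f \<in> borel_measurable lebesgue" "E \<in> sets lebesgue"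
  shows "mass f E = emeasure (density lebesgue (\<lambda>x. ennreal (f x))) E"
  using assms by (simp add: mass_def emeasure_density)

lemma mass_Diff:
  assumes f: "f \<in> borel_measurable lebesgue" and "E \<in> sets lebesgue" "F \<in> sets lebesgue" "E \<subseteq> F"
  shows "mass f F = mass f E + mass f (F - E)"
  using plus_emeasure[of E "density lebesgue (\<lambda>x. ennreal (f x))" "F - E"] assms
  by (simp add: mass_density Un_absorb1)

text \<open>The inequality is stated for any upper bound \<open>t > 0\<close> of the mass, which allows bounds from elsewhere to
be inserted directly.\<close>

definition reverse_Holder_bound :: "(real ^ 'n \<Rightarrow> real) \<Rightarrow> real \<Rightarrow> real \<Rightarrow> bool" where
  "reverse_Holder_bound W e C \<longleftrightarrow> (\<forall>c l t. 0 < l \<longrightarrow> 0 < t \<longrightarrow> mass W (cube c l) \<le> ennreal t \<longrightarrow>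
     mass (\<lambda>x. W x powr (1 + e)) (cube c l) \<le> ennreal (C * (l ^ CARD('n)) powr - e * t powr (1 + e)))"

lemma reverse_Holder_boundD:
  fixes W :: "real ^ 'n \<Rightarrow> real"
  assumes "reverse_Holder_bound W e C" "0 < l" "0 < t" "mass W (cube c l) \<le> ennreal t"
  shows "mass (\<lambda>x. W x powr (1 + e)) (cube c l) \<le> ennreal (C * (l ^ CARD('n)) powr - e * t powr (1 + e))"
  using assms unfolding reverse_Holder_bound_def by blast

text \<open>Cells differ from closed cubes by null sets, and a parent has \<open>2\<^sup>n\<close> times the measure of its child, so
the abstract inequality applies with \<open>d = 2\<^sup>n\<close> and \<open>\<eta> = 1 / 2\<close>. The constants depend only on \<open>\<beta>\<close> and
the dimension, which makes them uniform over all cubes.\<close>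

theorem reverse_Holder_on_cubes:
  fixes W :: "real ^ 'n \<Rightarrow> real"
  assumes W [measurable]: "W \<in> borel_measurable lebesgue" "\<And>x. 0 \<le> W x"
    and finite: "\<And>a l. 0 < l \<Longrightarrow> mass W (cube a l) < \<infinity>"
    and \<beta>: "0 < \<beta>"
    and A_infinity: "\<And>a l E. 0 < l \<Longrightarrow> E \<in> sets lebesgue \<Longrightarrow> E \<subseteq> cube a l \<Longrightarrow>
        ennreal (1 / 2) * emeasure lebesgue (cube a l) \<le> emeasure lebesgue E \<Longrightarrow>
        ennreal \<beta> * mass W (cube a l) \<le> mass W E"
  obtains e0 C where "0 < e0" "0 < C"
    "\<And>e. 0 \<le> e \<Longrightarrow> e \<le> e0 \<Longrightarrow> reverse_Holder_bound W e C"
proof -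
  define d :: real where "d = 2 ^ CARD('n)"
  define \<theta> where "\<theta> = 1 - min \<beta> (1 / 2)"
  have \<theta>: "0 < \<theta>" "\<theta> < 1" using \<beta> by (auto simp: \<theta>_def)
  have d: "1 \<le> d" unfolding d_def by simp
  have ratio: "1 < d / (1 / 2)" using d by simp
  \<comment> \<open>The largest \<open>e\<close> is chosen so that \<open>q * \<theta>\<close> in \<open>reverse_Holder\<close> equals \<open>(1 + \<theta>) / 2 < 1\<close>.\<close>
  define e0 where "e0 = ln ((1 + \<theta>) / (2 * \<theta>)) / ln (d / (1 / 2))"
  define Q where "Q = (1 + \<theta>) / (2 * \<theta>)"
  have Q1: "1 < Q" using \<theta> by (simp add: Q_def less_divide_eq)
  have e0: "0 < e0" unfolding e0_def Q_def[symmetric] using Q1 ratio by (intro divide_pos_pos) auto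
  have Q: "(d / (1 / 2)) powr e0 = Q"
    unfolding e0_def Q_def[symmetric] using ratio Q1 by (simp add: powr_def)
  have Q\<theta>: "Q * \<theta> < 1" using \<theta> by (simp add: Q_def)
  define C where "C = 1 + Q / (1 - Q * \<theta>)"
  have C: "0 < C" using Q1 Q\<theta> by (simp add: C_def add_pos_pos)
  have "mass (\<lambda>x. W x powr (1 + e)) (cube a l) \<le> ennreal (C * (l ^ CARD('n)) powr - e * t powr (1 + e))"
    if e: "0 \<le> e" "e \<le> e0" and l: "0 < l" and t: "0 < t" "mass W (cube a l) \<le> ennreal t" for e a l t
  proof -
    let ?H = "half_open_cube a l"
    define M where "M = lebesgue_on ?H"
    define N where "N = density M (\<lambda>x. ennreal (W x))"
    have space: "space M = ?H" by (simp add: M_def)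
    have sets: "E \<in> sets M \<longleftrightarrow> E \<in> sets lebesgue \<and> E \<subseteq> ?H" for E
      unfolding M_def by (subst sets_restrict_space_iff) auto
    have M: "emeasure M E = emeasure lebesgue E" if "E \<in> sets M" for E
      using that unfolding sets by (simp add: M_def emeasure_restrict_space)
    have WM [measurable]: "W \<in> borel_measurable M" unfolding M_def by (rule measurable_restrict_space1) (rule W)
    have integral: "(\<integral>\<^sup>+x. ennreal (f x) \<partial>M) = mass f ?H" for f
      unfolding M_def mass_def by (subst nn_integral_restrict_space) auto
    have N: "emeasure N E = mass W E" if "E \<in> sets M" for E
    proof -
      have "emeasure N E = (\<integral>\<^sup>+x. ennreal (W x) * indicator E x \<partial>M)"
        using that unfolding N_def by (simp add: emeasure_density)
      also have "\<dots> = (\<integral>\<^sup>+x. (ennreal (W x) * indicator E x) * indicator ?H x \<partial>lebesgue)"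
        unfolding M_def by (subst nn_integral_restrict_space) auto
      also have "\<dots> = mass W E" unfolding mass_def
        using that unfolding sets by (intro nn_integral_cong) (auto simp: indicator_def)
      finally show ?thesis .
    qed
    have cell_mass: "mass f (cell a l k x) = mass f (cube (corner a l k x) (l / 2 ^ k))"
      and cell_measure: "emeasure lebesgue (cell a l k x) = emeasure lebesgue (cube (corner a l k x) (l / 2 ^ k))"
      and cell_sub: "cell a l k x \<subseteq> cube (corner a l k x) (l / 2 ^ k)"
      and cell_sets: "cell a l k x \<in> sets lebesgue" for f k x
      unfolding cell_eq[OF l] by (simp_all add: mass_half_open emeasure_half_open half_open_between)
    have cell_emeasure: "emeasure lebesgue (cell a l k x) = ennreal ((l / 2 ^ k) ^ CARD('n))" for k x
      unfolding cell_measure by (rule emeasure_cube) (use l in simp)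
    interpret part: nested_partitions ?H "cell a l" by (rule cells_partition[OF l])
    have cells: "cell a l k x \<in> sets M" if "x \<in> ?H" for k x
      using part.sub[OF that] cell_sets by (simp add: sets)
    interpret filtered_pair M "cell a l" N d "1 / 2" \<theta>
    proof
      show "sets N = sets M" by (simp add: N_def)
      fix x k assume x: "x \<in> space M"
      then have x': "x \<in> ?H" by (simp add: space)
      show "cell a l k x \<in> sets M" by (rule cells[OF x'])
      show "cell a l 0 x = space M" using cell_0[OF l x'] by (simp add: space)
      show "x \<in> cell a l k x" using part.self x' by blast
      show "cell a l k x \<subseteq> space M" using part.sub x' by (simp add: space)
      show "cell a l (Suc k) x \<subseteq> cell a l k x" using part.nested x' by blast
      show "cell a l k y = cell a l k x" if "y \<in> cell a l k x" for y using part.part x' that by blast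
      have "(l / 2 ^ k) ^ CARD('n) = d * (l / 2 ^ Suc k) ^ CARD('n)"
        by (simp add: d_def power_divide power_mult_distrib)
      then show "emeasure M (cell a l k x) \<le> ennreal d * emeasure M (cell a l (Suc k) x)"
        using d l unfolding M[OF cells[OF x']] cell_emeasure by (simp only: ennreal_mult'[symmetric] zero_le_power ennreal_leI)
      fix E assume E: "E \<in> sets M" "E \<subseteq> cell a l k x"
        and small: "emeasure M E \<le> ennreal (1 / 2) * emeasure M (cell a l k x)"
      let ?K = "cube (corner a l k x) (l / 2 ^ k)" and ?D = "cell a l k x"
      have lk: "0 < l / 2 ^ k" using l by simp
      obtain v where v: "emeasure lebesgue ?K = ennreal v" "0 < v" using emeasure_cube[OF lk] lk by (metis zero_less_power)
      have E': "E \<in> sets lebesgue" using E sets by auto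
      have "emeasure lebesgue ?D = emeasure lebesgue E + emeasure lebesgue (?D - E)"
        using E E' cell_sets[of k x] plus_emeasure[of E lebesgue "?D - E"] by (simp add: Un_absorb1)
      moreover have half: "ennreal (1 / 2) * ennreal v = ennreal (v / 2)"
        by (subst ennreal_mult'[symmetric]) auto
      moreover have "emeasure lebesgue E \<le> ennreal (v / 2)"
        using small unfolding M[OF E(1)] M[OF cells[OF x']] cell_measure v(1) half .
      moreover have "emeasure lebesgue ?D = ennreal (v / 2) + ennreal (v / 2)"
        unfolding cell_measure v(1) using v(2) by (subst ennreal_plus[symmetric]) auto
      ultimately have "ennreal (v / 2) + ennreal (v / 2) \<le> ennreal (v / 2) + emeasure lebesgue (?D - E)"
        by (metis add_right_mono)
      then have "ennreal (1 / 2) * emeasure lebesgue ?K \<le> emeasure lebesgue (?D - E)"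
        unfolding v(1) half by (subst (asm) ennreal_add_left_cancel_le) auto
      then have "ennreal \<beta> * mass W ?K \<le> mass W (?D - E)"
        using E' cell_sets[of k x] cell_sub[of k x] lk by (intro A_infinity) auto
      then have big: "ennreal \<beta> * mass W ?D \<le> mass W (?D - E)" by (simp add: cell_mass)
      have split: "mass W ?D = mass W E + mass W (?D - E)"
        using E E' cell_sets by (intro mass_Diff W) auto
      have "mass W ?D < \<infinity>" using finite[OF lk] by (simp add: cell_mass)
      then have fin: "mass W E < \<infinity>" "mass W (?D - E) < \<infinity>"
        using mass_mono_set[OF E(2), of W] mass_mono_set[of "?D - E" ?D W] by (auto intro: le_less_trans)
      define m1 m2 m where "m1 = enn2real (mass W E)" and "m2 = enn2real (mass W (?D - E))" and "m = m1 + m2"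
      have m: "mass W E = ennreal m1" "mass W (?D - E) = ennreal m2" "0 \<le> m1" "0 \<le> m2" "0 \<le> m"
        using fin by (auto simp: m1_def m2_def m_def)
      then have m': "mass W ?D = ennreal m" by (simp add: split m_def)
      have "m = m1 + m2" by (simp add: m_def)
      moreover have "\<beta> * m \<le> m2" using big m m' \<beta> by (simp add: ennreal_mult'[symmetric])
      moreover have "min \<beta> (1 / 2) * m \<le> \<beta> * m" using m by (intro mult_right_mono) auto
      ultimately have "m1 \<le> \<theta> * m" by (simp add: \<theta>_def algebra_simps)
      then show "emeasure N E \<le> ennreal \<theta> * emeasure N ?D"
        using m m' \<theta> by (simp add: N[OF E(1)] N[OF cells[OF x']] ennreal_mult'[symmetric])
    next
      show "countable (cell a l k ` space M)" for k using part.countable_cells by (simp add: space)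
    qed (use d \<theta> in auto)
    define v where "v = l ^ CARD('n)"
    have v: "0 < v" using l by (simp add: v_def)
    define q where "q = (d / (1 / 2)) powr e"
    have q: "q \<le> Q" "0 < q" unfolding Q[symmetric] q_def using ratio e by (auto intro!: powr_mono)
    have q\<theta>: "q * \<theta> \<le> Q * \<theta>" using q \<theta> by simp
    have top: "?H \<in> sets M" by (simp add: sets)
    have NH: "emeasure N (space M) \<le> ennreal t" using t N[OF top] by (simp add: space mass_half_open)
    have "mass (\<lambda>x. W x powr (1 + e)) ?H \<le> ennreal ((t / v) powr e * (1 + q / (1 - q * \<theta>))) * emeasure N (space M)"
      unfolding integral[symmetric]
    proof (rule reverse_Holder[OF WM W(2) N_def])
      show "emeasure N (space M) \<le> ennreal (t / v) * emeasure M (space M)"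
        using NH t v M[OF top] emeasure_cube[OF l, of a] by (simp add: space emeasure_half_open v_def[symmetric] ennreal_mult'[symmetric])
      fix c :: real assume c: "0 < c"
      show "AE x in M. (\<forall>k. emeasure N (cell a l k x) \<le> ennreal c * emeasure M (cell a l k x)) \<longrightarrow> W x \<le> c"
        unfolding M_def
      proof (subst AE_restrict_space_iff)
        show "AE x in lebesgue. x \<in> ?H \<longrightarrow>
          (\<forall>k. emeasure N (cell a l k x) \<le> ennreal c * emeasure (lebesgue_on ?H) (cell a l k x)) \<longrightarrow> W x \<le> c"
          using dyadic_differentiation[OF l W c, of a]
        proof eventually_elim
          case (elim x)
          then show ?case unfolding M_def[symmetric] using N[OF cells, of x] M[OF cells, of x] space by auto
        qed
      qed auto
    qed (use t v e q q\<theta> Q\<theta> in \<open>auto simp: q_def\<close>)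
    also have "\<dots> \<le> ennreal ((t / v) powr e * C) * ennreal t"
    proof (intro mult_mono ennreal_leI mult_left_mono NH)
      have "q / (1 - q * \<theta>) \<le> Q / (1 - Q * \<theta>)" using q q\<theta> Q\<theta> by (intro frac_le) auto
      then show "1 + q / (1 - q * \<theta>) \<le> C" by (simp add: C_def)
      have "0 \<le> q / (1 - q * \<theta>)" using q q\<theta> Q\<theta> by (intro divide_nonneg_nonneg) auto
      then show "0 \<le> 1 + q / (1 - q * \<theta>)" by simp
    qed auto
    also have "\<dots> = ennreal (C * v powr - e * t powr (1 + e))"
    proof -
      have "(t / v) powr e = t powr e * v powr - e" using t v by (simp add: powr_divide powr_minus_divide)
      then have "(t / v) powr e * C * t = C * v powr - e * t powr (1 + e)" using t by (simp add: powr_add mult_ac)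
      then show ?thesis using t C by (simp add: ennreal_mult'[symmetric])
    qed
    finally show ?thesis by (simp add: mass_half_open v_def)
  qed
  then have "reverse_Holder_bound W e C" if "0 \<le> e" "e \<le> e0" for e
    using that unfolding reverse_Holder_bound_def by blast
  then show ?thesis using that e0 C by blast
qed

section \<open>Logarithmically Hoelder continuous exponents\<close>

abbreviation shifted_norm :: "real ^ 'n \<Rightarrow> real" where
  "shifted_norm x \<equiv> exp 1 + norm x"

abbreviation centred_cube :: "real \<Rightarrow> (real ^ 'n) set" where
  "centred_cube R \<equiv> cube (\<chi> i. - R) (2 * R)"

text \<open>These are all small cubes and the large ones that are far from the origin. On them the exponent is nearly
constant on the scale that matters.\<close>

definition distant_cube :: "real ^ 'n \<Rightarrow> real \<Rightarrow> bool" where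
  "distant_cube c l \<longleftrightarrow> 0 < l \<and> (\<forall>x\<in>cube c l. l \<le> shifted_norm x)"

lemma mem_cube: "x \<in> cube c l \<longleftrightarrow> (\<forall>i. c $ i \<le> x $ i \<and> x $ i \<le> c $ i + l)"
  by (simp add: mem_box_cart)

lemma mem_centred_cube: "x \<in> centred_cube R \<longleftrightarrow> (\<forall>i. \<bar>x $ i\<bar> \<le> R)"
  by (auto simp: mem_box_cart abs_le_iff minus_le_iff)

lemma norm_diff_cube:
  assumes "x \<in> cube c l" "y \<in> cube (c :: real ^ 'n) l"
  shows "norm (x - y) \<le> real CARD('n) * l"
proof -
  have "\<bar>(x - y) $ i\<bar> \<le> l" for i
  proof -
    have "c $ i \<le> x $ i" "x $ i \<le> c $ i + l" "c $ i \<le> y $ i" "y $ i \<le> c $ i + l"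
      using assms by (simp_all add: mem_cube)
    then show ?thesis by simp
  qed
  then have "(\<Sum>i\<in>UNIV. \<bar>(x - y) $ i\<bar>) \<le> (\<Sum>i\<in>(UNIV :: 'n set). l)" by (intro sum_mono)
  then show ?thesis using norm_le_l1_cart[of "x - y"] by simp
qed

lemma cube_subset_centred:
  assumes "x \<in> cube c l" and "norm x + l \<le> R"
  shows "cube c l \<subseteq> centred_cube R"
proof
  fix y assume y: "y \<in> cube c l"
  have "\<bar>y $ i\<bar> \<le> R" for i
  proof -
    have "c $ i \<le> x $ i" "x $ i \<le> c $ i + l" "c $ i \<le> y $ i" "y $ i \<le> c $ i + l"
      using assms y by (simp_all add: mem_cube)
    then show ?thesis using component_le_norm_cart[of x i] assms(2) by linarith
  qed
  then show "y \<in> centred_cube R" unfolding mem_centred_cube by blast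
qed

lemma shifted_norm_ge: "exp 1 \<le> shifted_norm x" "1 < shifted_norm x" "1 \<le> ln (shifted_norm x)"
proof -
  show 1: "exp 1 \<le> shifted_norm x" by simp
  have "(1::real) < exp 1" by simp
  then show "1 < shifted_norm x" using norm_ge_zero[of x] by linarith
  show "1 \<le> ln (shifted_norm x)" using 1 \<open>1 < shifted_norm x\<close> by (simp add: ln_ge_iff)
qed

lemma mass_le_cmult:
  assumes "g \<in> borel_measurable lebesgue" "E \<in> sets lebesgue" "0 \<le> c"
    and "\<And>x. x \<in> E \<Longrightarrow> f x \<le> c * g x"
  shows "mass f E \<le> ennreal c * mass g E"
proof -
  have "mass f E \<le> (\<integral>\<^sup>+x. ennreal c * (ennreal (g x) * indicator E x) \<partial>lebesgue)"
    unfolding mass_def using assms(3,4)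
    by (intro nn_integral_mono) (auto simp: indicator_def ennreal_mult'[symmetric] intro!: ennreal_leI)
  also have "\<dots> = ennreal c * mass g E"
    unfolding mass_def using assms(1,2) by (intro nn_integral_cmult) auto
  finally show ?thesis .
qed

lemma powr_le_of_log_bound:
  fixes t e C :: real
  assumes "0 < t" "\<bar>e\<bar> * \<bar>ln t\<bar> \<le> C"
  shows "t powr e \<le> exp C"
proof -
  have "e * ln t \<le> C" using assms(2) abs_ge_self[of "e * ln t"] by (simp add: abs_mult)
  then show ?thesis using assms(1) by (simp add: powr_def)
qed

locale log_Holder_exponent =
  fixes p :: "real ^ 'n \<Rightarrow> real" and P C0 Cinf pinf :: real
  assumes p: "\<And>x. 1 \<le> p x" "\<And>x. p x \<le> P"
    and p_measurable [measurable]: "p \<in> borel_measurable lebesgue"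
    and local_Holder: "\<And>x y. norm (x - y) < 1 / 2 \<Longrightarrow> \<bar>p x - p y\<bar> \<le> C0 / (- ln (norm (x - y)))"
    and decay: "\<And>x. \<bar>p x - pinf\<bar> \<le> Cinf / ln (shifted_norm x)"
    and C0: "0 \<le> C0"
begin

lemma P: "1 \<le> P" using p[of 0] by simp

lemma decay_ln: "\<bar>p x - pinf\<bar> * ln (shifted_norm x) \<le> Cinf"
  using decay[of x] shifted_norm_ge[of x] by (simp add: pos_le_divide_eq)

lemma Cinf: "0 \<le> Cinf"
proof -
  have "0 \<le> \<bar>p 0 - pinf\<bar> * ln (shifted_norm (0 :: real ^ 'n))" using shifted_norm_ge(3)[of "0 :: real ^ 'n"] by simp
  then show ?thesis using decay_ln[of 0] by linarith
qed

lemma pinf: "1 \<le> pinf"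
proof (rule ccontr)
  assume "\<not> 1 \<le> pinf"
  then have d: "0 < 1 - pinf" by simp
  \<comment> \<open>Points with \<open>ln (shifted_norm x) \<ge> t\<close> would violate the decay condition.\<close>
  define t where "t = Cinf / (1 - pinf) + 1"
  define x :: "real ^ 'n" where "x = exp t *\<^sub>R axis undefined 1"
  have "norm x = exp t" by (simp add: x_def)
  then have "exp t \<le> shifted_norm x" by simp
  then have "t \<le> ln (shifted_norm x)" using shifted_norm_ge(2)[of x] by (simp add: ln_ge_iff)
  then have "(1 - pinf) * t \<le> \<bar>p x - pinf\<bar> * ln (shifted_norm x)"
    using p(1)[of x] d Cinf by (intro mult_mono) (auto simp: t_def)
  then have "(1 - pinf) * t \<le> Cinf" using decay_ln[of x] by linarith
  moreover have "(1 - pinf) * t = Cinf + (1 - pinf)" using d unfolding t_def distrib_left by simp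
  ultimately show False using d by linarith
qed

text \<open>The decay condition at \<open>x\<close> and at \<open>y\<close> gives the bound, because \<open>shifted_norm x\<close> and \<open>shifted_norm y\<close> are comparable on
a distant cube.\<close>

lemma oscillation_ln_norm:
  assumes Q: "distant_cube c l" "x \<in> cube c l" "y \<in> cube c l"
  shows "\<bar>p x - p y\<bar> * ln (shifted_norm x) \<le> (real CARD('n) + 2) * Cinf"
proof -
  let ?n = "real CARD('n)"
  have "norm x \<le> norm y + ?n * l" using norm_diff_cube[OF Q(2,3)] norm_triangle_sub[of x y] by linarith
  also have "?n * l \<le> ?n * shifted_norm y" using Q by (intro mult_left_mono) (auto simp: distant_cube_def)
  finally have "shifted_norm x \<le> (?n + 1) * shifted_norm y" by (simp add: algebra_simps)
  then have "ln (shifted_norm x) \<le> ln ((?n + 1) * shifted_norm y)"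
    using shifted_norm_ge(2)[of x] by (subst ln_le_cancel_iff) auto
  also have "\<dots> = ln (?n + 1) + ln (shifted_norm y)" using shifted_norm_ge(2)[of y] by (subst ln_mult) auto
  also have "ln (?n + 1) \<le> ?n" using ln_add_one_self_le_self[of ?n] by (simp add: add.commute)
  also have "?n \<le> ?n * ln (shifted_norm y)" using shifted_norm_ge(3)[of y] by simp
  finally have ln: "ln (shifted_norm x) \<le> (?n + 1) * ln (shifted_norm y)" by (simp add: algebra_simps)
  have "\<bar>p x - p y\<bar> * ln (shifted_norm x) \<le> (\<bar>p x - pinf\<bar> + \<bar>p y - pinf\<bar>) * ln (shifted_norm x)"
    using shifted_norm_ge(3)[of x] by (intro mult_right_mono) auto
  also have "\<dots> \<le> \<bar>p x - pinf\<bar> * ln (shifted_norm x) + (?n + 1) * (\<bar>p y - pinf\<bar> * ln (shifted_norm y))"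
    using mult_left_mono[OF ln, of "\<bar>p y - pinf\<bar>"] by (simp add: algebra_simps)
  also have "\<dots> \<le> Cinf + (?n + 1) * Cinf" by (intro add_mono mult_left_mono decay_ln) auto
  finally show ?thesis by (simp add: algebra_simps)
qed

text \<open>For small \<open>l\<close> the distance of two points is at most \<open>sqrt l\<close>, so that its logarithm is comparable to
\<open>ln l\<close>. The threshold \<open>1 / (4 n\<^sup>2)\<close> absorbs the factor \<open>n\<close> between the distance and the side; above
it \<open>ln l\<close> is bounded.\<close>

lemma oscillation_ln_small_side:
  assumes l: "0 < l" "l < 1" and Q: "x \<in> cube c l" "y \<in> cube c l"
  shows "\<bar>p x - p y\<bar> * - ln l \<le> 2 * C0 + P * ln (4 * real CARD('n) ^ 2)"
proof (cases "l \<le> 1 / (4 * real CARD('n) ^ 2)")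
  case True
  let ?n = "real CARD('n)"
  have n: "1 \<le> ?n" by (simp add: Suc_le_eq)
  have rest: "0 \<le> P * ln (4 * ?n ^ 2)" using P n by (intro mult_nonneg_nonneg ln_ge_zero) (auto intro: order_trans[of 1 4])
  show ?thesis
  proof (cases "x = y")
    case False
    have "sqrt l \<le> sqrt ((1 / (2 * ?n)) ^ 2)"
      using True by (intro real_sqrt_le_mono) (simp add: power_divide power_mult_distrib)
    then have "sqrt l \<le> 1 / (2 * ?n)" using n by simp
    then have root: "?n * sqrt l \<le> 1 / 2" using n by (simp add: field_simps)
    have "?n * l = (?n * sqrt l) * sqrt l" using l by simp
    also have "\<dots> \<le> 1 / 2 * sqrt l" using root l by (intro mult_right_mono) auto
    finally have d: "norm (x - y) \<le> 1 / 2 * sqrt l" using norm_diff_cube[OF Q] by linarith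
    moreover have s1: "sqrt l < 1" using l by simp
    ultimately have half: "norm (x - y) < 1 / 2" by linarith
    have "norm (x - y) \<le> sqrt l" using d real_sqrt_ge_zero[of l] l by linarith
    then have "ln (norm (x - y)) \<le> ln (sqrt l)" using False l by (subst ln_le_cancel_iff) auto
    also have "\<dots> = ln l / 2" using l by (simp add: ln_sqrt)
    finally have ln: "- ln l \<le> 2 * - ln (norm (x - y))" by simp
    have pos: "0 < - ln (norm (x - y))" using False half by simp
    have "\<bar>p x - p y\<bar> * - ln l \<le> \<bar>p x - p y\<bar> * (2 * - ln (norm (x - y)))"
      using ln by (intro mult_left_mono) auto
    moreover have "\<bar>p x - p y\<bar> * - ln (norm (x - y)) \<le> C0"
      using local_Holder[OF half] unfolding pos_le_divide_eq[OF pos] .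
    ultimately show ?thesis using rest by linarith
  qed (use C0 rest in simp)
next
  case False
  let ?n = "real CARD('n)"
  have n: "1 \<le> ?n" by (simp add: Suc_le_eq)
  have "- ln l \<le> ln (4 * ?n ^ 2)"
  proof -
    have "ln (1 / (4 * ?n ^ 2)) \<le> ln l" using False n l by (subst ln_le_cancel_iff) auto
    then show ?thesis using n by (simp add: ln_div)
  qed
  then have "\<bar>p x - p y\<bar> * - ln l \<le> P * ln (4 * ?n ^ 2)"
    using p[of x] p[of y] l by (intro mult_mono) auto
  then show ?thesis using C0 by simp
qed

lemma oscillation_bound:
  obtains H where "0 \<le> H"
    "\<And>c l x y. distant_cube c l \<Longrightarrow> x \<in> cube c l \<Longrightarrow> y \<in> cube c l \<Longrightarrow>
       \<bar>p x - p y\<bar> * (\<bar>ln l\<bar> + ln (shifted_norm x)) \<le> H"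
proof
  define H1 where "H1 = (real CARD('n) + 2) * Cinf"
  define H2 where "H2 = 2 * C0 + P * ln (4 * real CARD('n) ^ 2)"
  have H1: "0 \<le> H1" using Cinf by (simp add: H1_def)
  have n: "1 \<le> real CARD('n)" by (simp add: Suc_le_eq)
  have H2: "0 \<le> H2" unfolding H2_def using P C0 n
    by (intro add_nonneg_nonneg mult_nonneg_nonneg ln_ge_zero) (auto intro: order_trans[of 1 4])
  show "0 \<le> 2 * H1 + H2" using H1 H2 by simp
  fix c x y :: "real ^ 'n" and l assume Q: "distant_cube c l" "x \<in> cube c l" "y \<in> cube c l"
  have l: "0 < l" "l \<le> shifted_norm x" using Q by (auto simp: distant_cube_def)
  have 1: "\<bar>p x - p y\<bar> * ln (shifted_norm x) \<le> H1" unfolding H1_def by (rule oscillation_ln_norm[OF Q])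
  have "\<bar>p x - p y\<bar> * \<bar>ln l\<bar> \<le> H1 + H2"
  proof (cases "l < 1")
    case True
    then show ?thesis using oscillation_ln_small_side[OF l(1) True Q(2,3)] l H1 by (simp add: H2_def)
  next
    case False
    then have "\<bar>ln l\<bar> \<le> ln (shifted_norm x)" using l by simp
    then have "\<bar>p x - p y\<bar> * \<bar>ln l\<bar> \<le> \<bar>p x - p y\<bar> * ln (shifted_norm x)" by (intro mult_left_mono) auto
    then show ?thesis using 1 H2 by linarith
  qed
  then show "\<bar>p x - p y\<bar> * (\<bar>ln l\<bar> + ln (shifted_norm x)) \<le> 2 * H1 + H2"
    using 1 by (simp add: distrib_left)
qed

end

section \<open>Normalised weights\<close>

lemma ennreal_le_cmult_imp:
  assumes "0 < y" "ennreal x \<le> ennreal y * m"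
  shows "ennreal (x / y) \<le> m"
proof (cases m)
  case (real r)
  then have "ennreal x \<le> ennreal (y * r)" using assms by (simp add: ennreal_mult)
  then have "x \<le> y * r" using assms real by (simp add: ennreal_le_iff)
  then show ?thesis using real assms by (intro ord_le_eq_trans[OF ennreal_leI]) (auto simp: pos_divide_le_eq mult.commute)
qed auto

lemma le_ennreal_weaken: "m \<le> ennreal a \<Longrightarrow> a \<le> b \<Longrightarrow> m \<le> ennreal b"
  using ennreal_leI order_trans by blast

lemma ennreal_le_weaken: "ennreal b \<le> m \<Longrightarrow> a \<le> b \<Longrightarrow> ennreal a \<le> m"
  using ennreal_leI order_trans by blast

lemma mass_Un_le:
  assumes "f \<in> borel_measurable lebesgue" "E \<in> sets lebesgue" "F \<in> sets lebesgue"
  shows "mass f (E \<union> F) \<le> mass f E + mass f F"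
  using emeasure_subadditive[of E "density lebesgue (\<lambda>x. ennreal (f x))" F] assms
  by (simp add: mass_density)

text \<open>Here \<open>W\<close> stands for \<open>w\<^sup>p\<close> and \<open>scale c l\<close> for the norm of \<open>w\<close> on the cube with corner \<open>c\<close> and side \<open>l\<close>,
up to a constant factor. The hypothesis \<open>spread\<close> is a normalised form of the Muckenhoupt condition, in
which the density still depends on the cube.\<close>

locale normalised_weight = log_Holder_exponent p P C0 Cinf pinf
  for p :: "real ^ 'n \<Rightarrow> real" and P C0 Cinf pinf :: real +
  fixes W :: "real ^ 'n \<Rightarrow> real" and K :: real and scale :: "real ^ 'n \<Rightarrow> real \<Rightarrow> real"
  assumes W [measurable]: "W \<in> borel_measurable lebesgue" "\<And>x. 0 \<le> W x"
    and K: "1 \<le> K"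
    and scale: "\<And>c l. 0 < l \<Longrightarrow> 0 < scale c l"
    and normalised: "\<And>c l. 0 < l \<Longrightarrow> mass (\<lambda>x. W x * scale c l powr - p x) (cube c l) \<le> 1"
    and spread: "\<And>c l E. 0 < l \<Longrightarrow> E \<in> sets lebesgue \<Longrightarrow> E \<subseteq> cube c l \<Longrightarrow>
       ennreal ((measure lebesgue E / (K * l ^ CARD('n))) powr P) \<le> mass (\<lambda>x. W x * scale c l powr - p x) E"
begin

abbreviation scaled :: "real \<Rightarrow> real ^ 'n \<Rightarrow> real" where
  "scaled t x \<equiv> W x * t powr - p x"

abbreviation centred_scale :: "real \<Rightarrow> real" where
  "centred_scale R \<equiv> scale (\<chi> i. - R) (2 * R)"

lemma scaled_measurable [measurable]: "scaled t \<in> borel_measurable lebesgue"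
  by measurable

lemma measure_cube: "0 < l \<Longrightarrow> measure lebesgue (cube (c :: real ^ 'n) l) = l ^ CARD('n)"
  using emeasure_cube[of l c] by (simp add: measure_def)

lemma change_scale:
  assumes "0 < s" "s \<le> t" "E \<in> sets lebesgue"
  shows "mass (scaled t) E \<le> ennreal (s / t) * mass (scaled s) E"
proof (rule mass_le_cmult)
  fix x assume "x \<in> E"
  have "t powr - p x = s powr - p x * (s / t) powr p x"
    using assms by (simp add: powr_divide powr_minus field_simps)
  also have "\<dots> \<le> s powr - p x * (s / t) powr 1"
    using assms p(1)[of x] by (intro mult_left_mono powr_mono') auto
  also have "(s / t) powr 1 = s / t" using assms by simp
  finally have "t powr - p x \<le> s powr - p x * (s / t)" .
  then have "W x * t powr - p x \<le> W x * (s powr - p x * (s / t))" by (rule mult_left_mono) (rule W(2))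
  then show "scaled t x \<le> s / t * scaled s x" by (simp add: mult_ac)
qed (use assms in auto)

text \<open>A norm on a cube dominates the norm on a subcube. Since \<open>scale\<close> need not be exactly a norm, this and the
next lemma are derived from the two-sided normalisation, with a loss in the constants.\<close>

lemma scale_subcube_le:
  assumes l: "0 < l" "0 < l'" and sub: "cube c' l' \<subseteq> cube c l"
  shows "scale c' l' \<le> K powr P * scale c l"
proof (cases "scale c' l' \<le> scale c l")
  case True
  have "1 \<le> K powr P" using K P by (simp add: ge_one_powr_ge_zero)
  then have "1 * scale c l \<le> K powr P * scale c l" using scale[OF l(1), of c] by (intro mult_right_mono) auto
  then show ?thesis using True by simp
next
  case False
  let ?s = "scale c l" and ?t = "scale c' l'"
  have s: "0 < ?s" and t: "0 < ?t" using scale l by auto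
  have "ennreal ((l' ^ CARD('n) / (K * l' ^ CARD('n))) powr P) \<le> mass (scaled ?t) (cube c' l')"
    using spread[OF l(2), of "cube c' l'" c'] measure_cube[OF l(2), of c'] by simp
  also have "\<dots> \<le> ennreal (?s / ?t) * mass (scaled ?s) (cube c' l')"
    using False s by (intro change_scale) auto
  also have "\<dots> \<le> ennreal (?s / ?t) * 1"
    using normalised[OF l(1), of c] mass_mono_set[OF sub, of "scaled ?s"] by (intro mult_left_mono) auto
  also have "l' ^ CARD('n) / (K * l' ^ CARD('n)) = 1 / K" using l by simp
  finally have "(1 / K) powr P \<le> ?s / ?t" using s t by (simp add: ennreal_le_iff)
  then have "1 / K powr P \<le> ?s / ?t" using K by (simp add: powr_divide)
  moreover have "0 < K powr P" using K by simp
  ultimately show ?thesis using t by (simp add: field_simps)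
qed

lemma scale_subcube_ge:
  assumes l: "0 < l" "0 < l'" and sub: "cube c' l' \<subseteq> cube c l"
  shows "scale c l * (l' ^ CARD('n) / (K * l ^ CARD('n))) powr P \<le> scale c' l'"
proof -
  let ?s = "scale c' l'" and ?t = "scale c l" and ?q = "(l' ^ CARD('n) / (K * l ^ CARD('n))) powr P"
  have s: "0 < ?s" and t: "0 < ?t" using scale l by auto
  have *: "ennreal ?q \<le> mass (scaled ?t) (cube c' l')"
    using spread[OF l(1) _ sub] measure_cube[OF l(2), of c'] by simp
  show ?thesis
  proof (cases "?s \<le> ?t")
    case True
    note *
    also have "mass (scaled ?t) (cube c' l') \<le> ennreal (?s / ?t) * mass (scaled ?s) (cube c' l')"
      using True s by (intro change_scale) auto
    also have "\<dots> \<le> ennreal (?s / ?t) * 1"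
      using normalised[OF l(2), of c'] by (intro mult_left_mono) auto
    finally have "?q \<le> ?s / ?t" using s t by (simp add: ennreal_le_iff)
    then show ?thesis using t by (simp add: field_simps)
  next
    case False
    have "ennreal ?q \<le> 1" using * mass_mono_set[OF sub, of "scaled ?t"] normalised[OF l(1), of c] by order
    then have "?q \<le> 1" by (simp add: ennreal_le_1)
    then have "?t * ?q \<le> ?t * 1" using t by (intro mult_left_mono) auto
    then show ?thesis using False by simp
  qed
qed

lemma mass_cube_le:
  assumes l: "0 < l"
  shows "mass W (cube c l) \<le> ennreal (max 1 (scale c l) powr P)"
proof -
  have "mass W (cube c l) \<le> ennreal (max 1 (scale c l) powr P) * mass (scaled (scale c l)) (cube c l)"
  proof (rule mass_le_cmult)
    fix x
    let ?t = "scale c l"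
    have t: "0 < ?t" using scale l by auto
    have "?t powr p x \<le> max 1 ?t powr p x" using t p(1)[of x] by (intro powr_mono2) auto
    also have "\<dots> \<le> max 1 ?t powr P" using p(2) by (intro powr_mono) auto
    finally have "1 \<le> max 1 ?t powr P * ?t powr - p x"
      using t by (simp add: powr_minus pos_le_divide_eq divide_inverse[symmetric])
    then have "W x * 1 \<le> W x * (max 1 ?t powr P * ?t powr - p x)" by (rule mult_left_mono) (rule W(2))
    then show "W x \<le> max 1 ?t powr P * scaled ?t x" by (simp add: mult_ac)
  qed auto
  also have "\<dots> \<le> ennreal (max 1 (scale c l) powr P) * 1" by (intro mult_left_mono normalised l) auto
  finally show ?thesis by simp
qed

lemma centred_cube_mono: "r \<le> R \<Longrightarrow> (centred_cube r :: (real ^ 'n) set) \<subseteq> centred_cube R"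
  unfolding subset_iff mem_centred_cube by (meson order_trans)

lemma centred_scale_ge: "1 \<le> R \<Longrightarrow> centred_scale 1 / K powr P \<le> centred_scale R"
  using scale_subcube_le[OF _ _ centred_cube_mono, of R 1] K by (simp add: field_simps)

lemma centred_scale_le:
  assumes R: "1 \<le> R"
  shows "centred_scale R \<le> centred_scale 1 * K powr P * R powr (real CARD('n) * P)"
proof -
  have "(2 * 1) ^ CARD('n) / (K * (2 * R) ^ CARD('n)) = 1 / (K * R ^ CARD('n))"
    using R by (simp add: power_mult_distrib)
  then have "centred_scale R * (1 / (K * R ^ CARD('n))) powr P \<le> centred_scale 1"
    using scale_subcube_ge[OF _ _ centred_cube_mono, of R 1] R by simp
  moreover have "(1 / (K * R ^ CARD('n))) powr P = 1 / (K powr P * R powr (real CARD('n) * P))"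
    using K R by (simp add: powr_divide powr_mult powr_realpow[symmetric] powr_powr)
  moreover have "0 < K powr P * R powr (real CARD('n) * P)" using K R by simp
  ultimately show ?thesis by (simp add: pos_divide_le_eq mult_ac)
qed

text \<open>Polynomial growth is what makes a centred cube whose side is a small power of a given size
negligible.\<close>

lemma centred_mass_growth:
  obtains C D where "1 \<le> C" "1 \<le> D"
     "\<And>R. 1 \<le> R \<Longrightarrow> mass W (centred_cube R) \<le> ennreal (C * R powr D)"
proof
  define N where "N = real CARD('n) * P"
  have "1 * 1 \<le> N" unfolding N_def using P by (intro mult_mono) (auto simp: Suc_le_eq)
  then have N: "1 \<le> N" by simp
  define A where "A = max 1 (centred_scale 1 * K powr P)"
  show "1 \<le> A powr P" using P by (intro ge_one_powr_ge_zero) (auto simp: A_def)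
  have NP: "N * 1 \<le> N * P" using N P by (intro mult_left_mono) auto
  show "1 \<le> N * P" using N NP by linarith
  fix R :: real assume R: "1 \<le> R"
  have "centred_scale R \<le> A * R powr N"
    using centred_scale_le[OF R] mult_right_mono[of "centred_scale 1 * K powr P" A "R powr N"] by (simp add: A_def N_def)
  moreover have "1 * 1 \<le> A * R powr N" using R N by (intro mult_mono ge_one_powr_ge_zero) (auto simp: A_def)
  ultimately have "max 1 (centred_scale R) powr P \<le> (A * R powr N) powr P"
    using P by (intro powr_mono2) auto
  also have "\<dots> = A powr P * R powr (N * P)" using R by (simp add: A_def powr_mult powr_powr)
  finally have le: "max 1 (centred_scale R) powr P \<le> A powr P * R powr (N * P)" .
  have "0 < 2 * R" using R by simp
  from le_ennreal_weaken[OF mass_cube_le[OF this] le]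
  show "mass W (centred_cube R) \<le> ennreal (A powr P * R powr (N * P))" .
qed

text \<open>Compare the cube with the centred cube of half-side \<open>2 (shifted_norm x)\<close>, whose scale is bounded above and
below by powers of \<open>shifted_norm x\<close>.\<close>

lemma distant_scale_bound:
  obtains A where "0 \<le> A"
    "\<And>c l x. distant_cube c l \<Longrightarrow> x \<in> cube c l \<Longrightarrow> \<bar>ln (scale c l)\<bar> \<le> A * (\<bar>ln l\<bar> + ln (shifted_norm x))"
proof -
  define N where "N = real CARD('n) * P"
  have N: "0 \<le> N" using P by (simp add: N_def)
  define b where "b = centred_scale 1"
  have b: "0 < b" unfolding b_def by (rule scale) simp
  have K0: "0 < K" "0 \<le> ln K" using K by auto
  define A0 where "A0 = \<bar>ln b\<bar> + 2 * P * ln K + N * ln 4"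
  have A0: "0 \<le> A0" using P K0 N by (simp add: A0_def)
  have "\<bar>ln (scale c l)\<bar> \<le> (A0 + N) * (\<bar>ln l\<bar> + ln (shifted_norm x))"
    if Q: "distant_cube c l" "x \<in> cube c l" for c l x
  proof -
    define m where "m = shifted_norm x"
    have m: "1 < m" "1 \<le> ln m" unfolding m_def using shifted_norm_ge by auto
    have l: "0 < l" "l \<le> m" using Q by (auto simp: distant_cube_def m_def)
    have "norm x \<le> m" by (simp add: m_def)
    then have sub: "cube c l \<subseteq> centred_cube (2 * m)" using l by (intro cube_subset_centred[OF Q(2)]) auto
    have s: "0 < scale c l" by (rule scale[OF l(1)])
    have b2: "0 < centred_scale (2 * m)" using m by (intro scale) auto
    have "scale c l \<le> K powr P * centred_scale (2 * m)" using m l by (intro scale_subcube_le[OF _ _ sub]) auto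
    also have "\<dots> \<le> K powr P * (b * K powr P * (2 * m) powr N)"
      using centred_scale_le[of "2 * m"] m by (intro mult_left_mono) (auto simp: b_def N_def)
    finally have "ln (scale c l) \<le> ln (K powr P * (b * K powr P * (2 * m) powr N))"
      using s b K0 m by (subst ln_le_cancel_iff) auto
    also have "\<dots> = 2 * P * ln K + ln b + N * (ln 2 + ln m)"
      using K0 b m by (simp add: ln_mult ln_powr)
    finally have "ln (scale c l) \<le> 2 * P * ln K + ln b + N * ln 2 + N * ln m" by (simp add: distrib_left)
    moreover have "N * ln 2 \<le> N * ln 4" using N by (intro mult_left_mono) auto
    moreover have "0 \<le> N * \<bar>ln l\<bar>" using N by simp
    ultimately have upper: "ln (scale c l) \<le> A0 + N * \<bar>ln l\<bar> + N * ln m" unfolding A0_def by linarith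
    let ?q = "(l ^ CARD('n) / (K * (4 * m) ^ CARD('n))) powr P"
    have "b / K powr P \<le> centred_scale (2 * m)" unfolding b_def using m by (intro centred_scale_ge) auto
    then have "b / K powr P * ?q \<le> centred_scale (2 * m) * ?q" by (rule mult_right_mono) simp
    also have "2 * (2 * m) = 4 * m" by simp
    then have "centred_scale (2 * m) * ?q \<le> scale c l"
      using scale_subcube_ge[OF _ l(1) sub] m(1) by simp
    finally have "b / K powr P * ?q \<le> scale c l" .
    then have "ln (b / K powr P * (l ^ CARD('n) / (K * (4 * m) ^ CARD('n))) powr P) \<le> ln (scale c l)"
      using s b K0 m l by (subst ln_le_cancel_iff) auto
    moreover have "ln (b / K powr P * (l ^ CARD('n) / (K * (4 * m) ^ CARD('n))) powr P)
        = ln b - P * ln K + P * (CARD('n) * ln l - (ln K + CARD('n) * (ln 4 + ln m)))"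
      using K0 b m l by (simp add: ln_mult ln_powr ln_div ln_realpow distrib_left)
    ultimately have "ln b - 2 * P * ln K + N * ln l - N * ln 4 - N * ln m \<le> ln (scale c l)"
      by (simp add: N_def algebra_simps)
    moreover have "- (N * \<bar>ln l\<bar>) \<le> N * ln l"
      using mult_left_mono[of "- \<bar>ln l\<bar>" "ln l" N] N by auto
    ultimately have "- (A0 + N * \<bar>ln l\<bar> + N * ln m) \<le> ln (scale c l)" unfolding A0_def by linarith
    then have "\<bar>ln (scale c l)\<bar> \<le> A0 + N * \<bar>ln l\<bar> + N * ln m" using upper by linarith
    moreover have "A0 * 1 \<le> A0 * (\<bar>ln l\<bar> + ln m)" using A0 m by (intro mult_left_mono) auto
    ultimately show ?thesis by (simp add: m_def algebra_simps)
  qed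
  then show ?thesis using that[of "A0 + N"] A0 N by auto
qed

text \<open>Both the side and the scale have a logarithm of size \<open>\<bar>ln l\<bar> + ln (shifted_norm x)\<close>, and \<open>oscillation_bound\<close>
controls the product of this quantity with the oscillation of the exponent.\<close>

lemma distant_comparability:
  obtains H where "1 \<le> H"
    "\<And>c l x y. distant_cube c l \<Longrightarrow> x \<in> cube c l \<Longrightarrow> y \<in> cube c l \<Longrightarrow> l powr (p x - p y) \<le> H"
    "\<And>c l x y. distant_cube c l \<Longrightarrow> x \<in> cube c l \<Longrightarrow> y \<in> cube c l \<Longrightarrow> scale c l powr (p x - p y) \<le> H"
proof -
  obtain A where A: "0 \<le> A" "\<And>c l x. distant_cube c l \<Longrightarrow> x \<in> cube c l \<Longrightarrow>
      \<bar>ln (scale c l)\<bar> \<le> A * (\<bar>ln l\<bar> + ln (shifted_norm x))" by (rule distant_scale_bound) blast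
  obtain B where B: "0 \<le> B" "\<And>c l x y. distant_cube c l \<Longrightarrow> x \<in> cube c l \<Longrightarrow> y \<in> cube c l \<Longrightarrow>
       \<bar>p x - p y\<bar> * (\<bar>ln l\<bar> + ln (shifted_norm x)) \<le> B" by (rule oscillation_bound) blast
  show ?thesis
  proof
    show "1 \<le> exp ((1 + A) * B)" using A(1) B(1) by simp
    fix c x y :: "real ^ 'n" and l assume Q: "distant_cube c l" "x \<in> cube c l" "y \<in> cube c l"
    have l: "0 < l" using Q by (simp add: distant_cube_def)
    have AB: "0 \<le> A * B" using A(1) B(1) by simp
    have "0 \<le> ln (shifted_norm x)" using shifted_norm_ge(3)[of x] by simp
    then have "\<bar>p x - p y\<bar> * \<bar>ln l\<bar> \<le> \<bar>p x - p y\<bar> * (\<bar>ln l\<bar> + ln (shifted_norm x))"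
      by (intro mult_left_mono) auto
    then have "\<bar>p x - p y\<bar> * \<bar>ln l\<bar> \<le> (1 + A) * B" using B(2)[OF Q] AB by (simp add: distrib_right)
    then show "l powr (p x - p y) \<le> exp ((1 + A) * B)" by (rule powr_le_of_log_bound[OF l])
    have "\<bar>p x - p y\<bar> * \<bar>ln (scale c l)\<bar> \<le> \<bar>p x - p y\<bar> * (A * (\<bar>ln l\<bar> + ln (shifted_norm x)))"
      by (intro mult_left_mono A Q) auto
    also have "\<dots> \<le> A * B" using mult_left_mono[OF B(2)[OF Q] A(1)] by (simp add: mult_ac)
    also have "\<dots> \<le> (1 + A) * B" using B by (simp add: distrib_right)
    finally show "scale c l powr (p x - p y) \<le> exp ((1 + A) * B)"
      by (rule powr_le_of_log_bound[OF scale[OF l]])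
  qed
qed

end

section \<open>The Muckenhoupt condition for the power of the weight\<close>

text \<open>A cube that is not distant has a point \<open>x\<close> with \<open>shifted_norm x < l\<close>, so it lies close to the origin.\<close>

lemma distant_or_central:
  assumes l: "0 < l"
  shows "distant_cube c l \<or> 1 \<le> 2 * l \<and> cube c l \<subseteq> centred_cube (2 * l)"
proof (rule disjCI)
  assume "\<not> (1 \<le> 2 * l \<and> cube c l \<subseteq> centred_cube (2 * l))"
  then have *: "2 * l < 1 \<or> \<not> cube c l \<subseteq> centred_cube (2 * l)" by auto
  have "l \<le> shifted_norm x" if x: "x \<in> cube c l" for x
  proof (rule ccontr)
    assume "\<not> l \<le> shifted_norm x"
    moreover have "0 < exp (1 :: real)" by simp
    ultimately have "norm x + l \<le> 2 * l" "1 < l" using shifted_norm_ge(2)[of x] by linarith+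
    then show False using * cube_subset_centred[OF x, of "2 * l"] by auto
  qed
  then show "distant_cube c l" using l by (simp add: distant_cube_def)
qed

lemma mass_split_le:
  assumes "f \<in> borel_measurable lebesgue" "E \<in> sets lebesgue" "B \<in> sets lebesgue"
  shows "mass f E \<le> mass f (E \<inter> B) + mass f (E - B)"
  using mass_Un_le[of f "E \<inter> B" "E - B"] assms by (simp add: Int_Diff_Un)

context log_Holder_exponent
begin

text \<open>Outside the centred cube of half-side \<open>r\<close> the deviation of the exponent from its limit is
\<open>O (1 / ln r)\<close>. This freezes the exponent for any base whose logarithm is \<open>O (1 + ln r)\<close>.\<close>

lemma powr_off_centre:
  assumes r: "1 \<le> r" and x: "x \<notin> centred_cube r" and t: "0 < t" "\<bar>ln t\<bar> \<le> A + M * ln r"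
    and A: "0 \<le> A" and M: "0 \<le> M"
  shows "t powr (p x - pinf) \<le> exp ((A + M) * Cinf)" "t powr (pinf - p x) \<le> exp ((A + M) * Cinf)"
proof -
  obtain i where "r < \<bar>x $ i\<bar>" using x unfolding mem_centred_cube by (auto simp: not_le)
  then have "r \<le> norm x" using component_le_norm_cart[of x i] by linarith
  moreover have "0 < exp (1 :: real)" by simp
  ultimately have "r \<le> shifted_norm x" by linarith
  then have ln: "ln r \<le> ln (shifted_norm x)" using r by (subst ln_le_cancel_iff) auto
  have m: "1 \<le> ln (shifted_norm x)" by (rule shifted_norm_ge)
  have "\<bar>ln t\<bar> \<le> A * ln (shifted_norm x) + M * ln (shifted_norm x)"
    using t(2) mult_left_mono[OF ln M] mult_left_mono[OF m A] by linarith
  then have "\<bar>p x - pinf\<bar> * \<bar>ln t\<bar> \<le> \<bar>p x - pinf\<bar> * ((A + M) * ln (shifted_norm x))"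
    by (intro mult_left_mono) (auto simp: distrib_right)
  also have "\<dots> \<le> (A + M) * Cinf" using mult_left_mono[OF decay_ln[of x], of "A + M"] A M by (simp add: mult_ac)
  finally have *: "\<bar>p x - pinf\<bar> * \<bar>ln t\<bar> \<le> (A + M) * Cinf" .
  show "t powr (p x - pinf) \<le> exp ((A + M) * Cinf)" by (rule powr_le_of_log_bound[OF t(1) *])
  show "t powr (pinf - p x) \<le> exp ((A + M) * Cinf)"
    by (rule powr_le_of_log_bound[OF t(1)]) (use * in \<open>simp add: abs_minus_commute\<close>)
qed

end

context normalised_weight
begin

lemma centred_scale_pos: "0 < R \<Longrightarrow> 0 < centred_scale R"
  by (rule scale) simp

text \<open>If \<open>t = centred_scale R\<close> is at least \<open>1\<close>, split at \<open>r\<close> with \<open>r powr D = sqrt t\<close>. The inner cube has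
mass \<open>O (sqrt t)\<close>, which is harmless since the limit exponent is at least \<open>1\<close>. Outside it the exponent is
frozen. Small values of \<open>t\<close> are bounded away from \<open>0\<close>.\<close>

lemma centred_upper:
  obtains H where "1 \<le> H"
    "\<And>R. 1 \<le> R \<Longrightarrow> mass W (centred_cube R) \<le> ennreal (H * centred_scale R powr pinf)"
proof -
  obtain C D where CD: "1 \<le> C" "1 \<le> D"
     "\<And>R. 1 \<le> R \<Longrightarrow> mass W (centred_cube R) \<le> ennreal (C * R powr D)"
    by (rule centred_mass_growth) blast
  define c where "c = centred_scale 1 / K powr P"
  have c: "0 < c" unfolding c_def using centred_scale_pos[of 1] K by simp
  define G where "G = exp ((0 + 2 * D) * Cinf)"
  have "mass W (centred_cube R) \<le> ennreal ((c powr - pinf + C + G) * centred_scale R powr pinf)"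
    if R: "1 \<le> R" for R
  proof -
    define t where "t = centred_scale R"
    have t: "0 < t" "c \<le> t" unfolding t_def c_def using centred_scale_pos[of R] centred_scale_ge[OF R] R by auto
    have "mass W (centred_cube R) \<le> ennreal (c powr - pinf * t powr pinf + (C + G) * t powr pinf)"
    proof (cases "1 \<le> t")
      case False
      have "c powr pinf \<le> t powr pinf" using c t pinf by (intro powr_mono2) auto
      then have "1 \<le> c powr - pinf * t powr pinf" using c by (simp add: powr_minus field_simps)
      moreover have one: "mass W (centred_cube R) \<le> ennreal 1"
        using mass_cube_le[of "2 * R" "\<chi> i. - R"] R False by (simp add: t_def)
      moreover have "0 \<le> (C + G) * t powr pinf" using CD by (simp add: G_def)
      ultimately show ?thesis by (intro le_ennreal_weaken[OF one]) linarith
    next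
      case True
      define r where "r = t powr (1 / (2 * D))"
      have r: "1 \<le> r" unfolding r_def using True CD by (intro ge_one_powr_ge_zero) auto
      have lnt: "\<bar>ln t\<bar> \<le> 0 + 2 * D * ln r" unfolding r_def using True CD t by (simp add: ln_powr)
      have "mass W (centred_cube R \<inter> centred_cube r) \<le> mass W (centred_cube r)" by (rule mass_mono_set) auto
      also have "\<dots> \<le> ennreal (C * r powr D)" by (rule CD(3)[OF r])
      also have "r powr D = t powr (1 / 2)" unfolding r_def using CD by (simp add: powr_powr)
      also have "ennreal (C * t powr (1 / 2)) \<le> ennreal (C * t powr pinf)"
        using True CD pinf by (intro ennreal_leI mult_left_mono powr_mono) auto
      finally have near: "mass W (centred_cube R \<inter> centred_cube r) \<le> ennreal (C * t powr pinf)" .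
      have "mass W (centred_cube R - centred_cube r) \<le> ennreal (G * t powr pinf) * mass (scaled t) (centred_cube R - centred_cube r)"
      proof (rule mass_le_cmult)
        fix x :: "real ^ 'n" assume x: "x \<in> centred_cube R - centred_cube r"
        have "t powr (p x - pinf) \<le> G" unfolding G_def
          using x CD by (intro powr_off_centre[OF r _ t(1) lnt]) auto
        then have "1 \<le> G * t powr pinf * t powr - p x"
          using t(1) by (simp add: powr_diff powr_minus field_simps)
        then have "W x * 1 \<le> W x * (G * t powr pinf * t powr - p x)" by (rule mult_left_mono) (rule W(2))
        then show "W x \<le> G * t powr pinf * scaled t x" by (simp add: mult_ac)
      qed (auto simp: G_def)
      also have "mass (scaled t) (centred_cube R - centred_cube r) \<le> 1"
      proof (rule order_trans[OF mass_mono_set])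
        show "mass (scaled t) (centred_cube R) \<le> 1" unfolding t_def using R by (intro normalised) simp
      qed auto
      finally have far: "mass W (centred_cube R - centred_cube r) \<le> ennreal (G * t powr pinf)"
        by (simp add: mult_left_mono)
      have "mass W (centred_cube R) \<le> mass W (centred_cube R \<inter> centred_cube r) + mass W (centred_cube R - centred_cube r)"
        by (intro mass_split_le) auto
      also have "\<dots> \<le> ennreal (C * t powr pinf) + ennreal (G * t powr pinf)" by (intro add_mono near far)
      also have "\<dots> = ennreal ((C + G) * t powr pinf)"
        using CD by (simp add: G_def distrib_right)
      also have "\<dots> \<le> ennreal (c powr - pinf * t powr pinf + (C + G) * t powr pinf)"
        by (intro ennreal_leI) simp
      finally show ?thesis .
    qed
    then show ?thesis by (simp add: t_def algebra_simps)
  qed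
  moreover have "1 \<le> c powr - pinf + C + G"
    using CD(1) by (simp add: G_def add_nonneg_nonneg add_increasing add_increasing2)
  ultimately show ?thesis using that by blast
qed

text \<open>The same splitting as in \<open>centred_upper\<close>. For large \<open>t\<close> the normalised mass of the inner cube is
\<open>O (1 / sqrt t)\<close>, less than half of the normalised mass of \<open>E\<close>. For bounded \<open>t\<close> all powers of \<open>t\<close> are
comparable to \<open>1\<close>.\<close>

lemma centred_lower:
  assumes \<alpha>: "0 < \<alpha>"
  obtains \<beta> where "0 < \<beta>"
    "\<And>R E. 1 \<le> R \<Longrightarrow> E \<in> sets lebesgue \<Longrightarrow> E \<subseteq> centred_cube R \<Longrightarrow>
       \<alpha> * (2 * R) ^ CARD('n) \<le> measure lebesgue E \<Longrightarrow> ennreal (\<beta> * centred_scale R powr pinf) \<le> mass W E"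
proof -
  obtain C D where CD: "1 \<le> C" "1 \<le> D"
     "\<And>R. 1 \<le> R \<Longrightarrow> mass W (centred_cube R) \<le> ennreal (C * R powr D)"
    by (rule centred_mass_growth) blast
  define c where "c = min 1 (centred_scale 1 / K powr P)"
  have c: "0 < c" "c \<le> 1" unfolding c_def using centred_scale_pos[of 1] K by auto
  define G where "G = exp ((0 + 2 * D) * Cinf)"
  define \<delta> where "\<delta> = (\<alpha> / K) powr P"
  have \<delta>: "0 < \<delta>" unfolding \<delta>_def using \<alpha> K by simp
  \<comment> \<open>Above this threshold \<open>C / sqrt t \<le> \<delta> / 2\<close>.\<close>
  define a where "a = max 1 ((2 * C / \<delta>) ^ 2)"
  define \<beta>1 where "\<beta>1 = \<delta> * c powr P * a powr - pinf"
  define \<beta>2 where "\<beta>2 = \<delta> / 2 / G"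
  have a: "1 \<le> a" by (simp add: a_def)
  have \<beta>: "0 < \<beta>1" "0 < \<beta>2" using \<delta> c a by (auto simp: \<beta>1_def \<beta>2_def G_def)
  have "ennreal (min \<beta>1 \<beta>2 * centred_scale R powr pinf) \<le> mass W E"
    if R: "1 \<le> R" and E: "E \<in> sets lebesgue" "E \<subseteq> centred_cube R"
      and big: "\<alpha> * (2 * R) ^ CARD('n) \<le> measure lebesgue E" for R E
  proof -
    define t where "t = centred_scale R"
    have t: "0 < t" "c \<le> t"
      unfolding t_def c_def using centred_scale_pos[of R] centred_scale_ge[OF R] R by (auto intro: min.coboundedI2)
    have "\<alpha> / K \<le> measure lebesgue E / (K * (2 * R) ^ CARD('n))"
      using big K R by (simp add: field_simps)
    then have "\<delta> \<le> (measure lebesgue E / (K * (2 * R) ^ CARD('n))) powr P"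
      unfolding \<delta>_def using \<alpha> K P by (intro powr_mono2) auto
    then have le: "\<delta> \<le> (measure lebesgue E / (K * (2 * R) ^ CARD('n))) powr P" .
    have "0 < 2 * R" using R by simp
    from ennreal_le_weaken[OF spread[OF this E] le]
    have V: "ennreal \<delta> \<le> mass (scaled t) E" unfolding t_def .
    show ?thesis
    proof (cases "t < a")
      case True
      note V
      also have "mass (scaled t) E \<le> ennreal (c powr - P) * mass W E"
      proof (rule mass_le_cmult)
        fix x assume "x \<in> E"
        have "t powr - p x \<le> c powr - p x" using t c p(1)[of x] by (intro powr_mono2') auto
        also have "\<dots> \<le> c powr - P" using c p(2)[of x] by (intro powr_mono') auto
        finally show "scaled t x \<le> c powr - P * W x" using W(2)[of x] by (simp add: mult_left_mono mult.commute)
      qed (use E in auto)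
      finally have "ennreal (\<delta> / c powr - P) \<le> mass W E" by (intro ennreal_le_cmult_imp) (use c in auto)
      moreover have "min \<beta>1 \<beta>2 * t powr pinf \<le> \<delta> / c powr - P"
      proof -
        have "t powr pinf \<le> a powr pinf" using True t pinf by (intro powr_mono2) auto
        then have "min \<beta>1 \<beta>2 * t powr pinf \<le> \<beta>1 * a powr pinf" using \<beta> by (intro mult_mono) auto
        also have "\<dots> = \<delta> / c powr - P" using a by (simp add: \<beta>1_def powr_minus field_simps)
        finally show ?thesis .
      qed
      ultimately show ?thesis unfolding t_def by (rule ennreal_le_weaken)
    next
      case False
      then have ta: "a \<le> t" "1 \<le> t" using a by auto
      define r where "r = t powr (1 / (2 * D))"
      have r: "1 \<le> r" unfolding r_def using ta CD by (intro ge_one_powr_ge_zero) auto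
      have lnt: "\<bar>ln t\<bar> \<le> 0 + 2 * D * ln r" unfolding r_def using ta CD t by (simp add: ln_powr)
      have rD: "r powr D = t powr (1 / 2)" unfolding r_def using CD by (simp add: powr_powr)
      have "mass (scaled t) (E \<inter> centred_cube r) \<le> mass (scaled t) (centred_cube r)" by (rule mass_mono_set) auto
      also have "\<dots> \<le> ennreal (1 / t) * mass W (centred_cube r)"
      proof (rule mass_le_cmult)
        fix x
        have "t powr - p x \<le> t powr - 1" using ta p(1)[of x] by (intro powr_mono) auto
        then show "scaled t x \<le> 1 / t * W x"
          using W(2)[of x] t mult_left_mono[of "t powr - p x" "t powr - 1" "W x"] by (simp add: powr_minus divide_inverse mult.commute)
      qed (use t in auto)
      also have "\<dots> \<le> ennreal (1 / t) * ennreal (C * t powr (1 / 2))"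
        using CD(3)[OF r] by (intro mult_left_mono) (auto simp: rD)
      also have "\<dots> = ennreal (C / sqrt t)"
      proof -
        have "1 / t * (C * t powr (1 / 2)) = C / sqrt t"
          using t by (simp add: powr_half_sqrt real_div_sqrt divide_simps)
        then show ?thesis using t by (simp add: ennreal_mult'[symmetric])
      qed
      also have "\<dots> \<le> ennreal (\<delta> / 2)"
      proof (rule ennreal_leI)
        have "2 * C / \<delta> \<le> sqrt t"
          using ta \<delta> CD by (intro real_le_rsqrt) (auto simp: a_def)
        then show "C / sqrt t \<le> \<delta> / 2" using t \<delta> by (simp add: field_simps)
      qed
      finally have near: "mass (scaled t) (E \<inter> centred_cube r) \<le> ennreal (\<delta> / 2)" .
      have far: "mass (scaled t) (E - centred_cube r) \<le> ennreal (G * t powr - pinf) * mass W (E - centred_cube r)"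
      proof (rule mass_le_cmult)
        fix x assume x: "x \<in> E - centred_cube r"
        have "t powr (pinf - p x) \<le> G" unfolding G_def
          using x CD by (intro powr_off_centre[OF r _ t(1) lnt]) auto
        then have "t powr - p x \<le> G * t powr - pinf"
          using t(1) by (simp add: powr_diff powr_minus field_simps)
        then have "W x * t powr - p x \<le> W x * (G * t powr - pinf)" by (rule mult_left_mono) (rule W(2))
        then show "scaled t x \<le> G * t powr - pinf * W x" by (simp add: mult_ac)
      qed (use E in \<open>auto simp: G_def\<close>)
      have "ennreal (\<delta> / 2) + ennreal (\<delta> / 2) = ennreal \<delta>" using \<delta> by (subst ennreal_plus[symmetric]) auto
      also have "\<dots> \<le> mass (scaled t) E" by (rule V)
      also have "\<dots> \<le> mass (scaled t) (E \<inter> centred_cube r) + mass (scaled t) (E - centred_cube r)"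
        using E by (intro mass_split_le) auto
      also have "\<dots> \<le> ennreal (\<delta> / 2) + ennreal (G * t powr - pinf) * mass W E"
      proof (rule add_mono[OF near order_trans[OF far]])
        show "ennreal (G * t powr - pinf) * mass W (E - centred_cube r) \<le> ennreal (G * t powr - pinf) * mass W E"
          by (intro mult_left_mono mass_mono_set) auto
      qed
      finally have le: "ennreal (\<delta> / 2) \<le> ennreal (G * t powr - pinf) * mass W E"
        by (subst (asm) ennreal_add_left_cancel_le) auto
      have "0 < G * t powr - pinf" using t by (simp add: G_def)
      from ennreal_le_cmult_imp[OF this le]
      have "ennreal (\<delta> / 2 / (G * t powr - pinf)) \<le> mass W E" .
      moreover have "min \<beta>1 \<beta>2 * t powr pinf \<le> \<delta> / 2 / (G * t powr - pinf)"
      proof -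
        have "min \<beta>1 \<beta>2 * t powr pinf \<le> \<beta>2 * t powr pinf" by (intro mult_right_mono) auto
        also have "\<dots> = \<delta> / 2 / (G * t powr - pinf)" using t by (simp add: \<beta>2_def powr_minus field_simps)
        finally show ?thesis .
      qed
      ultimately show ?thesis unfolding t_def by (rule ennreal_le_weaken)
    qed
  qed
  then show ?thesis using that[of "min \<beta>1 \<beta>2"] \<beta> by auto
qed

text \<open>The exponent is frozen at the corner \<open>c\<close>.\<close>

lemma distant_mass:
  obtains H where "1 \<le> H"
    "\<And>c l. distant_cube c l \<Longrightarrow> mass W (cube c l) \<le> ennreal (H * scale c l powr p c)"
    "\<And>c l E. distant_cube c l \<Longrightarrow> E \<in> sets lebesgue \<Longrightarrow> E \<subseteq> cube c l \<Longrightarrow>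
       mass (scaled (scale c l)) E \<le> ennreal (H * scale c l powr - p c) * mass W E"
proof -
  obtain H where H: "1 \<le> H"
    "\<And>c l x y. distant_cube c l \<Longrightarrow> x \<in> cube c l \<Longrightarrow> y \<in> cube c l \<Longrightarrow> l powr (p x - p y) \<le> H"
    "\<And>c l x y. distant_cube c l \<Longrightarrow> x \<in> cube c l \<Longrightarrow> y \<in> cube c l \<Longrightarrow> scale c l powr (p x - p y) \<le> H"
    by (rule distant_comparability) blast
  show ?thesis
  proof (rule that[OF H(1)])
    fix c :: "real ^ 'n" and l assume Q: "distant_cube c l"
    then have l: "0 < l" by (simp add: distant_cube_def)
    then have c: "c \<in> cube c l" by (simp add: mem_cube)
    let ?t = "scale c l"
    have t: "0 < ?t" by (rule scale[OF l])
    have "mass W (cube c l) \<le> ennreal (H * ?t powr p c) * mass (scaled ?t) (cube c l)"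
    proof (rule mass_le_cmult)
      fix x assume x: "x \<in> cube c l"
      have "1 \<le> H * ?t powr p c * ?t powr - p x"
        using H(3)[OF Q x c] t by (simp add: powr_diff powr_minus field_simps)
      then have "W x * 1 \<le> W x * (H * ?t powr p c * ?t powr - p x)" by (rule mult_left_mono) (rule W(2))
      then show "W x \<le> H * ?t powr p c * scaled ?t x" by (simp add: mult_ac)
    qed (use H in auto)
    also have "\<dots> \<le> ennreal (H * ?t powr p c) * 1" by (intro mult_left_mono normalised l) auto
    finally show "mass W (cube c l) \<le> ennreal (H * ?t powr p c)" by simp
    fix E assume E: "E \<in> sets lebesgue" "E \<subseteq> cube c l"
    show "mass (scaled ?t) E \<le> ennreal (H * ?t powr - p c) * mass W E"
    proof (rule mass_le_cmult)
      fix x assume "x \<in> E"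
      then have x: "x \<in> cube c l" using E by auto
      have "?t powr - p x \<le> H * ?t powr - p c"
        using H(3)[OF Q c x] t by (simp add: powr_diff powr_minus field_simps)
      then have "W x * ?t powr - p x \<le> W x * (H * ?t powr - p c)" by (rule mult_left_mono) (rule W(2))
      then show "scaled ?t x \<le> H * ?t powr - p c * W x" by (simp add: mult_ac)
    qed (use H E in auto)
  qed
qed

text \<open>In both cases there is a number \<open>A\<close>, the scale to a frozen exponent, such that the mass of the cube
is at most a multiple of \<open>A\<close> and the mass of \<open>E\<close> is at least a multiple of \<open>A\<close>. A cube that is not
distant is replaced by the centred cube of four times its side.\<close>

theorem muckenhoupt:
  obtains \<beta> where "0 < \<beta>"
    "\<And>c l E. 0 < l \<Longrightarrow> E \<in> sets lebesgue \<Longrightarrow> E \<subseteq> cube c l \<Longrightarrow>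
       ennreal (1 / 2) * emeasure lebesgue (cube c l) \<le> emeasure lebesgue E \<Longrightarrow>
       ennreal \<beta> * mass W (cube c l) \<le> mass W E"
proof -
  obtain H where H: "1 \<le> H"
    "\<And>c l. distant_cube c l \<Longrightarrow> mass W (cube c l) \<le> ennreal (H * scale c l powr p c)"
    "\<And>c l E. distant_cube c l \<Longrightarrow> E \<in> sets lebesgue \<Longrightarrow> E \<subseteq> cube c l \<Longrightarrow>
       mass (scaled (scale c l)) E \<le> ennreal (H * scale c l powr - p c) * mass W E"
    by (rule distant_mass) blast
  obtain U where U: "1 \<le> U"
    "\<And>R. 1 \<le> R \<Longrightarrow> mass W (centred_cube R) \<le> ennreal (U * centred_scale R powr pinf)"
    by (rule centred_upper) blast
  \<comment> \<open>Half of a cube is this proportion of the centred cube of four times the side.\<close>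
  define \<alpha> where "\<alpha> = 1 / (2 * 4 ^ CARD('n) :: real)"
  have \<alpha>: "0 < \<alpha>" by (simp add: \<alpha>_def)
  obtain L where L: "0 < L"
    "\<And>R E. 1 \<le> R \<Longrightarrow> E \<in> sets lebesgue \<Longrightarrow> E \<subseteq> centred_cube R \<Longrightarrow>
       \<alpha> * (2 * R) ^ CARD('n) \<le> measure lebesgue E \<Longrightarrow> ennreal (L * centred_scale R powr pinf) \<le> mass W E"
    by (rule centred_lower[OF \<alpha>]) blast
  define \<beta>1 where "\<beta>1 = (1 / (2 * K)) powr P / (H * H)"
  define \<beta>2 where "\<beta>2 = L / U"
  have \<beta>: "0 < \<beta>1" "0 < \<beta>2" using H(1) K U(1) L(1) by (auto simp: \<beta>1_def \<beta>2_def)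
  have "ennreal (min \<beta>1 \<beta>2) * mass W (cube c l) \<le> mass W E"
    if l: "0 < l" and E: "E \<in> sets lebesgue" "E \<subseteq> cube c l"
      and big: "ennreal (1 / 2) * emeasure lebesgue (cube c l) \<le> emeasure lebesgue E" for c l E
  proof -
    have fin: "emeasure lebesgue E \<noteq> \<infinity>"
      using emeasure_mono[OF E(2), of lebesgue] emeasure_cube[OF l, of c] by (auto simp: top_unique)
    have "ennreal (1 / 2 * l ^ CARD('n)) \<le> ennreal (measure lebesgue E)"
      using big unfolding emeasure_cube[OF l] emeasure_eq_ennreal_measure[OF fin[unfolded infinity_ennreal_def]]
      by (subst (asm) ennreal_mult'[symmetric]) auto
    then have half: "l ^ CARD('n) / 2 \<le> measure lebesgue E" by (subst (asm) ennreal_le_iff) auto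
    consider "distant_cube c l" | "1 \<le> 2 * l" "cube c l \<subseteq> centred_cube (2 * l)"
      using distant_or_central[OF l, of c] by blast
    then show ?thesis
    proof cases
      case 1
      let ?t = "scale c l"
      have t: "0 < ?t" by (rule scale[OF l])
      have "1 / (2 * K) \<le> measure lebesgue E / (K * l ^ CARD('n))"
        using half K l by (simp add: field_simps)
      then have "(1 / (2 * K)) powr P \<le> (measure lebesgue E / (K * l ^ CARD('n))) powr P"
        using K P by (intro powr_mono2) auto
      then have "ennreal ((1 / (2 * K)) powr P) \<le> mass (scaled ?t) E"
        by (rule ennreal_le_weaken[OF spread[OF l E]])
      also have "\<dots> \<le> ennreal (H * ?t powr - p c) * mass W E" by (rule H(3)[OF 1 E])
      finally have *: "ennreal ((1 / (2 * K)) powr P / (H * ?t powr - p c)) \<le> mass W E"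
        by (intro ennreal_le_cmult_imp) (use t H(1) in auto)
      have "ennreal (min \<beta>1 \<beta>2) * mass W (cube c l) \<le> ennreal \<beta>1 * ennreal (H * ?t powr p c)"
        by (intro mult_mono ennreal_leI H(2) 1) auto
      also have "\<dots> = ennreal (\<beta>1 * (H * ?t powr p c))" using \<beta> by (simp add: ennreal_mult')
      also have "\<beta>1 * (H * ?t powr p c) = (1 / (2 * K)) powr P / (H * ?t powr - p c)"
        using t H(1) by (simp add: \<beta>1_def powr_minus field_simps)
      finally show ?thesis using * by order
    next
      case 2
      let ?t = "centred_scale (2 * l)"
      have eq: "\<alpha> * (2 * (2 * l)) ^ CARD('n) = l ^ CARD('n) / 2" by (simp add: \<alpha>_def power_mult_distrib)
      have "\<alpha> * (2 * (2 * l)) ^ CARD('n) \<le> measure lebesgue E" unfolding eq by (rule half)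
      from L(2)[OF 2(1) E(1) order_trans[OF E(2) 2(2)] this]
      have *: "ennreal (L * ?t powr pinf) \<le> mass W E" .
      have "ennreal (min \<beta>1 \<beta>2) * mass W (cube c l) \<le> ennreal \<beta>2 * mass W (centred_cube (2 * l))"
        using mass_mono_set[OF 2(2), of W] by (intro mult_mono ennreal_leI) auto
      also have "\<dots> \<le> ennreal \<beta>2 * ennreal (U * ?t powr pinf)" by (intro mult_left_mono U(2) 2) auto
      also have "\<dots> = ennreal (\<beta>2 * (U * ?t powr pinf))" using \<beta> by (simp add: ennreal_mult')
      also have "\<beta>2 * (U * ?t powr pinf) = L * ?t powr pinf" using U(1) by (simp add: \<beta>2_def)
      finally show ?thesis using * by order
    qed
  qed
  then show ?thesis using that[of "min \<beta>1 \<beta>2"] \<beta> by auto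
qed

theorem weight_reverse_Holder:
  obtains e0 C where "0 < e0" "0 < C"
    "\<And>e. 0 \<le> e \<Longrightarrow> e \<le> e0 \<Longrightarrow> reverse_Holder_bound W e C"
proof -
  obtain \<beta> where \<beta>: "0 < \<beta>"
    "\<And>c l E. 0 < l \<Longrightarrow> E \<in> sets lebesgue \<Longrightarrow> E \<subseteq> cube c l \<Longrightarrow>
       ennreal (1 / 2) * emeasure lebesgue (cube c l) \<le> emeasure lebesgue E \<Longrightarrow>
       ennreal \<beta> * mass W (cube c l) \<le> mass W E" by (rule muckenhoupt) blast
  have fin: "mass W (cube c l) < \<infinity>" if "0 < l" for c l
    using mass_cube_le[OF that, of c] by (auto simp: le_less_trans)
  show ?thesis by (rule reverse_Holder_on_cubes[OF W fin \<beta>]) (use that in blast)+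
qed

end

section \<open>Higher integrability of the normalised weight\<close>

lemma mass_add:
  assumes "f \<in> borel_measurable lebesgue" "g \<in> borel_measurable lebesgue" "E \<in> sets lebesgue"
    and "\<And>x. 0 \<le> f x" "\<And>x. 0 \<le> g x"
  shows "mass (\<lambda>x. f x + g x) E = mass f E + mass g E"
  unfolding mass_def using assms
  by (subst nn_integral_add[symmetric]) (auto intro!: nn_integral_cong simp: distrib_right ennreal_plus)

lemma mass_const:
  assumes "E \<in> sets lebesgue"
  shows "mass (\<lambda>x. k) E = ennreal k * emeasure lebesgue E"
  unfolding mass_def using assms by (rule nn_integral_cmult_indicator)

context normalised_weight
begin

text \<open>By the reverse Hoelder inequality on the large cube, the unit cube carries a proportion of its mass that
decays like a power of \<open>R\<close>. Since the mass of the unit cube is fixed, the mass of the large cube, and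
with it the scale, grows at least like a power.\<close>

lemma centred_scale_growth:
  obtains c \<delta> where "0 < c" "c \<le> 1" "0 < \<delta>" "\<And>R. 1 \<le> R \<Longrightarrow> c * R powr \<delta> \<le> centred_scale R"
proof -
  let ?n = "real CARD('n)" and ?B = "centred_cube 1 :: (real ^ 'n) set"
  obtain e C where e: "0 < e" "0 < C"
    and RH: "reverse_Holder_bound W e C"
    by (rule weight_reverse_Holder) (metis less_imp_le order_refl)
  obtain \<beta> where \<beta>: "0 < \<beta>"
    "\<And>R E. 1 \<le> R \<Longrightarrow> E \<in> sets lebesgue \<Longrightarrow> E \<subseteq> centred_cube R \<Longrightarrow>
       1 * (2 * R) ^ CARD('n) \<le> measure lebesgue E \<Longrightarrow> ennreal (\<beta> * centred_scale R powr pinf) \<le> mass W E"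
    by (rule centred_lower[of 1]) auto
  define w where "w = \<beta> * centred_scale 1 powr pinf"
  have w: "0 < w" unfolding w_def using \<beta>(1) centred_scale_pos[of 1] by simp
  have "1 * (2 * 1) ^ CARD('n) \<le> measure lebesgue ?B" using measure_cube[of "2 * 1" "\<chi> i. - 1"] by simp
  then have wB: "ennreal w \<le> mass W ?B" unfolding w_def by (intro \<beta>(2)) auto
  define v :: real where "v = 2 ^ CARD('n)"
  have v: "0 < v" by (simp add: v_def)
  define h where "h = w / (2 * v)"
  have h: "0 < h" using w v by (simp add: h_def)
  define B where "B = h powr - e * C"
  have B: "0 < B" using h e by (simp add: B_def)
  define q where "q = P * (1 + e)"
  have q: "0 < q" using P e by (simp add: q_def)
  have key: "w / (2 * B) * R powr (?n * e) \<le> max 1 (centred_scale R) powr q" if R: "1 \<le> R" for R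
  proof -
    define \<tau> where "\<tau> = max 1 (centred_scale R) powr P"
    have \<tau>: "0 < \<tau>" by (simp add: \<tau>_def)
    have R2: "0 < 2 * R" using R by simp
    have "mass W (centred_cube R) \<le> ennreal \<tau>" unfolding \<tau>_def by (rule mass_cube_le[OF R2])
    from reverse_Holder_boundD[OF RH R2 \<tau> this]
    have "mass (\<lambda>x. W x powr (1 + e)) (centred_cube R) \<le> ennreal (C * ((2 * R) ^ CARD('n)) powr - e * \<tau> powr (1 + e))" .
    then have "mass (\<lambda>x. W x powr (1 + e)) (centred_cube R) \<le> ennreal (C * R powr - (?n * e) * \<tau> powr (1 + e))"
    proof (rule le_ennreal_weaken)
      have "((2 * R) ^ CARD('n)) powr - e \<le> (R ^ CARD('n)) powr - e"
        using R e by (intro powr_mono2' power_mono) auto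
      also have "\<dots> = R powr - (?n * e)" using R by (simp add: powr_realpow[symmetric] powr_powr)
      finally show "C * ((2 * R) ^ CARD('n)) powr - e * \<tau> powr (1 + e) \<le> C * R powr - (?n * e) * \<tau> powr (1 + e)"
        using e by (intro mult_right_mono mult_left_mono) auto
    qed
    then have large: "mass (\<lambda>x. W x powr (1 + e)) ?B \<le> ennreal (C * R powr - (?n * e) * \<tau> powr (1 + e))"
      by (rule order_trans[OF mass_mono_set[OF centred_cube_mono[OF R]]])
    \<comment> \<open>The constant \<open>h\<close> is such that its share is half of the lower bound \<open>w\<close> for the mass of \<open>?B\<close>.\<close>
    have "mass W ?B \<le> ennreal 1 * mass (\<lambda>x. h + h powr - e * W x powr (1 + e)) ?B"
    proof (rule mass_le_cmult)
      fix x
      show "W x \<le> 1 * (h + h powr - e * W x powr (1 + e))"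
      proof (cases "W x \<le> h")
        case True
        then show ?thesis by (simp add: add_increasing2)
      next
        case False
        then have "h powr e * W x \<le> W x powr e * W x"
          using h e W(2)[of x] by (intro mult_right_mono powr_mono2) auto
        also have "\<dots> = W x powr (1 + e)" using False h by (simp add: powr_add mult.commute)
        finally have "W x \<le> h powr - e * W x powr (1 + e)" using h by (simp add: powr_minus field_simps)
        then show ?thesis using h by simp
      qed
    qed auto
    also have "\<dots> = ennreal h * emeasure lebesgue ?B + mass (\<lambda>x. h powr - e * W x powr (1 + e)) ?B"
      using h by (simp add: mass_add mass_const)
    also have "\<dots> \<le> ennreal h * ennreal v + ennreal (h powr - e) * ennreal (C * R powr - (?n * e) * \<tau> powr (1 + e))"
    proof (intro add_mono mult_left_mono)
      show "emeasure lebesgue ?B \<le> ennreal v" using emeasure_cube[of "2 * 1" "(\<chi> i. - 1) :: real ^ 'n"] by (simp add: v_def)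
      have "mass (\<lambda>x. h powr - e * W x powr (1 + e)) ?B \<le> ennreal (h powr - e) * mass (\<lambda>x. W x powr (1 + e)) ?B"
        by (rule mass_le_cmult) auto
      also have "\<dots> \<le> ennreal (h powr - e) * ennreal (C * R powr - (?n * e) * \<tau> powr (1 + e))"
        by (intro mult_left_mono large) auto
      finally show "mass (\<lambda>x. h powr - e * W x powr (1 + e)) ?B
        \<le> ennreal (h powr - e) * ennreal (C * R powr - (?n * e) * \<tau> powr (1 + e))" .
    qed auto
    also have "\<dots> = ennreal (h * v + B * R powr - (?n * e) * \<tau> powr (1 + e))"
      using h v e by (simp add: B_def ennreal_mult'[symmetric] mult.assoc)
    finally have "ennreal w \<le> ennreal (h * v + B * R powr - (?n * e) * \<tau> powr (1 + e))"
      by (rule order_trans[OF wB])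
    then have "w \<le> h * v + B * R powr - (?n * e) * \<tau> powr (1 + e)"
      using h v B by (subst (asm) ennreal_le_iff) auto
    moreover have "h * v = w / 2" using v by (simp add: h_def)
    ultimately have "w / 2 \<le> B * R powr - (?n * e) * \<tau> powr (1 + e)" by linarith
    also have "\<dots> = B * \<tau> powr (1 + e) / R powr (?n * e)"
      unfolding powr_minus_divide by simp
    finally have "w / 2 \<le> B * \<tau> powr (1 + e) / R powr (?n * e)" .
    moreover have "0 < R powr (?n * e)" using R by simp
    ultimately have "w / 2 * R powr (?n * e) \<le> \<tau> powr (1 + e) * B"
      by (simp only: pos_le_divide_eq mult.commute[of B])
    then have "w / 2 * R powr (?n * e) / B \<le> \<tau> powr (1 + e)" by (simp only: pos_divide_le_eq[OF B])
    then have "w / (2 * B) * R powr (?n * e) \<le> \<tau> powr (1 + e)" by simp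
    then show ?thesis by (simp add: \<tau>_def q_def powr_powr)
  qed
  define c0 where "c0 = min 1 (centred_scale 1 / K powr P)"
  have c0: "0 < c0" "c0 \<le> 1" unfolding c0_def using centred_scale_pos[of 1] K by auto
  define c1 where "c1 = (w / (2 * B)) powr (1 / q)"
  have c1: "0 < c1" using w B by (simp add: c1_def)
  have "min 1 (c0 * c1) * R powr (?n * e / q) \<le> centred_scale R" if R: "1 \<le> R" for R
  proof -
    define t where "t = centred_scale R"
    have t: "0 < t" "c0 \<le> t"
      unfolding t_def c0_def using centred_scale_pos[of R] centred_scale_ge[OF R] R by (auto intro: min.coboundedI2)
    have "c1 * R powr (?n * e / q) = (w / (2 * B) * R powr (?n * e)) powr (1 / q)"
      unfolding c1_def powr_mult powr_powr by simp
    also have "\<dots> \<le> (max 1 t powr q) powr (1 / q)"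
      using key[OF R] w B q by (intro powr_mono2) (auto simp: t_def)
    also have "\<dots> = max 1 t" using q by (simp add: powr_powr)
    finally have "c0 * (c1 * R powr (?n * e / q)) \<le> c0 * max 1 t" using c0 by (intro mult_left_mono) auto
    also have "c0 * max 1 t \<le> t"
      using c0 t mult_right_mono[of c0 1 t] by (auto simp: max_def)
    finally have "c0 * c1 * R powr (?n * e / q) \<le> t" by (simp add: mult.assoc)
    moreover have "min 1 (c0 * c1) * R powr (?n * e / q) \<le> c0 * c1 * R powr (?n * e / q)"
      by (intro mult_right_mono) auto
    ultimately show ?thesis unfolding t_def by linarith
  qed
  moreover have "0 < ?n * e / q" using e q by simp
  ultimately show ?thesis using that[of "min 1 (c0 * c1)" "?n * e / q"] c0 c1 by auto
qed

text \<open>The number \<open>\<nu>\<close> plays the part of the norm of the indicator of the cube. The second bound says that it is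
not too small, the first is the reverse Hoelder inequality relative to the measure \<open>\<nu> powr - p\<close>, for the
density of the normalised weight with respect to it.\<close>

definition admissible :: "real \<Rightarrow> real \<Rightarrow> real ^ 'n \<Rightarrow> real \<Rightarrow> bool" where
  "admissible e C c l \<longleftrightarrow> (\<exists>\<nu>>0.
     mass (\<lambda>x. scaled (scale c l) x powr (1 + e) * \<nu> powr (e * p x)) (cube c l) \<le> ennreal C \<and>
     mass (\<lambda>x. \<nu> powr - p x) (cube c l) \<le> ennreal C)"

lemma admissible_mono: "admissible e C c l \<Longrightarrow> C \<le> C' \<Longrightarrow> admissible e C' c l"
  unfolding admissible_def using le_ennreal_weaken by blast

text \<open>Once the two factors with variable exponents are bounded by constants on \<open>E\<close>, only the reverse Hoelder
inequality for \<open>W\<close> on a surrounding cube is left.\<close>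

lemma frozen_reverse_Holder:
  assumes e: "0 \<le> e" and RH: "reverse_Holder_bound W e C"
    and Q: "0 < l" "0 < \<tau>" "mass W (cube c l) \<le> ennreal \<tau>" and E: "E \<in> sets lebesgue" "E \<subseteq> cube c l"
    and h: "\<And>x. x \<in> E \<Longrightarrow> t powr - p x \<le> h" and k: "\<And>x. x \<in> E \<Longrightarrow> \<nu> powr p x \<le> k"
  shows "mass (\<lambda>x. scaled t x powr (1 + e) * \<nu> powr (e * p x)) E
    \<le> ennreal (h powr (1 + e) * k powr e * (C * (l ^ CARD('n)) powr - e * \<tau> powr (1 + e)))"
proof -
  have "mass (\<lambda>x. scaled t x powr (1 + e) * \<nu> powr (e * p x)) E
      \<le> ennreal (h powr (1 + e) * k powr e) * mass (\<lambda>x. W x powr (1 + e)) E"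
  proof (rule mass_le_cmult)
    fix x assume x: "x \<in> E"
    have "scaled t x powr (1 + e) \<le> (W x * h) powr (1 + e)"
      using h[OF x] W(2)[of x] e by (intro powr_mono2 mult_left_mono) auto
    also have "\<dots> = W x powr (1 + e) * h powr (1 + e)" by (rule powr_mult)
    finally have 1: "scaled t x powr (1 + e) \<le> W x powr (1 + e) * h powr (1 + e)" .
    have "\<nu> powr (e * p x) = (\<nu> powr p x) powr e" by (simp add: powr_powr mult.commute)
    also have "\<dots> \<le> k powr e" using k[OF x] e by (intro powr_mono2) auto
    finally have 2: "\<nu> powr (e * p x) \<le> k powr e" .
    show "scaled t x powr (1 + e) * \<nu> powr (e * p x) \<le> h powr (1 + e) * k powr e * W x powr (1 + e)"
      using mult_mono[OF 1 2] by (simp add: mult_ac)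
  qed (use E in auto)
  also have "\<dots> \<le> ennreal (h powr (1 + e) * k powr e) * ennreal (C * (l ^ CARD('n)) powr - e * \<tau> powr (1 + e))"
    using reverse_Holder_boundD[OF RH Q] by (intro mult_left_mono order_trans[OF mass_mono_set[OF E(2)]]) auto
  finally show ?thesis by (simp add: ennreal_mult')
qed

text \<open>On a distant cube both the scale and \<open>\<nu> = l powr (n / p c)\<close> have frozen exponents, so the claim is the
reverse Hoelder inequality up to constants.\<close>

lemma distant_admissible:
  assumes e: "0 < e" and C: "0 < C"
    and RH: "reverse_Holder_bound W e C"
  obtains C' where "\<And>c l. distant_cube c l \<Longrightarrow> admissible e C' c l"
proof -
  let ?n = "real CARD('n)"
  obtain H where H: "1 \<le> H"
    "\<And>c l x y. distant_cube c l \<Longrightarrow> x \<in> cube c l \<Longrightarrow> y \<in> cube c l \<Longrightarrow> l powr (p x - p y) \<le> H"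
    "\<And>c l x y. distant_cube c l \<Longrightarrow> x \<in> cube c l \<Longrightarrow> y \<in> cube c l \<Longrightarrow> scale c l powr (p x - p y) \<le> H"
    by (rule distant_comparability) blast
  obtain U where U: "1 \<le> U"
    "\<And>c l. distant_cube c l \<Longrightarrow> mass W (cube c l) \<le> ennreal (U * scale c l powr p c)"
    by (rule distant_mass) blast
  define G where "G = H powr ?n"
  have G: "0 \<le> G" by (simp add: G_def)
  define C' where "C' = C * (H powr (1 + e) * G powr e * U powr (1 + e)) + G"
  have "admissible e C' c l" if Q: "distant_cube c l" for c l
  proof -
    have l: "0 < l" using Q by (simp add: distant_cube_def)
    then have c: "c \<in> cube c l" by (simp add: mem_cube)
    define t where "t = scale c l"
    have t: "0 < t" unfolding t_def by (rule scale[OF l])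
    define A where "A = t powr p c"
    have A: "0 < A" using t by (simp add: A_def)
    define v where "v = l ^ CARD('n)"
    have v: "0 < v" "v = l powr ?n" using l by (auto simp: v_def powr_realpow)
    define \<nu> where "\<nu> = l powr (?n / p c)"
    have \<nu>: "0 < \<nu>" using l by (simp add: \<nu>_def)
    have pc: "0 < p c" using p(1)[of c] by simp
    have root: "(l powr d) powr (?n / p c) \<le> G" if "l powr d \<le> H" for d
    proof -
      have "(l powr d) powr (?n / p c) \<le> H powr (?n / p c)" using that pc by (intro powr_mono2) auto
      also have "?n / p c \<le> ?n / 1" using p(1)[of c] by (intro divide_left_mono) auto
      then have "H powr (?n / p c) \<le> H powr ?n" using H(1) by (intro powr_mono) auto
      finally show ?thesis by (simp add: G_def)
    qed
    have \<nu>_le: "\<nu> powr p x \<le> v * G" if x: "x \<in> cube c l" for x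
    proof -
      have "\<nu> powr p x = v * (l powr (p x - p c)) powr (?n / p c)"
        using l pc by (simp add: \<nu>_def v(2) powr_powr powr_add[symmetric] field_simps)
      then show ?thesis using root[OF H(2)[OF Q x c]] v by (simp add: mult_left_mono)
    qed
    have \<nu>_ge: "\<nu> powr - p x \<le> G / v" if x: "x \<in> cube c l" for x
    proof -
      have "\<nu> powr - p x = (l powr (p c - p x)) powr (?n / p c) / v"
        using l pc by (simp add: \<nu>_def v(2) powr_powr powr_diff[symmetric] field_simps)
      then show ?thesis using root[OF H(2)[OF Q c x]] v by (simp add: divide_right_mono)
    qed
    have t_le: "t powr - p x \<le> H / A" if "x \<in> cube c l" for x
      using H(3)[OF Q c that] t by (simp add: t_def[symmetric] A_def powr_diff powr_minus field_simps)
    have "0 < U * A" "mass W (cube c l) \<le> ennreal (U * A)" using U A Q by (auto simp: A_def t_def)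
    then have "mass (\<lambda>x. scaled t x powr (1 + e) * \<nu> powr (e * p x)) (cube c l)
        \<le> ennreal ((H / A) powr (1 + e) * (v * G) powr e * (C * v powr - e * (U * A) powr (1 + e)))"
      unfolding v_def using e by (intro frozen_reverse_Holder[OF _ RH l] t_le \<nu>_le[unfolded v_def]) auto
    also have "(H / A) powr (1 + e) * (v * G) powr e * (C * v powr - e * (U * A) powr (1 + e))
        = C * (H powr (1 + e) * G powr e * U powr (1 + e))"
      using A v H U G by (simp add: powr_mult powr_divide powr_minus field_simps)
    also have "ennreal \<dots> \<le> ennreal C'" using G by (intro ennreal_leI) (simp add: C'_def)
    finally have first: "mass (\<lambda>x. scaled t x powr (1 + e) * \<nu> powr (e * p x)) (cube c l) \<le> ennreal C'" .
    have "mass (\<lambda>x. \<nu> powr - p x) (cube c l) \<le> ennreal (G / v) * mass (\<lambda>x. 1) (cube c l)"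
      by (rule mass_le_cmult) (use \<nu>_ge G v in auto)
    also have "mass (\<lambda>x. 1) (cube c l) = ennreal v" unfolding mass_const[OF lmeasurable_cbox[THEN fmeasurableD]] emeasure_cube[OF l] by (simp add: v_def)
    also have "ennreal (G / v) * ennreal v = ennreal G" using v G by (simp add: ennreal_mult'[symmetric])
    also have "\<dots> \<le> ennreal C'" using C H U by (intro ennreal_leI) (simp add: C'_def)
    finally show ?thesis using first \<nu> unfolding admissible_def t_def by blast
  qed
  then show ?thesis using that by blast
qed

text \<open>With \<open>\<nu> = R powr (n / pinf)\<close> the exponents are frozen outside a centred cube of half-side
\<open>r = R powr \<kappa>\<close>, and there the claim is the reverse Hoelder inequality. Inside, everything is estimated
crudely by powers of \<open>R\<close>; the growth of the scale provides the factor \<open>R powr - (\<delta> (1 + e))\<close>, which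
wins if \<open>\<kappa>\<close> and \<open>e\<close> are small.\<close>

lemma centred_admissible:
  assumes e: "0 < e" and C: "0 < C"
    and RH: "reverse_Holder_bound W e C"
    and growth: "0 < c" "c \<le> 1" "0 < \<delta>" "\<And>R. 1 \<le> R \<Longrightarrow> c * R powr \<delta> \<le> centred_scale R"
    and small: "2 * real CARD('n) * P * e \<le> \<delta>"
  obtains C' where "\<And>R. 1 \<le> R \<Longrightarrow> admissible e C' (\<chi> i. - R) (2 * R)"
proof -
  let ?n = "real CARD('n)"
  obtain B D where BD: "1 \<le> B" "1 \<le> D"
     "\<And>R. 1 \<le> R \<Longrightarrow> mass W (centred_cube R) \<le> ennreal (B * R powr D)"
    by (rule centred_mass_growth) blast
  obtain U where U: "1 \<le> U"
    "\<And>R. 1 \<le> R \<Longrightarrow> mass W (centred_cube R) \<le> ennreal (U * centred_scale R powr pinf)"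
    by (rule centred_upper) blast
  define N where "N = ?n * P"
  have N: "0 \<le> N" "?n \<le> N" using P by (auto simp: N_def)
  define b where "b = centred_scale 1"
  have b: "0 < b" unfolding b_def by (rule centred_scale_pos) simp
  define M0 where "M0 = \<bar>ln b\<bar> + P * ln K"
  have M0: "0 \<le> M0" using K P by (simp add: M0_def)
  \<comment> \<open>The first entry makes the mass of the inner cube harmless, the second one its measure.\<close>
  define \<kappa> where "\<kappa> = min (\<delta> / (2 * D)) (1 / pinf)"
  have \<kappa>: "0 < \<kappa>" "\<kappa> \<le> 1 / pinf" "\<kappa> * (2 * D) \<le> \<delta>"
    using growth(3) BD pinf by (auto simp: \<kappa>_def field_simps min_def)
  define H where "H = exp ((M0 + N / \<kappa>) * Cinf)"
  have H: "0 < H" by (simp add: H_def)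
  define Cfar where "Cfar = H powr (1 + e) * H powr e * C * U powr (1 + e)"
  define Cnear where "Cnear = c powr - (P * (1 + e)) * C * B powr (1 + e)"
  define C' where "C' = Cfar + Cnear + 2 ^ CARD('n) * (H + 1)"
  have Cfn: "0 \<le> Cfar" "0 \<le> Cnear" using C by (auto simp: Cfar_def Cnear_def)
  have "admissible e C' (\<chi> i. - R) (2 * R)" if R: "1 \<le> R" for R
  proof -
    have R2: "0 < 2 * R" using R by simp
    define Q where "Q = (centred_cube R :: (real ^ 'n) set)"
    define t where "t = centred_scale R"
    have t: "0 < t" unfolding t_def using R by (intro centred_scale_pos) simp
    define A where "A = t powr pinf"
    have A: "0 < A" using t by (simp add: A_def)
    define v where "v = R powr ?n"
    have v: "0 < v" "v = R ^ CARD('n)" using R by (auto simp: v_def powr_realpow)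
    define \<nu> where "\<nu> = R powr (?n / pinf)"
    have \<nu>: "1 \<le> \<nu>" unfolding \<nu>_def using R pinf by (intro ge_one_powr_ge_zero) auto
    have \<nu>_pinf: "\<nu> powr pinf = v" using pinf by (simp add: \<nu>_def v_def powr_powr)
    define r where "r = R powr \<kappa>"
    have r: "1 \<le> r" unfolding r_def using R \<kappa> by (intro ge_one_powr_ge_zero) auto
    have r2: "0 < 2 * r" using r by simp
    have ln_r: "ln r = \<kappa> * ln R" using R by (simp add: r_def ln_powr)
    have lnR: "0 \<le> ln R" using R by simp
    define near where "near = (centred_cube r :: (real ^ 'n) set)"
    have Qs: "Q \<in> sets lebesgue" "near \<in> sets lebesgue" by (auto simp: Q_def near_def)
    have lnt: "\<bar>ln t\<bar> \<le> M0 + N / \<kappa> * ln r"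
    proof -
      have "ln t \<le> ln (b * K powr P * R powr N)"
        using centred_scale_le[OF R] t b K R by (subst ln_le_cancel_iff) (auto simp: t_def b_def N_def)
      also have "\<dots> = ln b + P * ln K + N * ln R" using b K R by (simp add: ln_mult ln_powr)
      finally have 1: "ln t \<le> ln b + P * ln K + N * ln R" .
      have "ln (b / K powr P) \<le> ln t"
        using centred_scale_ge[OF R] t b K by (subst ln_le_cancel_iff) (auto simp: t_def b_def)
      then have 2: "ln b - P * ln K \<le> ln t" using b K by (simp add: ln_div ln_powr)
      have "0 \<le> N * ln R" "0 \<le> P * ln K" using N lnR P K by auto
      then have "\<bar>ln t\<bar> \<le> M0 + N * ln R" using 1 2 unfolding M0_def by linarith
      then show ?thesis using \<kappa> by (simp add: ln_r)
    qed
    have ln\<nu>: "\<bar>ln \<nu>\<bar> \<le> M0 + N / \<kappa> * ln r"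
    proof -
      have "\<bar>ln \<nu>\<bar> = ?n / pinf * ln R" using R pinf by (simp add: \<nu>_def ln_powr)
      also have "\<dots> \<le> N * ln R"
      proof (rule mult_right_mono[OF _ lnR])
        have "?n / pinf \<le> ?n / 1" using pinf by (intro divide_left_mono) auto
        then show "?n / pinf \<le> N" using N by simp
      qed
      finally show ?thesis using M0 \<kappa> by (simp add: ln_r)
    qed
    have M: "0 \<le> N / \<kappa>" using N \<kappa> by simp
    have \<nu>0: "0 < \<nu>" using \<nu> by simp
    define f where "f x = scaled t x powr (1 + e) * \<nu> powr (e * p x)" for x
    have f [measurable]: "f \<in> borel_measurable lebesgue" unfolding f_def by measurable
    have \<nu>_meas: "(\<lambda>x. \<nu> powr - p x) \<in> borel_measurable lebesgue" by measurable
    have e0: "0 \<le> e" using e by simp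

    have t_far: "t powr - p x \<le> H / A" and \<nu>_far: "\<nu> powr p x \<le> H * v" if "x \<in> Q - near" for x
    proof -
      have x: "x \<notin> centred_cube r" using that by (simp add: near_def)
      have "t powr (pinf - p x) \<le> H" unfolding H_def
        by (rule powr_off_centre(2)[OF r x t lnt M0 M])
      then show "t powr - p x \<le> H / A" using t by (simp add: A_def powr_diff powr_minus field_simps)
      have "\<nu> powr (p x - pinf) \<le> H" unfolding H_def
        by (rule powr_off_centre(1)[OF r x \<nu>0 ln\<nu> M0 M])
      then show "\<nu> powr p x \<le> H * v" using \<nu>0 v by (simp add: powr_diff \<nu>_pinf field_simps)
    qed
    have UA: "0 < U * A" using U A by simp
    have WQ: "mass W (centred_cube R) \<le> ennreal (U * A)" unfolding A_def t_def by (rule U(2)[OF R])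
    have QQ: "Q - near \<in> sets lebesgue" "Q - near \<subseteq> centred_cube R" using Qs by (auto simp: Q_def)
    have "mass f (Q - near) \<le> ennreal ((H / A) powr (1 + e) * (H * v) powr e
        * (C * ((2 * R) ^ CARD('n)) powr - e * (U * A) powr (1 + e)))"
      unfolding f_def by (rule frozen_reverse_Holder[OF e0 RH R2 UA WQ QQ t_far \<nu>_far])
    also have "\<dots> \<le> ennreal ((H / A) powr (1 + e) * (H * v) powr e * (C * v powr - e * (U * A) powr (1 + e)))"
    proof (intro ennreal_leI mult_left_mono mult_right_mono)
      show "((2 * R) ^ CARD('n)) powr - e \<le> v powr - e"
        unfolding v(2) using R e by (intro powr_mono2' power_mono) auto
    qed (use C in auto)
    also have "(H / A) powr (1 + e) * (H * v) powr e * (C * v powr - e * (U * A) powr (1 + e)) = Cfar"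
      using A v(1) H U by (simp add: Cfar_def powr_mult powr_divide powr_minus field_simps)
    finally have far: "mass f (Q - near) \<le> ennreal Cfar" .

    define \<sigma> where "\<sigma> = c powr - P * R powr - \<delta>"
    have \<sigma>: "0 \<le> \<sigma>" by (simp add: \<sigma>_def)
    have t_le: "t powr - p x \<le> \<sigma>" for x
    proof -
      have g: "0 < c * R powr \<delta>" using growth R by simp
      have "t powr - p x \<le> (c * R powr \<delta>) powr - p x"
        using growth(4)[OF R] g p(1)[of x] unfolding t_def by (intro powr_mono2') auto
      also have "\<dots> = c powr - p x * R powr - (\<delta> * p x)" using growth(1) R by (simp add: powr_mult powr_powr)
      also have "\<dots> \<le> c powr - P * R powr - \<delta>"
        using growth(1-3) R p[of x] by (intro mult_mono powr_mono powr_mono') auto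
      finally show ?thesis by (simp add: \<sigma>_def)
    qed
    have \<nu>_le: "\<nu> powr p x \<le> R powr N" for x
    proof -
      have "?n * p x / pinf \<le> ?n * p x / 1" using pinf p(1)[of x] by (intro divide_left_mono) auto
      also have "\<dots> \<le> N" using p(2)[of x] by (simp add: N_def mult_left_mono)
      finally have "R powr (?n * p x / pinf) \<le> R powr N" using R by (intro powr_mono) auto
      then show ?thesis by (simp add: \<nu>_def powr_powr)
    qed
    have Br: "0 < B * r powr D" using BD r by simp
    have "mass f near \<le> ennreal (\<sigma> powr (1 + e) * (R powr N) powr e
        * (C * ((2 * r) ^ CARD('n)) powr - e * (B * r powr D) powr (1 + e)))"
      unfolding f_def near_def
      by (rule frozen_reverse_Holder[OF e0 RH r2 Br BD(3)[OF r] _ order_refl t_le \<nu>_le]) simp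
    also have "\<dots> \<le> ennreal (\<sigma> powr (1 + e) * (R powr N) powr e * (C * 1 * (B * r powr D) powr (1 + e)))"
    proof (intro ennreal_leI mult_left_mono mult_right_mono)
      have "1 \<le> (2 * r) ^ CARD('n)" using r by (intro one_le_power) auto
      then have "((2 * r) ^ CARD('n)) powr - e \<le> 1 powr - e" using e by (intro powr_mono2') auto
      then show "((2 * r) ^ CARD('n)) powr - e \<le> 1" by simp
    qed (use C in auto)
    also have "\<dots> = ennreal (\<sigma> powr (1 + e) * R powr (N * e) * (C * (B * r powr D) powr (1 + e)))"
      by (simp add: powr_powr)
    also have "\<dots> \<le> ennreal Cnear"
    proof (rule ennreal_leI)
      have "\<sigma> powr (1 + e) * R powr (N * e) * (C * (B * r powr D) powr (1 + e))
          = Cnear * (R powr - (\<delta> * (1 + e)) * R powr (N * e) * R powr (\<kappa> * D * (1 + e)))"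
        by (simp add: \<sigma>_def Cnear_def r_def powr_mult powr_powr mult_ac)
      also have "R powr - (\<delta> * (1 + e)) * R powr (N * e) * R powr (\<kappa> * D * (1 + e))
          = R powr (- (\<delta> * (1 + e)) + N * e + \<kappa> * D * (1 + e))"
        by (simp only: powr_add)
      also have "\<dots> \<le> R powr 0"
      proof (rule powr_mono[OF _ R])
        have "\<kappa> * D * (1 + e) \<le> \<delta> / 2 * (1 + e)" using \<kappa>(3) e by (intro mult_right_mono) auto
        moreover have "N * e \<le> \<delta> / 2 * 1" using small by (simp add: N_def)
        moreover have "\<delta> / 2 * 1 \<le> \<delta> / 2 * (1 + e)" using e growth by (intro mult_left_mono) auto
        ultimately show "- (\<delta> * (1 + e)) + N * e + \<kappa> * D * (1 + e) \<le> 0" by (simp add: field_simps)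
      qed
      also have "R powr 0 = 1" using R by simp
      finally show "\<sigma> powr (1 + e) * R powr (N * e) * (C * (B * r powr D) powr (1 + e)) \<le> Cnear"
        using Cfn by (simp add: mult_left_mono)
    qed
    finally have near: "mass f near \<le> ennreal Cnear" .

    have "mass f Q \<le> mass f (Q \<inter> near) + mass f (Q - near)" by (rule mass_split_le[OF f Qs])
    also have "\<dots> \<le> ennreal Cnear + ennreal Cfar"
      by (intro add_mono far order_trans[OF mass_mono_set[OF Int_lower2] near])
    also have "\<dots> = ennreal (Cnear + Cfar)" using Cfn by simp
    also have "\<dots> \<le> ennreal C'" using H by (intro ennreal_leI) (simp add: C'_def)
    finally have first: "mass f Q \<le> ennreal C'" .

    have "mass (\<lambda>x. \<nu> powr - p x) (Q - near) \<le> ennreal (H / v) * mass (\<lambda>x. 1) (Q - near)"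
    proof (rule mass_le_cmult)
      fix x assume "x \<in> Q - near"
      then have x: "x \<notin> centred_cube r" by (simp add: near_def)
      have "\<nu> powr (pinf - p x) \<le> H" unfolding H_def
        by (rule powr_off_centre(2)[OF r x \<nu>0 ln\<nu> M0 M])
      then show "\<nu> powr - p x \<le> H / v * 1" using \<nu>0 v(1) by (simp add: powr_diff powr_minus \<nu>_pinf field_simps)
    qed (use Qs H v in auto)
    also have "\<dots> \<le> ennreal (H / v) * ennreal (2 ^ CARD('n) * v)"
    proof (intro mult_left_mono)
      have "mass (\<lambda>x. 1) Q = ennreal (2 ^ CARD('n) * v)"
        unfolding mass_const[OF Qs(1)] unfolding Q_def emeasure_cube[OF R2] by (simp add: v(2) power_mult_distrib)
      then show "mass (\<lambda>x. 1) (Q - near) \<le> ennreal (2 ^ CARD('n) * v)"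
        using mass_mono_set[OF Diff_subset, of "\<lambda>x. 1" Q near] by simp
    qed auto
    also have "\<dots> = ennreal (2 ^ CARD('n) * H)" using v(1) H by (simp add: ennreal_mult'[symmetric])
    finally have far1: "mass (\<lambda>x. \<nu> powr - p x) (Q - near) \<le> ennreal (2 ^ CARD('n) * H)" .
    have "mass (\<lambda>x. \<nu> powr - p x) near \<le> ennreal (1 / \<nu>) * mass (\<lambda>x. 1) near"
    proof (rule mass_le_cmult)
      fix x
      have "\<nu> powr - p x \<le> \<nu> powr - 1" using \<nu> p(1)[of x] by (intro powr_mono) auto
      then show "\<nu> powr - p x \<le> 1 / \<nu> * 1" using \<nu>0 by (simp add: powr_minus divide_inverse)
    qed (use Qs \<nu>0 in auto)
    also have "\<dots> = ennreal (1 / \<nu>) * ennreal ((2 * r) ^ CARD('n))"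
      unfolding mass_const[OF Qs(2)] unfolding near_def emeasure_cube[OF r2] by simp
    also have "\<dots> = ennreal ((2 * r) ^ CARD('n) / \<nu>)" using \<nu>0 by (simp add: ennreal_mult'[symmetric])
    also have "\<dots> \<le> ennreal (2 ^ CARD('n))"
    proof (rule ennreal_leI)
      have "r ^ CARD('n) = R powr (\<kappa> * ?n)" using r R by (simp add: r_def powr_realpow[symmetric] powr_powr)
      also have "\<dots> \<le> \<nu>" unfolding \<nu>_def
      proof (rule powr_mono[OF _ R])
        show "\<kappa> * ?n \<le> ?n / pinf" using mult_right_mono[OF \<kappa>(2), of ?n] by simp
      qed
      finally show "(2 * r) ^ CARD('n) / \<nu> \<le> 2 ^ CARD('n)"
        using \<nu>0 by (simp add: power_mult_distrib pos_divide_le_eq)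
    qed
    finally have near1: "mass (\<lambda>x. \<nu> powr - p x) near \<le> ennreal (2 ^ CARD('n))" .
    have "mass (\<lambda>x. \<nu> powr - p x) Q \<le> mass (\<lambda>x. \<nu> powr - p x) (Q \<inter> near) + mass (\<lambda>x. \<nu> powr - p x) (Q - near)"
      by (rule mass_split_le[OF \<nu>_meas Qs])
    also have "\<dots> \<le> ennreal (2 ^ CARD('n)) + ennreal (2 ^ CARD('n) * H)"
      by (intro add_mono far1 order_trans[OF mass_mono_set[OF Int_lower2] near1])
    also have "\<dots> = ennreal (2 ^ CARD('n) * (H + 1))" using H by (simp add: distrib_left ennreal_plus[symmetric] del: ennreal_plus)
    also have "\<dots> \<le> ennreal C'" using Cfn by (intro ennreal_leI) (simp add: C'_def)
    finally show ?thesis using first \<nu>0 unfolding admissible_def f_def Q_def t_def by blast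
  qed
  then show ?thesis using that by blast
qed

theorem normalised_higher_integrability:
  obtains e1 where "0 < e1"
    "\<And>e. 0 < e \<Longrightarrow> e \<le> e1 \<Longrightarrow> \<exists>C\<ge>1. \<forall>c l. (distant_cube c l \<or> (\<exists>R\<ge>1. c = (\<chi> i. - R) \<and> l = 2 * R)) \<longrightarrow> admissible e C c l"
proof -
  obtain e0 C where RH: "0 < e0" "0 < C"
    "\<And>e. 0 \<le> e \<Longrightarrow> e \<le> e0 \<Longrightarrow> reverse_Holder_bound W e C"
    by (rule weight_reverse_Holder) blast
  obtain c \<delta> where growth: "0 < c" "c \<le> 1" "0 < \<delta>" "\<And>R. 1 \<le> R \<Longrightarrow> c * R powr \<delta> \<le> centred_scale R"
    by (rule centred_scale_growth) blast
  define k where "k = 2 * real CARD('n) * P"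
  have k: "0 < k" using P by (simp add: k_def)
  show ?thesis
  proof
    show "0 < min e0 (\<delta> / k)" using RH growth k by simp
    fix e assume e: "0 < e" "e \<le> min e0 (\<delta> / k)"
    then have small: "2 * real CARD('n) * P * e \<le> \<delta>" using k unfolding k_def[symmetric] by (simp add: field_simps)
    have RHe: "reverse_Holder_bound W e C" using e by (intro RH(3)) auto
    obtain C1 where C1: "\<And>c l. distant_cube c l \<Longrightarrow> admissible e C1 c l"
      by (rule distant_admissible[OF e(1) RH(2) RHe]) blast+
    obtain C2 where C2: "\<And>R. 1 \<le> R \<Longrightarrow> admissible e C2 (\<chi> i. - R) (2 * R)"
      by (rule centred_admissible[OF e(1) RH(2) RHe growth small]) blast+
    have "admissible e (max 1 (max C1 C2)) c l"
      if "distant_cube c l \<or> (\<exists>R\<ge>1. c = (\<chi> i. - R) \<and> l = 2 * R)" for c l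
      using that by (auto intro: admissible_mono[OF C1] admissible_mono[OF C2])
    then show "\<exists>C\<ge>1. \<forall>c l. (distant_cube c l \<or> (\<exists>R\<ge>1. c = (\<chi> i. - R) \<and> l = 2 * R)) \<longrightarrow> admissible e C c l"
      by (intro exI[of _ "max 1 (max C1 C2)"]) auto
  qed
qed

end

section \<open>Norms and modulars\<close>

text \<open>Young's inequality for three exponents without the optimal constants. The larger of the two powers
on the right-hand side already dominates the left-hand side.\<close>

lemma powr_Youngs_inequality:
  fixes x y \<theta> r q :: real
  assumes "0 \<le> x" "0 \<le> y" and pos: "0 < \<theta>" "0 < r" "0 < q" and exponents: "1 / \<theta> = 1 / r + 1 / q"
  shows "(x * y) powr \<theta> \<le> x powr r + y powr q"
proof -
  have dominated: "(x * y) powr \<theta> \<le> x powr r"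
    if "0 < x" "0 < y" "0 < r" "0 < q" "1 / \<theta> = 1 / r + 1 / q" "y powr q \<le> x powr r" for x y r q :: real
  proof -
    have "y = (y powr q) powr (1 / q)" using that by (simp add: powr_powr)
    also have "\<dots> \<le> (x powr r) powr (1 / q)" using that by (intro powr_mono2) auto
    finally have "y \<le> x powr (r / q)" by (simp add: powr_powr)
    then have "(x * y) powr \<theta> \<le> (x powr 1 * x powr (r / q)) powr \<theta>"
      using that pos by (intro powr_mono2 mult_mono) auto
    also have "\<dots> = x powr ((1 + r / q) * \<theta>)" by (simp only: powr_add[symmetric] powr_powr)
    also have "(1 + r / q) * \<theta> = r * (1 / r + 1 / q) * \<theta>" using that by (simp add: field_simps)
    also have "\<dots> = r" unfolding that(5)[symmetric] using pos by simp
    finally show ?thesis .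
  qed
  show ?thesis
  proof (cases "x = 0 \<or> y = 0")
    case False
    then have xy: "0 < x" "0 < y" using assms by auto
    show ?thesis
    proof (cases "y powr q \<le> x powr r")
      case True
      then show ?thesis using dominated[OF xy pos(2,3) exponents] by (simp add: add_increasing2)
    next
      case False
      have "(y * x) powr \<theta> \<le> y powr q"
        by (rule dominated[OF xy(2,1) pos(3,2)]) (use exponents False in auto)
      then show ?thesis by (simp add: mult.commute add_increasing)
    qed
  qed auto
qed

lemma mass_mono_AE:
  assumes "AE x in lebesgue. x \<in> E \<longrightarrow> f x \<le> g x"
  shows "mass f E \<le> mass g E"
  unfolding mass_def
proof (rule nn_integral_mono_AE)
  show "AE x in lebesgue. ennreal (f x) * indicator E x \<le> ennreal (g x) * indicator E x"
    using assms by eventually_elim (auto simp: indicator_def intro: ennreal_leI)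
qed

lemma ennreal_powr_measurable [measurable]:
  assumes [measurable]: "f \<in> borel_measurable M" "q \<in> borel_measurable M"
  shows "(\<lambda>x. ennreal_powr (f x) (q x)) \<in> borel_measurable M"
  unfolding ennreal_powr_def by measurable

lemma ennreal_powr_le_scaled:
  assumes "0 < l" "l \<le> 1" "1 \<le> q"
  shows "ennreal_powr y q \<le> ennreal l * ennreal_powr (y / ennreal l) q"
proof (cases y)
  case (real r)
  have "r powr q = l powr q * (r / l) powr q" using assms by (simp add: powr_divide)
  also have "\<dots> \<le> l powr 1 * (r / l) powr q"
    using assms by (intro mult_right_mono powr_mono') auto
  finally have "r powr q \<le> l * (r / l) powr q" using assms by simp
  then show ?thesis using real assms
    by (simp add: ennreal_powr_def divide_ennreal ennreal_mult'[symmetric] ennreal_leI)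
next
  case top
  then show ?thesis using assms by (simp add: ennreal_powr_def ennreal_top_divide ennreal_mult_top)
qed

lemma var_norm_le:
  "0 < l \<Longrightarrow> modular p (\<lambda>x. f x / ennreal l) \<le> 1 \<Longrightarrow> var_norm p f \<le> ennreal l"
  unfolding var_norm_def by (rule Inf_lower) blast

lemma var_norm_nearly_attained:
  assumes "0 < var_norm p f" "var_norm p f < \<infinity>"
  obtains l where "0 < l" "ennreal l \<le> 2 * var_norm p f" "modular p (\<lambda>x. f x / ennreal l) \<le> 1"
proof -
  obtain r where r: "var_norm p f = ennreal r" "0 < r"
    using assms by (cases "var_norm p f") auto
  then have "var_norm p f < ennreal (2 * r)" by (simp add: ennreal_less_iff)
  then obtain l where l: "0 < l" "modular p (\<lambda>x. f x / ennreal l) \<le> 1" "ennreal l < ennreal (2 * r)"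
    unfolding var_norm_def Inf_less_iff by blast
  have "ennreal (2 * r) = 2 * var_norm p f" using r by (simp add: ennreal_mult)
  then show ?thesis using that l by auto
qed

text \<open>Where the exponent is finite, convexity in the form of \<open>ennreal_powr_le_scaled\<close> bounds the
modular of \<open>f\<close> itself by arbitrarily small numbers. Where it is infinite, the essential supremum does the
same.\<close>

lemma var_norm_eq_0_imp:
  fixes p f :: "real ^ 'n \<Rightarrow> ennreal"
  assumes zero: "var_norm p f = 0"
    and p [measurable]: "p \<in> borel_measurable lebesgue" and p1: "\<And>x. 1 \<le> p x"
    and f [measurable]: "f \<in> borel_measurable lebesgue"
  shows "AE x in lebesgue. f x = 0"
proof -
  have small: "\<exists>l'>0. l' < l \<and> modular p (\<lambda>x. f x / ennreal l') \<le> 1" if "0 < l" for l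
  proof -
    have "var_norm p f < ennreal l" using zero that by simp
    then show ?thesis unfolding var_norm_def Inf_less_iff using that by (auto simp: ennreal_less_iff)
  qed
  have \<Omega>: "Omega_inf p \<in> sets lebesgue"
  proof -
    have "{x \<in> space lebesgue. p x = \<infinity>} \<in> sets lebesgue" by measurable
    then show ?thesis by (simp add: Omega_inf_def)
  qed
  then have \<Omega>': "- Omega_inf p \<in> sets lebesgue" using sets.compl_sets[OF \<Omega>] by (simp add: Compl_eq_Diff_UNIV)
  have finite_part: "AE x in lebesgue. x \<notin> Omega_inf p \<longrightarrow> f x = 0"
  proof -
    define h where "h g x = ennreal_powr (g x) (enn2real (p x)) * indicator (- Omega_inf p) x" for g :: "real ^ 'n \<Rightarrow> ennreal" and x
    have h [measurable (raw)]: "h g \<in> borel_measurable lebesgue" if [measurable]: "g \<in> borel_measurable lebesgue" for g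
      unfolding h_def using \<Omega>' by measurable
    have bound: "(\<integral>\<^sup>+x. h f x \<partial>lebesgue) \<le> ennreal l" if l: "0 < l" "l \<le> 1" for l
    proof -
      obtain l' where l': "0 < l'" "l' < l" "modular p (\<lambda>x. f x / ennreal l') \<le> 1" using small l by blast
      have "(\<integral>\<^sup>+x. h f x \<partial>lebesgue) \<le> (\<integral>\<^sup>+x. ennreal l' * h (\<lambda>x. f x / ennreal l') x \<partial>lebesgue)"
      proof (rule nn_integral_mono)
        fix x
        show "h f x \<le> ennreal l' * h (\<lambda>x. f x / ennreal l') x"
        proof (cases "x \<in> Omega_inf p")
          case False
          then obtain r where r: "p x = ennreal r" "0 \<le> r" by (cases "p x") (auto simp: Omega_inf_def)
          then have "1 \<le> enn2real (p x)" using p1[of x] by simp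
          then show ?thesis using ennreal_powr_le_scaled[of l' "enn2real (p x)" "f x"] l l' False by (simp add: h_def)
        qed (simp add: h_def)
      qed
      also have "\<dots> = ennreal l' * (\<integral>\<^sup>+x. h (\<lambda>x. f x / ennreal l') x \<partial>lebesgue)" by (rule nn_integral_cmult) measurable
      also have "(\<integral>\<^sup>+x. h (\<lambda>x. f x / ennreal l') x \<partial>lebesgue) \<le> 1"
        using l'(3) unfolding modular_def h_def by (rule order_trans[rotated]) simp
      then have "ennreal l' * (\<integral>\<^sup>+x. h (\<lambda>x. f x / ennreal l') x \<partial>lebesgue) \<le> ennreal l' * 1" by (rule mult_left_mono) simp
      finally show ?thesis using l' by (simp add: le_ennreal_weaken)
    qed
    have "(\<integral>\<^sup>+x. h f x \<partial>lebesgue) \<le> ennreal 0 + ennreal l" if "0 < l" for l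
      using le_ennreal_weaken[OF bound[of "min l 1"], of l] that by simp
    then have "(\<integral>\<^sup>+x. h f x \<partial>lebesgue) \<le> ennreal 0" by (rule ennreal_le_epsilon)
    then have "(\<integral>\<^sup>+x. h f x \<partial>lebesgue) = 0" by simp
    then have "AE x in lebesgue. h f x = 0" by (subst (asm) nn_integral_0_iff_AE) auto
    then show ?thesis
    proof eventually_elim
      case (elim x)
      show ?case
      proof
        assume "x \<notin> Omega_inf p"
        then have "ennreal_powr (f x) (enn2real (p x)) = 0" using elim by (simp add: h_def)
        then show "f x = 0" by (cases "f x") (auto simp: ennreal_powr_def split: if_splits)
      qed
    qed
  qed
  have "AE x in lebesgue. x \<in> Omega_inf p \<longrightarrow> f x \<le> ennreal (1 / real (Suc n))" for n
  proof -
    obtain l where l: "0 < l" "l < 1 / real (Suc n)" "modular p (\<lambda>x. f x / ennreal l) \<le> 1"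
      using small[of "1 / real (Suc n)"] by auto
    then have "esssup (restrict_space lebesgue (Omega_inf p)) (\<lambda>x. f x / ennreal l) \<le> 1"
      unfolding modular_def by (meson order_trans add_increasing zero_le order_refl)
    moreover have "AE x in restrict_space lebesgue (Omega_inf p).
        f x / ennreal l \<le> esssup (restrict_space lebesgue (Omega_inf p)) (\<lambda>x. f x / ennreal l)"
      by (rule esssup_AE)
    ultimately have "AE x in restrict_space lebesgue (Omega_inf p). f x / ennreal l \<le> 1"
      by (auto elim: eventually_mono)
    then have "AE x in lebesgue. x \<in> Omega_inf p \<longrightarrow> f x / ennreal l \<le> 1"
      using \<Omega> by (subst (asm) AE_restrict_space_iff) auto
    then show ?thesis
    proof eventually_elim
      case (elim x)
      show ?case
      proof
        assume "x \<in> Omega_inf p"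
        then have "f x / ennreal l \<le> 1" using elim by simp
        then have "f x \<le> ennreal l"
          using l(1) by (cases "f x") (auto simp: divide_ennreal ennreal_top_divide ennreal_le_1 top_unique intro: ennreal_leI)
        then show "f x \<le> ennreal (1 / real (Suc n))" by (rule le_ennreal_weaken) (use l in simp)
      qed
    qed
  qed
  then have "AE x in lebesgue. \<forall>n. x \<in> Omega_inf p \<longrightarrow> f x \<le> ennreal (1 / real (Suc n))"
    by (simp only: AE_all_countable) blast
  then show ?thesis using finite_part
  proof eventually_elim
    case (elim x)
    show ?case
    proof (cases "x \<in> Omega_inf p")
      case True
      show ?thesis
      proof (rule ccontr)
        assume nz: "f x \<noteq> 0"
        have "f x \<le> ennreal 1" using elim(1) True by (metis One_nat_def div_by_1 of_nat_1)
        then obtain r where r: "f x = ennreal r" "0 < r" using nz by (cases "f x") (auto simp: top_unique)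
        obtain n where "inverse (real (Suc n)) < r" using reals_Archimedean[OF r(2)] by auto
        moreover have "ennreal r \<le> ennreal (1 / real (Suc n))" using elim(1) True r by metis
        ultimately show False using r by (simp add: ennreal_le_iff inverse_eq_divide)
      qed
    qed (use elim in auto)
  qed
qed

lemma conj_exponent_eq:
  fixes q :: "'a \<Rightarrow> real"
  assumes "1 \<le> q x"
  shows "conj_exponent (\<lambda>x. ennreal (q x)) x = (if q x = 1 then \<infinity> else ennreal (q x / (q x - 1)))"
proof (cases "q x = 1")
  case False
  then have q: "1 < q x" using assms by simp
  have "1 - inverse (ennreal (q x)) = ennreal (1 - inverse (q x))"
    using q by (simp add: inverse_ennreal ennreal_minus flip: ennreal_1)
  moreover have "0 < 1 - inverse (q x)" using q by (simp add: inverse_less_1_iff)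
  ultimately have "conj_exponent (\<lambda>x. ennreal (q x)) x = ennreal (inverse (1 - inverse (q x)))"
    by (simp add: conj_exponent_def inverse_ennreal)
  also have "inverse (1 - inverse (q x)) = q x / (q x - 1)" using q by (simp add: field_simps)
  finally show ?thesis using False by simp
qed (simp add: conj_exponent_def)

text \<open>The essential supremum in the modular is taken over the empty set here, where it is the least element
\<open>0\<close>.\<close>

lemma modular_finite_exponent:
  fixes q r :: "real ^ 'n \<Rightarrow> real"
  assumes q: "\<And>x. 0 < q x" and f: "f \<in> borel_measurable lebesgue"
    and fr: "AE x in lebesgue. f x = ennreal (r x) * indicator Q x" "\<And>x. 0 \<le> r x"
  shows "modular (\<lambda>x. ennreal (q x)) f = mass (\<lambda>x. r x powr q x) Q"
proof -
  have \<Omega>: "Omega_inf (\<lambda>x. ennreal (q x)) = {}" by (simp add: Omega_inf_def)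
  have "esssup (restrict_space lebesgue ({} :: (real ^ 'n) set)) f \<le> 0"
    using f by (intro esssup_I measurable_restrict_space1) (auto simp: AE_restrict_space_iff)
  moreover have "(\<integral>\<^sup>+x. ennreal_powr (f x) (enn2real (ennreal (q x))) \<partial>lebesgue) = mass (\<lambda>x. r x powr q x) Q"
    unfolding mass_def
  proof (rule nn_integral_cong_AE)
    show "AE x in lebesgue. ennreal_powr (f x) (enn2real (ennreal (q x))) = ennreal (r x powr q x) * indicator Q x"
      using fr(1)
    proof eventually_elim
      case (elim x)
      then show ?case using q[of x] fr(2)[of x] by (auto simp: indicator_def ennreal_powr_def)
    qed
  qed
  ultimately show ?thesis unfolding modular_def \<Omega> by simp
qed

section \<open>Normalised weights from the Muckenhoupt condition\<close>

lemma cube_in_cubes: "0 < l \<Longrightarrow> cube c l \<in> cubes"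
  unfolding cubes_def by blast

lemma conj_exponent_ge_1:
  fixes q :: "'a \<Rightarrow> real"
  assumes "1 \<le> q x"
  shows "1 \<le> conj_exponent (\<lambda>x. ennreal (q x)) x"
proof (cases "q x = 1")
  case False
  then have "1 \<le> q x / (q x - 1)" using assms by (simp add: pos_le_divide_eq)
  then show ?thesis using False assms by (simp add: conj_exponent_eq)
qed (use assms in \<open>simp add: conj_exponent_eq\<close>)

lemma conj_exponent_measurable [measurable]:
  "p \<in> borel_measurable M \<Longrightarrow> conj_exponent p \<in> borel_measurable M"
  unfolding conj_exponent_def by measurable

definition norm_bounds ::
  "(real ^ 'n \<Rightarrow> real) \<Rightarrow> (real ^ 'n \<Rightarrow> ennreal) \<Rightarrow> (real ^ 'n) set \<Rightarrow> real \<Rightarrow> real \<Rightarrow> bool" where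
  "norm_bounds p w Q a b \<longleftrightarrow> 0 < a \<and> 0 < b \<and>
     modular (\<lambda>x. ennreal (p x)) (\<lambda>x. w x * indicator Q x / ennreal a) \<le> 1 \<and>
     modular (conj_exponent (\<lambda>x. ennreal (p x))) (\<lambda>x. inverse (w x) * indicator Q x / ennreal b) \<le> 1"

text \<open>The norms are infima, so they are replaced by admissible numbers at most twice as large. This requires the
norms to be positive and finite: each is positive because the weight is neither zero nor infinite on a
set of positive measure, and each is finite because the product is.\<close>

lemma Ap_class_normalisation:
  fixes p :: "real ^ 'n \<Rightarrow> real" and w :: "real ^ 'n \<Rightarrow> ennreal"
  assumes p [measurable]: "p \<in> borel_measurable lebesgue" "\<And>x. 1 \<le> p x"
    and w: "w \<in> Ap_class (\<lambda>x. ennreal (p x))"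
  obtains K0 where "0 < K0"
    "\<And>c l. 0 < l \<Longrightarrow> \<exists>a b. norm_bounds p w (cube c l) a b \<and> a * b \<le> K0 * l ^ CARD('n)"
proof -
  let ?p = "\<lambda>x. ennreal (p x)"
  have w_meas [measurable]: "w \<in> borel_measurable lebesgue"
    and w_pos: "AE x in lebesgue. 0 < w x \<and> w x < \<infinity>" and const: "Ap_const ?p w < \<infinity>"
    using w by (auto simp: Ap_class_def weight_def)
  obtain A where A: "Ap_const ?p w = ennreal A" "0 \<le> A"
    using const by (cases "Ap_const ?p w") auto
  have "\<exists>a b. norm_bounds p w (cube c l) a b \<and> a * b \<le> (4 * A + 1) * l ^ CARD('n)"
    if l: "0 < l" for c l
  proof -
    define Q where "Q = cube c l"
    have Q [measurable]: "Q \<in> sets lebesgue" by (simp add: Q_def)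
    define v where "v = l ^ CARD('n)"
    have v: "emeasure lebesgue Q = ennreal v" "0 < v" unfolding Q_def v_def using emeasure_cube[OF l] l by auto
    define N1 where "N1 = var_norm ?p (\<lambda>x. w x * indicator Q x)"
    define N2 where "N2 = var_norm (conj_exponent ?p) (\<lambda>x. inverse (w x) * indicator Q x)"
    have not_null: "\<not> (AE x in lebesgue. x \<notin> Q)"
      using v AE_iff_null_sets[OF Q] by (auto simp: null_sets_def)
    have "N1 \<noteq> 0"
    proof
      assume "N1 = 0"
      then have "AE x in lebesgue. w x * indicator Q x = 0"
        unfolding N1_def by (rule var_norm_eq_0_imp) (use p in auto)
      then have "AE x in lebesgue. x \<notin> Q" using w_pos
        by eventually_elim (auto simp: indicator_def)
      then show False using not_null by simp
    qed
    moreover have "N2 \<noteq> 0"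
    proof
      assume "N2 = 0"
      then have "AE x in lebesgue. inverse (w x) * indicator Q x = 0"
        unfolding N2_def by (rule var_norm_eq_0_imp) (use p conj_exponent_ge_1[of p, OF p(2)] in auto)
      then have "AE x in lebesgue. x \<notin> Q" using w_pos
        by eventually_elim (auto simp: indicator_def)
      then show False using not_null by simp
    qed
    moreover have le: "inverse (emeasure lebesgue Q) * N1 * N2 \<le> ennreal A"
      unfolding A(1)[symmetric] Ap_const_def N1_def N2_def Q_def by (intro SUP_upper cube_in_cubes l)
    have inv: "inverse (ennreal v) = ennreal (1 / v)" using v by (simp add: inverse_ennreal inverse_eq_divide)
    have "ennreal (1 / v) * (N1 * N2) \<le> ennreal A" using le v inv by (simp add: mult.assoc)
    then have "ennreal v * (ennreal (1 / v) * (N1 * N2)) \<le> ennreal v * ennreal A" by (rule mult_left_mono) simp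
    moreover have "ennreal v * ennreal (1 / v) = 1" using v by (simp add: ennreal_mult'[symmetric])
    ultimately have prod: "N1 * N2 \<le> ennreal (v * A)" using A v by (simp add: mult.assoc[symmetric] ennreal_mult)
    then have "N1 * N2 < \<infinity>" by (auto simp: le_less_trans)
    with \<open>N1 \<noteq> 0\<close> \<open>N2 \<noteq> 0\<close> have fin: "N1 < \<infinity>" "N2 < \<infinity>"
      by (auto simp: ennreal_mult_less_top less_top[symmetric] ennreal_mult_eq_top_iff)
    obtain a where a: "0 < a" "ennreal a \<le> 2 * N1" "modular ?p (\<lambda>x. w x * indicator Q x / ennreal a) \<le> 1"
      using var_norm_nearly_attained[of ?p "\<lambda>x. w x * indicator Q x"] \<open>N1 \<noteq> 0\<close> fin(1)
      unfolding N1_def[symmetric] by (metis not_gr_zero)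
    obtain b where b: "0 < b" "ennreal b \<le> 2 * N2"
        "modular (conj_exponent ?p) (\<lambda>x. inverse (w x) * indicator Q x / ennreal b) \<le> 1"
      using var_norm_nearly_attained[of "conj_exponent ?p" "\<lambda>x. inverse (w x) * indicator Q x"] \<open>N2 \<noteq> 0\<close> fin(2)
      unfolding N2_def[symmetric] by (metis not_gr_zero)
    have "ennreal (a * b) = ennreal a * ennreal b" using a b by (simp add: ennreal_mult)
    also have "\<dots> \<le> (2 * N1) * (2 * N2)" by (intro mult_mono a b) auto
    also have "\<dots> = 4 * (N1 * N2)" by (simp add: mult_ac)
    also have "\<dots> \<le> 4 * ennreal (v * A)" by (intro mult_left_mono prod) auto
    also have "\<dots> = ennreal (4 * (v * A))" using v A by (simp add: ennreal_mult)
    finally have "a * b \<le> 4 * (v * A)" using v A by (subst (asm) ennreal_le_iff) auto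
    then have "a * b \<le> (4 * A + 1) * v" using v by (simp add: algebra_simps)
    then show ?thesis using a b unfolding norm_bounds_def Q_def v_def by blast
  qed
  moreover have "0 < 4 * A + 1" using A by simp
  ultimately show ?thesis using that by blast
qed

text \<open>The density of the modular of \<open>1 / (u b)\<close> for the conjugate exponent, on the set where that exponent is
finite. Where \<open>p x = 1\<close> the modular controls the supremum instead, which is recorded separately.\<close>

definition dual_density :: "(real ^ 'n \<Rightarrow> real) \<Rightarrow> (real ^ 'n \<Rightarrow> real) \<Rightarrow> real \<Rightarrow> real ^ 'n \<Rightarrow> real" where
  "dual_density p u b x = (if p x = 1 then 0 else (1 / (u x * b)) powr (p x / (p x - 1)))"

lemma inverse_weight_eq:
  assumes "0 < w" "w < \<infinity>" "0 < b"
  shows "inverse w / ennreal b = ennreal (1 / (enn2real w * b))"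
proof -
  obtain r where "w = ennreal r" "0 < r" using assms(1,2) by (cases w) auto
  then show ?thesis using assms(3) by (simp add: inverse_ennreal divide_ennreal divide_inverse)
qed

lemma dual_modular_imp:
  fixes p :: "real ^ 'n \<Rightarrow> real" and w :: "real ^ 'n \<Rightarrow> ennreal"
  assumes p [measurable]: "p \<in> borel_measurable lebesgue" "\<And>x. 1 \<le> p x"
    and w_pos: "AE x in lebesgue. 0 < w x \<and> w x < \<infinity>" and b: "0 < b"
    and modular: "modular (conj_exponent (\<lambda>x. ennreal (p x))) (\<lambda>x. inverse (w x) * indicator Q x / ennreal b) \<le> 1"
  shows "mass (dual_density p (\<lambda>x. enn2real (w x)) b) Q \<le> 1"
    and "AE x in lebesgue. x \<in> Q \<longrightarrow> p x = 1 \<longrightarrow> 1 / (enn2real (w x) * b) \<le> 1"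
proof -
  let ?q = "conj_exponent (\<lambda>x. ennreal (p x))" and ?f = "\<lambda>x. inverse (w x) * indicator Q x / ennreal b"
  have \<Omega>: "Omega_inf ?q = {x. p x = 1}" using p(2) by (auto simp: Omega_inf_def conj_exponent_eq split: if_splits)
  have "{x \<in> space lebesgue. p x = 1} \<in> sets lebesgue" by measurable
  then have \<Omega>_sets: "{x. p x = 1} \<in> sets lebesgue" by simp
  have parts: "(\<integral>\<^sup>+x. ennreal_powr (?f x) (enn2real (?q x)) * indicator (- {x. p x = 1}) x \<partial>lebesgue) \<le> 1"
      "esssup (restrict_space lebesgue {x. p x = 1}) ?f \<le> 1"
    using modular unfolding modular_def \<Omega>
    by (rule order_trans[rotated], simp)+
  have "mass (dual_density p (\<lambda>x. enn2real (w x)) b) Q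
      \<le> (\<integral>\<^sup>+x. ennreal_powr (?f x) (enn2real (?q x)) * indicator (- {x. p x = 1}) x \<partial>lebesgue)"
    unfolding mass_def
  proof (rule nn_integral_mono_AE)
    show "AE x in lebesgue. ennreal (dual_density p (\<lambda>x. enn2real (w x)) b x) * indicator Q x
        \<le> ennreal_powr (?f x) (enn2real (?q x)) * indicator (- {x. p x = 1}) x"
      using w_pos
    proof eventually_elim
      case (elim x)
      show ?case
      proof (cases "x \<in> Q \<and> p x \<noteq> 1")
        case True
        then have "1 < p x" using p(2)[of x] by simp
        then have "enn2real (?q x) = p x / (p x - 1)" using p(2)[of x] by (simp add: conj_exponent_eq)
        moreover have "?f x = ennreal (1 / (enn2real (w x) * b))"
          using True inverse_weight_eq[OF _ _ b, of "w x"] elim by simp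
        ultimately show ?thesis using True b by (simp add: dual_density_def ennreal_powr_def)
      qed (auto simp: dual_density_def indicator_def)
    qed
  qed
  then show "mass (dual_density p (\<lambda>x. enn2real (w x)) b) Q \<le> 1" using parts(1) by (rule order_trans)
  have "AE x in restrict_space lebesgue {x. p x = 1}. ?f x \<le> esssup (restrict_space lebesgue {x. p x = 1}) ?f"
    by (rule esssup_AE)
  then have "AE x in restrict_space lebesgue {x. p x = 1}. ?f x \<le> 1"
    using parts(2) by (auto elim: eventually_mono)
  then have "AE x in lebesgue. x \<in> {x. p x = 1} \<longrightarrow> ?f x \<le> 1"
    using \<Omega>_sets by (subst (asm) AE_restrict_space_iff) auto
  then show "AE x in lebesgue. x \<in> Q \<longrightarrow> p x = 1 \<longrightarrow> 1 / (enn2real (w x) * b) \<le> 1"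
    using w_pos
  proof eventually_elim
    case (elim x)
    show ?case
    proof (intro impI)
      assume "x \<in> Q" "p x = 1"
      then have "ennreal (1 / (enn2real (w x) * b)) \<le> 1"
        using elim inverse_weight_eq[OF _ _ b, of "w x"] by simp
      then show "1 / (enn2real (w x) * b) \<le> 1" by (simp add: ennreal_le_1)
    qed
  qed
qed

text \<open>Write \<open>1 = t a b * (u / (t a)) * (1 / (u b))\<close> and apply Young's inequality to the last two factors.\<close>

lemma measure_le_of_dual:
  fixes p u :: "real ^ 'n \<Rightarrow> real"
  assumes p [measurable]: "p \<in> borel_measurable lebesgue" "\<And>x. 1 \<le> p x" "\<And>x. p x \<le> P"
    and u [measurable]: "u \<in> borel_measurable lebesgue" and u_pos: "AE x in lebesgue. 0 < u x"
    and a: "0 < a" and b: "0 < b" and t: "0 < t" "t \<le> 1"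
    and Q: "E \<in> sets lebesgue" "E \<subseteq> Q"
    and dual: "mass (dual_density p u b) Q \<le> 1"
      "AE x in lebesgue. x \<in> Q \<longrightarrow> p x = 1 \<longrightarrow> 1 / (u x * b) \<le> 1"
    and V: "mass (\<lambda>x. u x powr p x * a powr - p x) E \<le> ennreal (t powr P)"
  shows "emeasure lebesgue E \<le> ennreal (2 * (t * a * b))"
proof -
  let ?V = "\<lambda>x. u x powr p x * a powr - p x" and ?k = "t * a * b"
  have k: "0 < ?k" using a b t by simp
  have dual_meas [measurable]: "dual_density p u b \<in> borel_measurable lebesgue"
    unfolding dual_density_def by measurable
  have dual_nonneg: "0 \<le> dual_density p u b x" for x by (simp add: dual_density_def)
  have "emeasure lebesgue E = mass (\<lambda>x. 1) E" using mass_const[OF Q(1), of 1] by simp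
  also have "\<dots> \<le> mass (\<lambda>x. ?k * (t powr - P * ?V x + dual_density p u b x)) E"
  proof (rule mass_mono_AE)
    show "AE x in lebesgue. x \<in> E \<longrightarrow> 1 \<le> ?k * (t powr - P * ?V x + dual_density p u b x)"
      using u_pos dual(2)
    proof eventually_elim
      case (elim x)
      show ?case
      proof
        assume "x \<in> E"
        then have xQ: "x \<in> Q" using Q by auto
        define X where "X = u x / (t * a)"
        define Y where "Y = 1 / (u x * b)"
        have XY: "0 < X" "0 < Y" "1 = ?k * (X * Y)" using a b t elim(1) by (auto simp: X_def Y_def)
        have "X powr p x = t powr - p x * ?V x"
          by (simp only: X_def powr_divide powr_mult powr_minus) (simp add: divide_inverse)
        also have "\<dots> \<le> t powr - P * ?V x"
          using t p(3)[of x] by (intro mult_right_mono powr_mono') auto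
        finally have X: "X powr p x \<le> t powr - P * ?V x" .
        have "X * Y \<le> t powr - P * ?V x + dual_density p u b x"
        proof (cases "p x = 1")
          case True
          then have "Y \<le> 1" using elim(2) xQ by (simp add: Y_def)
          then have "X * Y \<le> X" using XY by (simp add: mult_left_le)
          also have "X = X powr p x" using True XY by simp
          finally show ?thesis using X dual_nonneg[of x] by linarith
        next
          case False
          then have p1: "1 < p x" using p(2)[of x] by simp
          have "(X * Y) powr 1 \<le> X powr p x + Y powr (p x / (p x - 1))"
            using XY p1 by (intro powr_Youngs_inequality) (auto simp: field_simps)
          moreover have "Y powr (p x / (p x - 1)) = dual_density p u b x"
            using False by (simp add: dual_density_def Y_def)
          ultimately show ?thesis using X XY by simp
        qed
        then show "1 \<le> ?k * (t powr - P * ?V x + dual_density p u b x)"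
          using XY(3) k by (metis mult_left_mono less_imp_le)
      qed
    qed
  qed
  also have "\<dots> \<le> ennreal ?k * mass (\<lambda>x. t powr - P * ?V x + dual_density p u b x) E"
    using Q k by (intro mass_le_cmult) auto
  also have "mass (\<lambda>x. t powr - P * ?V x + dual_density p u b x) E
      = mass (\<lambda>x. t powr - P * ?V x) E + mass (dual_density p u b) E"
    using Q dual_nonneg by (intro mass_add) auto
  also have "ennreal ?k * \<dots> \<le> ennreal ?k * (1 + 1)"
  proof (intro mult_left_mono add_mono)
    have "mass (\<lambda>x. t powr - P * ?V x) E \<le> ennreal (t powr - P) * mass ?V E"
      using Q by (intro mass_le_cmult) auto
    also have "\<dots> \<le> ennreal (t powr - P) * ennreal (t powr P)" by (intro mult_left_mono V) auto
    also have "\<dots> = 1" using t by (simp add: ennreal_mult'[symmetric] powr_add[symmetric])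
    finally show "mass (\<lambda>x. t powr - P * ?V x) E \<le> 1" .
    show "mass (dual_density p u b) E \<le> 1" by (rule order_trans[OF mass_mono_set[OF Q(2)] dual(1)])
  qed auto
  also have "ennreal ?k * (1 + 1) = ennreal (2 * ?k)" using k by (simp add: ennreal_mult mult.commute)
  finally show ?thesis .
qed

text \<open>If \<open>q = \<bar>E\<bar> / m\<close> exceeded the \<open>P\<close>-th root of the normalised mass of \<open>E\<close>, there would be a positive
\<open>t < q\<close> that is at least this root, and \<open>measure_le_of_dual\<close> would give \<open>q \<le> t\<close>. The maximum with \<open>q / 2\<close>
keeps \<open>t\<close> positive when the root vanishes.\<close>

lemma spread_of_dual:
  fixes p u :: "real ^ 'n \<Rightarrow> real"
  assumes p [measurable]: "p \<in> borel_measurable lebesgue" "\<And>x. 1 \<le> p x" "\<And>x. p x \<le> P"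
    and u [measurable]: "u \<in> borel_measurable lebesgue" and u_pos: "AE x in lebesgue. 0 < u x"
    and a: "0 < a" and b: "0 < b" and Q: "E \<in> sets lebesgue" "E \<subseteq> Q"
    and dual: "mass (dual_density p u b) Q \<le> 1"
      "AE x in lebesgue. x \<in> Q \<longrightarrow> p x = 1 \<longrightarrow> 1 / (u x * b) \<le> 1"
    and V: "mass (\<lambda>x. u x powr p x * a powr - p x) Q \<le> 1"
    and m: "2 * (a * b) \<le> m"
  shows "ennreal ((measure lebesgue E / m) powr P) \<le> mass (\<lambda>x. u x powr p x * a powr - p x) E"
proof (rule ccontr)
  let ?V = "\<lambda>x. u x powr p x * a powr - p x"
  define q where "q = measure lebesgue E / m"
  assume "\<not> ?thesis"
  then have less: "mass ?V E < ennreal (q powr P)" by (simp add: q_def)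
  have P: "1 \<le> P" using p(2,3)[of 0] by linarith
  have ab: "0 < a * b" using a b by simp
  then have m0: "0 < m" using m by linarith
  have bound: "q \<le> t" if t: "0 < t" "t \<le> 1" "mass ?V E \<le> ennreal (t powr P)" for t
  proof -
    have "emeasure lebesgue E \<le> ennreal (2 * (t * a * b))"
      by (rule measure_le_of_dual[OF p u u_pos a b t(1,2) Q dual t(3)])
    then have "measure lebesgue E \<le> 2 * (t * a * b)"
      using a b t by (simp add: measure_def enn2real_leI)
    also have "\<dots> = t * (2 * (a * b))" by simp
    also have "\<dots> \<le> t * m" using m t by (intro mult_left_mono) auto
    finally show ?thesis using m0 by (simp add: q_def pos_divide_le_eq)
  qed
  have "mass ?V E \<le> 1" by (rule order_trans[OF mass_mono_set[OF Q(2)] V])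
  then have q1: "q \<le> 1" using bound[of 1] by simp
  obtain \<epsilon> where \<epsilon>: "mass ?V E = ennreal \<epsilon>" "0 \<le> \<epsilon>" using less by (cases "mass ?V E") auto
  then have \<epsilon>q: "\<epsilon> < q powr P" using less by (simp add: ennreal_less_iff)
  moreover have "0 \<le> q" using m0 by (simp add: q_def)
  ultimately have q0: "0 < q" using \<epsilon>(2) by (cases "q = 0") auto
  define t where "t = max (q / 2) (\<epsilon> powr (1 / P))"
  have "\<epsilon> powr (1 / P) < (q powr P) powr (1 / P)" using \<epsilon> \<epsilon>q P by (intro powr_less_mono2) auto
  then have tq: "t < q" using q0 P by (simp add: t_def powr_powr)
  have t0: "0 < t" using q0 by (simp add: t_def less_max_iff_disj)
  have "(\<epsilon> powr (1 / P)) powr P \<le> t powr P" using P by (intro powr_mono2) (auto simp: t_def)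
  then have "\<epsilon> \<le> t powr P" using \<epsilon> P by (simp add: powr_powr)
  then have "q \<le> t" using tq q1 t0 \<epsilon> by (intro bound) (auto intro: ennreal_leI)
  then show False using tq by simp
qed

section \<open>Openness of the Muckenhoupt condition\<close>

lemma mass_scaled_le:
  assumes "g \<in> borel_measurable lebesgue" "E \<in> sets lebesgue" "0 < k"
    and "AE x in lebesgue. x \<in> E \<longrightarrow> f x \<le> g x / k" and "mass g E \<le> ennreal k"
  shows "mass f E \<le> 1"
proof -
  have "mass f E \<le> mass (\<lambda>x. g x / k) E" by (rule mass_mono_AE) (rule assms(4))
  also have "\<dots> \<le> ennreal (1 / k) * mass g E" using assms(1-3) by (intro mass_le_cmult) auto
  also have "\<dots> \<le> ennreal (1 / k) * ennreal k" by (intro mult_left_mono assms) auto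
  also have "\<dots> = 1" using assms(3) by (simp add: ennreal_mult'[symmetric])
  finally show ?thesis .
qed

lemma modular_weight_on_set:
  fixes q :: "real ^ 'n \<Rightarrow> real" and w :: "real ^ 'n \<Rightarrow> ennreal"
  assumes q: "\<And>x. 0 < q x" and w [measurable]: "w \<in> borel_measurable lebesgue"
    and w_pos: "AE x in lebesgue. 0 < w x \<and> w x < \<infinity>" and \<alpha>: "0 < \<alpha>" and Q [measurable]: "Q \<in> sets lebesgue"
  shows "modular (\<lambda>x. ennreal (q x)) (\<lambda>x. w x * indicator Q x / ennreal \<alpha>)
    = mass (\<lambda>x. (enn2real (w x) / \<alpha>) powr q x) Q"
proof (rule modular_finite_exponent[OF q])
  show "(\<lambda>x. w x * indicator Q x / ennreal \<alpha>) \<in> borel_measurable lebesgue" by measurable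
  show "AE x in lebesgue. w x * indicator Q x / ennreal \<alpha> = ennreal (enn2real (w x) / \<alpha>) * indicator Q x"
    using w_pos
  proof eventually_elim
    case (elim x)
    then obtain r where "w x = ennreal r" "0 < r" by (cases "w x") auto
    then show ?case using \<alpha> by (auto simp: indicator_def divide_ennreal)
  qed
  show "0 \<le> enn2real (w x) / \<alpha>" for x using \<alpha> by simp
qed

text \<open>The factor \<open>\<nu> powr (e / (1 + e))\<close> raised to the exponent \<open>(1 + e) p\<close> is \<open>\<nu> powr (e p)\<close>, the weight
in \<open>admissible\<close>. As the exponent is at least \<open>1\<close>, dividing by \<open>C\<close> inside the norm gains at least
the factor \<open>1 / C\<close>.\<close>

lemma powered_weight_modular:
  fixes p :: "real ^ 'n \<Rightarrow> real" and w :: "real ^ 'n \<Rightarrow> ennreal"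
  defines "u \<equiv> \<lambda>x. enn2real (w x)"
  assumes p [measurable]: "p \<in> borel_measurable lebesgue" "\<And>x. 1 \<le> p x"
    and w [measurable]: "w \<in> borel_measurable lebesgue" and w_pos: "AE x in lebesgue. 0 < w x \<and> w x < \<infinity>"
    and e: "0 < e" and a: "0 < a" and \<nu>: "0 < \<nu>" and C: "1 \<le> C" and Q: "Q \<in> sets lebesgue" "Q \<subseteq> Q'"
    and bound: "mass (\<lambda>x. (u x powr p x * a powr - p x) powr (1 + e) * \<nu> powr (e * p x)) Q' \<le> ennreal C"
  shows "modular (\<lambda>x. ennreal ((1 + e) * p x)) (\<lambda>x. w x * indicator Q x / ennreal (C * a / \<nu> powr (e / (1 + e)))) \<le> 1"
proof -
  define \<mu> where "\<mu> = \<nu> powr (e / (1 + e))"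
  have \<mu>: "0 < \<mu>" using \<nu> by (simp add: \<mu>_def)
  let ?\<alpha> = "C * a / \<mu>"
  have \<alpha>: "0 < ?\<alpha>" using C a \<mu> by simp
  have p0: "0 < (1 + e) * p x" for x using e p(2)[of x] by simp
  have [measurable]: "u \<in> borel_measurable lebesgue" unfolding u_def by measurable
  have "modular (\<lambda>x. ennreal ((1 + e) * p x)) (\<lambda>x. w x * indicator Q x / ennreal ?\<alpha>)
      = mass (\<lambda>x. (u x / ?\<alpha>) powr ((1 + e) * p x)) Q"
    unfolding u_def by (rule modular_weight_on_set[OF p0 w w_pos \<alpha> Q(1)])
  also have "\<dots> \<le> 1"
  proof (rule mass_scaled_le[of "\<lambda>x. (u x powr p x * a powr - p x) powr (1 + e) * \<nu> powr (e * p x)" _ C])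
    show "mass (\<lambda>x. (u x powr p x * a powr - p x) powr (1 + e) * \<nu> powr (e * p x)) Q \<le> ennreal C"
      by (rule order_trans[OF mass_mono_set[OF Q(2)] bound])
    show "AE x in lebesgue. x \<in> Q \<longrightarrow> (u x / ?\<alpha>) powr ((1 + e) * p x)
        \<le> (u x powr p x * a powr - p x) powr (1 + e) * \<nu> powr (e * p x) / C"
    proof (intro AE_I2 impI)
      fix x
      have "e / (1 + e) * ((1 + e) * p x) = e * p x" using e by (simp add: field_simps)
      then have \<mu>p: "\<mu> powr ((1 + e) * p x) = \<nu> powr (e * p x)" by (simp add: \<mu>_def powr_powr)
      have up: "(u x / a) powr ((1 + e) * p x) = (u x powr p x * a powr - p x) powr (1 + e)"
      proof -
        have "(u x / a) powr p x = u x powr p x * a powr - p x"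
          by (simp only: powr_divide powr_minus divide_inverse powr_mult) (simp add: inverse_powr)
        then show ?thesis by (metis powr_powr mult.commute)
      qed
      have "u x / ?\<alpha> = (u x / a) * \<mu> * (1 / C)" by simp
      then have "(u x / ?\<alpha>) powr ((1 + e) * p x)
          = (u x powr p x * a powr - p x) powr (1 + e) * \<nu> powr (e * p x) * (1 / C) powr ((1 + e) * p x)"
        by (simp only: powr_mult up \<mu>p)
      also have "\<dots> \<le> (u x powr p x * a powr - p x) powr (1 + e) * \<nu> powr (e * p x) * (1 / C) powr 1"
      proof (intro mult_left_mono powr_mono')
        have "1 * 1 \<le> (1 + e) * p x" using e p(2)[of x] by (intro mult_mono) auto
        then show "1 \<le> (1 + e) * p x" by simp
      qed (use C in auto)
      finally show "(u x / ?\<alpha>) powr ((1 + e) * p x)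
        \<le> (u x powr p x * a powr - p x) powr (1 + e) * \<nu> powr (e * p x) / C" using C by simp
    qed
  qed (use C Q in auto)
  finally show ?thesis by (simp add: \<mu>_def)
qed

text \<open>The reciprocals of the exponents satisfy \<open>1 / (s p)' = 1 / p' + 1 / (s' p)\<close> with \<open>s = 1 + e\<close> and
\<open>s' = s / e\<close>. Young's inequality therefore bounds the modular by the one of \<open>1 / (u b)\<close> for \<open>p'\<close> and by the
integral of \<open>\<nu> powr - p\<close>.\<close>

lemma powered_dual_modular:
  fixes p :: "real ^ 'n \<Rightarrow> real" and w :: "real ^ 'n \<Rightarrow> ennreal"
  defines "u \<equiv> \<lambda>x. enn2real (w x)"
  assumes p [measurable]: "p \<in> borel_measurable lebesgue" "\<And>x. 1 \<le> p x"
    and w [measurable]: "w \<in> borel_measurable lebesgue" and w_pos: "AE x in lebesgue. 0 < w x \<and> w x < \<infinity>"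
    and e: "0 < e" and b: "0 < b" and \<nu>: "0 < \<nu>" and C: "0 \<le> C" and Q: "Q \<in> sets lebesgue" "Q \<subseteq> Q'"
    and bound: "mass (\<lambda>x. \<nu> powr - p x) Q' \<le> ennreal C"
    and dual: "mass (dual_density p u b) Q' \<le> 1"
      "AE x in lebesgue. x \<in> Q' \<longrightarrow> p x = 1 \<longrightarrow> 1 / (u x * b) \<le> 1"
  shows "modular (conj_exponent (\<lambda>x. ennreal ((1 + e) * p x)))
    (\<lambda>x. inverse (w x) * indicator Q x / ennreal ((1 + C) * b * \<nu> powr (e / (1 + e)))) \<le> 1"
proof -
  define \<mu> where "\<mu> = \<nu> powr (e / (1 + e))"
  have \<mu>: "0 < \<mu>" using \<nu> by (simp add: \<mu>_def)
  let ?\<beta> = "(1 + C) * b * \<mu>"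
  have \<beta>: "0 < ?\<beta>" using C b \<mu> by simp
  define \<theta> where "\<theta> x = (1 + e) * p x / ((1 + e) * p x - 1)" for x
  have sp: "1 < (1 + e) * p x" for x
  proof -
    have "1 * 1 < (1 + e) * p x" using e p(2)[of x] by (intro mult_less_le_imp_less) auto
    then show ?thesis by simp
  qed
  have \<theta>1: "1 < \<theta> x" for x using sp[of x] by (simp add: \<theta>_def less_divide_eq)
  then have \<theta>0: "0 < \<theta> x" for x using less_trans[OF zero_less_one] by blast
  have conj: "conj_exponent (\<lambda>x. ennreal ((1 + e) * p x)) = (\<lambda>x. ennreal (\<theta> x))"
  proof
    fix x
    show "conj_exponent (\<lambda>x. ennreal ((1 + e) * p x)) x = ennreal (\<theta> x)"
      using conj_exponent_eq[of "\<lambda>x. (1 + e) * p x" x] sp[of x] by (simp add: \<theta>_def)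
  qed
  have [measurable]: "u \<in> borel_measurable lebesgue" unfolding u_def by measurable
  have dual_meas [measurable]: "dual_density p u b \<in> borel_measurable lebesgue"
    unfolding dual_density_def by measurable
  have dual_nonneg: "0 \<le> dual_density p u b x" for x by (simp add: dual_density_def)
  have "modular (conj_exponent (\<lambda>x. ennreal ((1 + e) * p x))) (\<lambda>x. inverse (w x) * indicator Q x / ennreal ?\<beta>)
      = mass (\<lambda>x. (1 / (u x * ?\<beta>)) powr \<theta> x) Q"
    unfolding conj
  proof (rule modular_finite_exponent[OF \<theta>0])
    show "(\<lambda>x. inverse (w x) * indicator Q x / ennreal ?\<beta>) \<in> borel_measurable lebesgue" using Q by measurable
    show "AE x in lebesgue. inverse (w x) * indicator Q x / ennreal ?\<beta> = ennreal (1 / (u x * ?\<beta>)) * indicator Q x"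
      using w_pos
    proof eventually_elim
      case (elim x)
      then show ?case using inverse_weight_eq[OF _ _ \<beta>, of "w x"] by (auto simp: u_def indicator_def)
    qed
    show "0 \<le> 1 / (u x * ?\<beta>)" for x using \<beta> by (simp add: u_def)
  qed
  also have "\<dots> \<le> 1"
  proof (rule mass_scaled_le[of "\<lambda>x. dual_density p u b x + \<nu> powr - p x" _ "1 + C"])
    have "mass (\<lambda>x. dual_density p u b x + \<nu> powr - p x) Q = mass (dual_density p u b) Q + mass (\<lambda>x. \<nu> powr - p x) Q"
      using Q dual_nonneg by (intro mass_add) auto
    also have "\<dots> \<le> 1 + ennreal C"
      by (intro add_mono order_trans[OF mass_mono_set[OF Q(2)]] dual(1) bound)
    also have "\<dots> = ennreal (1 + C)" using C by simp
    finally show "mass (\<lambda>x. dual_density p u b x + \<nu> powr - p x) Q \<le> ennreal (1 + C)" .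
    show "AE x in lebesgue. x \<in> Q \<longrightarrow> (1 / (u x * ?\<beta>)) powr \<theta> x \<le> (dual_density p u b x + \<nu> powr - p x) / (1 + C)"
      using w_pos dual(2)
    proof eventually_elim
      case (elim x)
      show ?case
      proof
        assume "x \<in> Q"
        then have xQ: "x \<in> Q'" using Q by auto
        define v where "v = 1 / (u x * b)"
        have v: "0 \<le> v" using b by (simp add: v_def u_def)
        have \<mu>_powr: "(1 / \<mu>) powr ((1 + e) * p x / e) = \<nu> powr - p x"
        proof -
          have "1 / \<mu> = \<nu> powr - (e / (1 + e))" by (simp add: \<mu>_def powr_minus_divide)
          moreover have "- (e / (1 + e)) * ((1 + e) * p x / e) = - p x"
          proof -
            define k where "k = 1 + e"
            have "k \<noteq> 0" using e by (simp add: k_def)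
            then show ?thesis using e unfolding k_def[symmetric] by simp
          qed
          ultimately show ?thesis by (simp only: powr_powr)
        qed
        have young: "(v * (1 / \<mu>)) powr \<theta> x \<le> dual_density p u b x + \<nu> powr - p x"
        proof (cases "p x = 1")
          case True
          then have "v \<le> 1" using elim(2) xQ by (simp add: v_def)
          then have "v * (1 / \<mu>) \<le> 1 * (1 / \<mu>)" using \<mu> by (intro mult_right_mono) auto
          then have "(v * (1 / \<mu>)) powr \<theta> x \<le> (1 / \<mu>) powr \<theta> x"
            using v \<mu> \<theta>0[of x] by (intro powr_mono2) auto
          also have "\<dots> = (1 / \<mu>) powr ((1 + e) * p x / e)" using True by (simp add: \<theta>_def)
          finally show ?thesis using dual_nonneg[of x] unfolding \<mu>_powr by linarith
        next
          case False
          then have p1: "1 < p x" using p(2)[of x] by simp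
          have "(v * (1 / \<mu>)) powr \<theta> x \<le> v powr (p x / (p x - 1)) + (1 / \<mu>) powr ((1 + e) * p x / e)"
          proof (rule powr_Youngs_inequality)
            show "1 / \<theta> x = 1 / (p x / (p x - 1)) + 1 / ((1 + e) * p x / e)"
            proof -
              define k where "k = 1 + e"
              have k: "k \<noteq> 0" "e = k - 1" using e by (auto simp: k_def)
              have "1 / \<theta> x = 1 - 1 / (k * p x)"
                using sp[of x] p1 k by (simp add: \<theta>_def k_def[symmetric] diff_divide_distrib)
              moreover have "1 / (p x / (p x - 1)) = 1 - 1 / p x" using p1 by (simp add: diff_divide_distrib)
              moreover have "1 / (k * p x / e) = 1 / p x - 1 / (k * p x)"
                using p1 k(1) unfolding k(2) by (simp add: diff_divide_distrib)
              ultimately show ?thesis unfolding k_def by simp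
            qed
          qed (use v \<mu> p1 e \<theta>0[of x] in auto)
          then show ?thesis using False by (simp add: \<mu>_powr dual_density_def v_def)
        qed
        have "1 / (u x * ?\<beta>) = v * (1 / \<mu>) * (1 / (1 + C))" by (simp add: v_def)
        then have "(1 / (u x * ?\<beta>)) powr \<theta> x = (v * (1 / \<mu>)) powr \<theta> x * (1 / (1 + C)) powr \<theta> x"
          by (simp only: powr_mult)
        also have "\<dots> \<le> (dual_density p u b x + \<nu> powr - p x) * (1 / (1 + C)) powr 1"
          using young \<theta>1[of x] C dual_nonneg[of x] by (intro mult_mono powr_mono') auto
        finally show "(1 / (u x * ?\<beta>)) powr \<theta> x \<le> (dual_density p u b x + \<nu> powr - p x) / (1 + C)"
          using C by simp
      qed
    qed
  qed (use C Q in auto)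
  finally show ?thesis by (simp add: \<mu>_def)
qed

text \<open>The decay condition alone bounds the exponent, since \<open>ln (shifted_norm x) \<ge> 1\<close>.\<close>

lemma log_Holder_imp:
  fixes p :: "real ^ 'n \<Rightarrow> real"
  assumes "log_Holder p" "p \<in> borel_measurable lebesgue" "\<And>x. 1 \<le> p x"
  obtains P C0 Cinf pinf where "log_Holder_exponent p P C0 Cinf pinf"
proof -
  obtain C0 Cinf pinf where loc: "\<And>x y. norm (x - y) < 1 / 2 \<Longrightarrow> \<bar>p x - p y\<bar> \<le> C0 / (- ln (norm (x - y)))"
    and dec: "\<And>x. \<bar>p x - pinf\<bar> \<le> Cinf / ln (shifted_norm x)"
    using assms(1) unfolding log_Holder_def by blast
  have "log_Holder_exponent p (pinf + \<bar>Cinf\<bar>) \<bar>C0\<bar> Cinf pinf"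
  proof
    fix x :: "real ^ 'n"
    have "Cinf / ln (shifted_norm x) \<le> \<bar>Cinf\<bar> / ln (shifted_norm x)"
      using shifted_norm_ge(3)[of x] by (intro divide_right_mono) auto
    also have "\<dots> \<le> \<bar>Cinf\<bar> / 1" using shifted_norm_ge(3)[of x] by (intro divide_left_mono) auto
    finally show "p x \<le> pinf + \<bar>Cinf\<bar>" using dec[of x] by linarith
  next
    fix x y :: "real ^ 'n" assume d: "norm (x - y) < 1 / 2"
    have "0 \<le> - ln (norm (x - y))"
    proof (cases "x = y")
      case False
      then have "ln (norm (x - y)) \<le> ln 1" using d by (subst ln_le_cancel_iff) auto
      then show ?thesis by simp
    qed simp
    then have "C0 / (- ln (norm (x - y))) \<le> \<bar>C0\<bar> / (- ln (norm (x - y)))" by (intro divide_right_mono) auto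
    then show "\<bar>p x - p y\<bar> \<le> \<bar>C0\<bar> / (- ln (norm (x - y)))" using loc[OF d] by linarith
  qed (use assms dec in auto)
  then show ?thesis using that by blast
qed

theorem corollary1p3:
  fixes p :: "real ^ 'n \<Rightarrow> real" and w :: "real ^ 'n \<Rightarrow> ennreal"
  assumes "exponent_function (\<lambda>x. ennreal (p x))"
    and "log_Holder p"
    and "esssup lebesgue (\<lambda>x. ennreal (p x)) < \<infinity>"
    and "w \<in> Ap_class (\<lambda>x. ennreal (p x))"
  shows "\<exists>r::real. r > 1 \<and> (\<forall>s\<in>{1..r}. w \<in> Ap_class (\<lambda>x. ennreal (s * p x)))"
proof -
  have p1: "1 \<le> p x" for x
    using assms(1) unfolding exponent_function_def by (metis ennreal_1 ennreal_le_iff2 zero_less_one not_le)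
  have "(\<lambda>x. enn2real (ennreal (p x))) \<in> borel_measurable lebesgue"
    by (rule measurable_compose[of _ _ borel]) (use assms(1) in \<open>auto simp: exponent_function_def\<close>)
  moreover have "enn2real (ennreal (p x)) = p x" for x using p1[of x] by simp
  ultimately have p_meas [measurable]: "p \<in> borel_measurable lebesgue" by simp
  have weight: "weight w" using assms(4) by (simp add: Ap_class_def)
  then have w_meas [measurable]: "w \<in> borel_measurable lebesgue"
    and w_pos: "AE x in lebesgue. 0 < w x \<and> w x < \<infinity>" by (auto simp: weight_def)
  obtain P C0 Cinf pinf where "log_Holder_exponent p P C0 Cinf pinf"
    by (rule log_Holder_imp[OF assms(2) p_meas p1])
  then interpret log_Holder_exponent p P C0 Cinf pinf .
  obtain K0 where K0: "0 < K0"
    and ex: "\<And>c l. 0 < l \<Longrightarrow> \<exists>a b. norm_bounds p w (cube c l) a b \<and> a * b \<le> K0 * l ^ CARD('n)"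
    using Ap_class_normalisation[OF p_meas p1 assms(4)] by blast
  then have "\<forall>c l. \<exists>a b. 0 < l \<longrightarrow> norm_bounds p w (cube c l) a b \<and> a * b \<le> K0 * l ^ CARD('n)"
    by blast
  then obtain scale codual where
    "\<forall>c l. 0 < l \<longrightarrow> norm_bounds p w (cube c l) (scale c l) (codual c l) \<and> scale c l * codual c l \<le> K0 * l ^ CARD('n)"
    unfolding choice_iff by blast
  then have scale: "0 < scale c l" and codual: "0 < codual c l"
    and prod: "scale c l * codual c l \<le> K0 * l ^ CARD('n)"
    and mod: "modular (\<lambda>x. ennreal (p x)) (\<lambda>x. w x * indicator (cube c l) x / ennreal (scale c l)) \<le> 1"
    and comod: "modular (conj_exponent (\<lambda>x. ennreal (p x))) (\<lambda>x. inverse (w x) * indicator (cube c l) x / ennreal (codual c l)) \<le> 1"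
    if "0 < l" for c l
    using that unfolding norm_bounds_def by blast+
  define u where "u x = enn2real (w x)" for x
  have u_meas [measurable]: "u \<in> borel_measurable lebesgue" unfolding u_def by measurable
  have u_pos: "AE x in lebesgue. 0 < u x"
    using w_pos by eventually_elim (auto simp: u_def enn2real_positive_iff)
  define W where "W x = u x powr p x" for x
  \<comment> \<open>The factor \<open>2\<close> is the sum of the two modulars in Young's inequality.\<close>
  define K where "K = max 1 (2 * K0)"
  have u_eq: "u = (\<lambda>x. enn2real (w x))" by (simp add: u_def fun_eq_iff)
  have normal: "mass (\<lambda>x. W x * scale c l powr - p x) (cube c l) \<le> 1" if l: "0 < l" for c l
  proof -
    have "modular (\<lambda>x. ennreal (p x)) (\<lambda>x. w x * indicator (cube c l) x / ennreal (scale c l))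
        = mass (\<lambda>x. (u x / scale c l) powr p x) (cube c l)"
      unfolding u_def using p1 scale[OF l, of c]
      by (intro modular_weight_on_set[OF _ w_meas w_pos]) (auto intro: less_le_trans[OF zero_less_one])
    moreover have "(u x / scale c l) powr p x = W x * scale c l powr - p x" for x
      unfolding W_def powr_divide powr_minus_divide by simp
    ultimately show ?thesis using mod[OF l, of c] by simp
  qed
  note dual = dual_modular_imp[OF p_meas p1 w_pos codual comod, folded u_def]
  have spread: "ennreal ((measure lebesgue E / (K * l ^ CARD('n))) powr P) \<le> mass (\<lambda>x. W x * scale c l powr - p x) E"
    if l: "0 < l" and E: "E \<in> sets lebesgue" "E \<subseteq> cube c l" for c l E
    unfolding W_def
  proof (rule spread_of_dual[OF p_meas p u_meas u_pos scale[OF l] codual[OF l] E])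
    show "mass (dual_density p u (codual c l)) (cube c l) \<le> 1" by (rule dual(1)[OF l l])
    show "AE x in lebesgue. x \<in> cube c l \<longrightarrow> p x = 1 \<longrightarrow> 1 / (u x * codual c l) \<le> 1" by (rule dual(2)[OF l l])
    show "mass (\<lambda>x. u x powr p x * scale c l powr - p x) (cube c l) \<le> 1" using normal[OF l] by (simp add: W_def)
    have "2 * (scale c l * codual c l) \<le> 2 * K0 * l ^ CARD('n)" using prod[OF l, of c] by simp
    also have "\<dots> \<le> K * l ^ CARD('n)" using l by (intro mult_right_mono) (auto simp: K_def)
    finally show "2 * (scale c l * codual c l) \<le> K * l ^ CARD('n)" .
  qed
  interpret normalised_weight p P C0 Cinf pinf W K scale
  proof
    show "W \<in> borel_measurable lebesgue" unfolding W_def by measurable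
    show "0 \<le> W x" for x by (simp add: W_def)
    show "1 \<le> K" by (simp add: K_def)
  qed (use scale normal spread in auto)
  obtain e1 where e1: "0 < e1" and
    higher: "\<And>e. 0 < e \<Longrightarrow> e \<le> e1 \<Longrightarrow> \<exists>C\<ge>1. \<forall>c l. (distant_cube c l \<or> (\<exists>R\<ge>1. c = (\<chi> i. - R) \<and> l = 2 * R)) \<longrightarrow> admissible e C c l"
    by (rule normalised_higher_integrability) blast
  have "w \<in> Ap_class (\<lambda>x. ennreal (s * p x))" if s: "1 \<le> s" "s \<le> 1 + e1" for s
  proof (cases "s = 1")
    case True
    then show ?thesis using assms(4) by simp
  next
    case False
    define e where "e = s - 1"
    have e: "0 < e" "e \<le> e1" "s = 1 + e" using s False by (auto simp: e_def)
    obtain C where C: "1 \<le> C"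
      and adm: "\<And>c l. distant_cube c l \<or> (\<exists>R\<ge>1. c = (\<chi> i. - R) \<and> l = 2 * R) \<Longrightarrow> admissible e C c l"
      using higher[OF e(1,2)] by blast
    define B where "B = C * (1 + C) * (K0 * 4 ^ CARD('n))"
    have "Ap_const (\<lambda>x. ennreal (s * p x)) w \<le> ennreal B"
      unfolding Ap_const_def
    proof (rule SUP_least)
      fix Q :: "(real ^ 'n) set" assume "Q \<in> cubes"
      then obtain c l where Q: "Q = cube c l" and l: "0 < l" unfolding cubes_def by blast
      \<comment> \<open>The norms are monotone in the cube, so it may be replaced by a larger one of comparable size.\<close>
      have "\<exists>c' l'. admissible e C c' l' \<and> cube c l \<subseteq> cube c' l' \<and> 0 < l' \<and> l' \<le> 4 * l"
      proof (cases "distant_cube c l")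
        case True
        then show ?thesis using adm l by (intro exI[of _ c] exI[of _ l]) auto
      next
        case False
        then have "1 \<le> 2 * l" "cube c l \<subseteq> centred_cube (2 * l)" using distant_or_central[OF l, of c] by auto
        then show ?thesis using l adm
          by (intro exI[of _ "\<chi> i. - (2 * l)"] exI[of _ "2 * (2 * l)"]) auto
      qed
      then obtain c' l' where adm': "admissible e C c' l'" and sub: "cube c l \<subseteq> cube c' l'" and l': "0 < l'" "l' \<le> 4 * l"
        by blast
      define a b where "a = scale c' l'" and "b = codual c' l'"
      have ab: "0 < a" "0 < b" unfolding a_def b_def using scale[OF l'(1)] codual[OF l'(1)] by auto
      obtain \<nu> where \<nu>: "0 < \<nu>"
        and first: "mass (\<lambda>x. (u x powr p x * a powr - p x) powr (1 + e) * \<nu> powr (e * p x)) (cube c' l') \<le> ennreal C"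
        and second: "mass (\<lambda>x. \<nu> powr - p x) (cube c' l') \<le> ennreal C"
        using adm' unfolding admissible_def W_def a_def by blast
      define \<mu> where "\<mu> = \<nu> powr (e / (1 + e))"
      have \<mu>: "0 < \<mu>" using \<nu> by (simp add: \<mu>_def)
      have Qs: "Q \<in> sets lebesgue" "Q \<subseteq> cube c' l'" using sub by (auto simp: Q)
      have C0: "0 \<le> C" using C by simp
      have "modular (\<lambda>x. ennreal (s * p x)) (\<lambda>x. w x * indicator Q x / ennreal (C * a / \<mu>)) \<le> 1"
        unfolding e(3) \<mu>_def
        by (rule powered_weight_modular[OF p_meas p1 w_meas w_pos e(1) ab(1) \<nu> C Qs first[unfolded u_eq]])
      then have N1: "var_norm (\<lambda>x. ennreal (s * p x)) (\<lambda>x. w x * indicator Q x) \<le> ennreal (C * a / \<mu>)"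
        using C ab \<mu> by (intro var_norm_le) auto
      have "modular (conj_exponent (\<lambda>x. ennreal (s * p x))) (\<lambda>x. inverse (w x) * indicator Q x / ennreal ((1 + C) * b * \<mu>)) \<le> 1"
        unfolding e(3) \<mu>_def
        by (rule powered_dual_modular[OF p_meas p1 w_meas w_pos e(1) ab(2) \<nu> C0 Qs second
              dual(1)[OF l'(1) l'(1), of c', folded b_def, unfolded u_eq] dual(2)[OF l'(1) l'(1), of c', folded b_def, unfolded u_eq]])
      then have N2: "var_norm (conj_exponent (\<lambda>x. ennreal (s * p x))) (\<lambda>x. inverse (w x) * indicator Q x) \<le> ennreal ((1 + C) * b * \<mu>)"
        using C ab \<mu> by (intro var_norm_le) auto
      have v: "0 < l ^ CARD('n)" using l by simp
      have inv: "inverse (emeasure lebesgue Q) = ennreal (1 / l ^ CARD('n))"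
        unfolding Q emeasure_cube[OF l] using v by (simp add: inverse_ennreal inverse_eq_divide)
      let ?product = "inverse (emeasure lebesgue Q) * var_norm (\<lambda>x. ennreal (s * p x)) (\<lambda>x. w x * indicator Q x)
          * var_norm (conj_exponent (\<lambda>x. ennreal (s * p x))) (\<lambda>x. inverse (w x) * indicator Q x)"
      have "?product \<le> ennreal (1 / l ^ CARD('n)) * ennreal (C * a / \<mu>) * ennreal ((1 + C) * b * \<mu>)"
        unfolding inv by (intro mult_mono N1 N2) auto
      also have "\<dots> = ennreal (1 / l ^ CARD('n) * (C * a / \<mu>) * ((1 + C) * b * \<mu>))"
        using v C ab \<mu> by (subst ennreal_mult[symmetric], simp, simp)+ simp
      also have "\<dots> \<le> ennreal B"
      proof (rule ennreal_leI)
        have "a * b \<le> K0 * l' ^ CARD('n)" unfolding a_def b_def by (rule prod[OF l'(1)])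
        also have "\<dots> \<le> K0 * (4 * l) ^ CARD('n)" using l' K0 by (intro mult_left_mono power_mono) auto
        finally have "C * (1 + C) * (a * b) \<le> C * (1 + C) * (K0 * (4 * l) ^ CARD('n))"
          using C by (intro mult_left_mono) auto
        also have "\<dots> = B * l ^ CARD('n)" by (simp add: B_def power_mult_distrib)
        finally have "C * (1 + C) * (a * b) / l ^ CARD('n) \<le> B" using v by (simp add: pos_divide_le_eq)
        moreover have "1 / l ^ CARD('n) * (C * a / \<mu>) * ((1 + C) * b * \<mu>) = C * (1 + C) * (a * b) / l ^ CARD('n)"
          using \<mu> by simp
        ultimately show "1 / l ^ CARD('n) * (C * a / \<mu>) * ((1 + C) * b * \<mu>) \<le> B" by simp
      qed
      finally show "?product \<le> ennreal B" .
    qed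
    then show ?thesis using weight by (auto simp: Ap_class_def le_less_trans)
  qed
  then show ?thesis using e1 by (intro exI[of _ "1 + e1"]) auto
qed

end
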